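(* Let $M$ be a smooth, connected, simply connected $n$-manifold and $\bar\sigma:M\to\mathbb{H}^n_\tau$ a non-degenerate Lagrangian immersion. Let $\sigma^-=(-\xi,\nu):M\to\mathbb{H}^{n+1,n}$ be a lift of $\bar\sigma$, i.e. $\pi_-\circ\sigma^-=\bar\sigma$ (such a lift always exists); any other lift can be written as $\sigma^-_\mu=(-f^\mu,\nu^\mu)$, where $\mu:M\to\mathbb{R}$ is a smooth function and $f^\mu=e^\mu\xi$ (resp. $\nu^\mu=e^{-\mu}\nu$) is a centroaffine immersion into $\mathbb{R}^{n+1}$ (resp. into $(\mathbb{R}^{n+1})^*$). Then: (i) each lift $\sigma^-_\mu:M\to\mathbb{H}^{n+1,n}$ is $\phi$-anti-invariant, and the induced metric coincides with that induced by $\bar\sigma$; (ii) there exists a unique function $\hat\mu$, up to an additive constant, such that the lift $\sigma^-_{\hat\mu}$ is horizontal; (iii) the centroaffine immersions $f^{\hat\mu}$ and $\nu^{\hat\mu}$ induced by $\sigma^-_{\hat\mu}$ are dual to each other and unique up to homothety.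
   Context: Everything is smooth. Pseudohyperbolic space. $V=\mathbb{R}^{n+1}\oplus(\mathbb{R}^{n+1})^*$ with $\hat{\mathbf g}((v,\alpha),(w,\beta))=\tfrac12(\alpha(w)+\beta(v))$ of signature $(n+1,n+1)$. $\mathbb{H}^{n+1,n}=\{(v,\alpha)\in V:\alpha(v)=-1\}$ with the restricted metric $g$ of signature $(n+1,n)$. At $z=(v,\alpha)$ put $\zeta_z=(v,-\alpha)\in T_z\mathbb{H}^{n+1,n}$. The horizontal space is the $g$-orthogonal complement of $\zeta_z$ in $T_z\mathbb{H}^{n+1,n}$: $\mathcal{H}_z=\{(w,\beta):\alpha(w)=0=\beta(v)\}$. The endomorphism $\phi$ of $T\mathbb{H}^{n+1,n}$ is given by $\phi(\zeta)=0$ and $\phi(w,\beta)=(w,-\beta)$ on $\mathcal{H}$. A map $\sigma:M\to\mathbb{H}^{n+1,n}$ is horizontal if $\sigma_*(X)\in\mathcal{H}$ for all $X$, and $\phi$-anti-invariant if $g(\phi(\sigma_*X),\sigma_*Y)=0$ for all $X,Y\in\Gamma(TM)$. The metric induced by $\sigma$ is $\sigma^*g$. Para-complex hyperbolic space. $\mathbb{R}$ acts freely and properly by isometries on $\mathbb{H}^{n+1,n}$ via $t\cdot(v,\alpha)=(e^tv,e^{-t}\alpha)$; $\pi_-:\mathbb{H}^{n+1,n}\to\mathbb{H}^n_\tau:=\mathbb{H}^{n+1,n}/\mathbb{R}$ is the quotient principal $\mathbb{R}$-bundle. $\mathbb{H}^n_\tau$ carries the para-Kähler structure $(\mathbf g,\mathbf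 P,\boldsymbol\omega)$, where $\mathbf g$ (signature $(n,n)$), $\mathbf P$ and $\boldsymbol\omega=\mathbf g(\cdot,\mathbf P\cdot)$ correspond to $g|_{\mathcal H}$, $\phi|_{\mathcal H}$ and $g(\cdot,\phi\cdot)|_{\mathcal H}$ under the isomorphisms $d\pi_-:\mathcal{H}_z\to T_{\pi_-(z)}\mathbb{H}^n_\tau$. An immersion $\bar\sigma$ of an $n$-manifold is Lagrangian if $\bar\sigma^*\boldsymbol\omega=0$ and non-degenerate if $\bar\sigma^*\mathbf g$ is non-degenerate; the metric induced by $\bar\sigma$ is $\bar\sigma^*\mathbf g$. Affine notions. An immersion $f:M\to W$ of an $n$-manifold into an $(n+1)$-dimensional vector space is centroaffine if $W=f_*(T_pM)\oplus\mathbb{R}f(p)$ for all $p$. For a centroaffine immersion $f:M\to\mathbb{R}^{n+1}$ its dual (conormal) immersion is the map $\nu:M\to(\mathbb{R}^{n+1})^*$ with $\nu_p(f(p))=1$ and $\nu_p(f_*X)=0$ for all $X\in T_pM$.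
   Formalization: In (i), equality of the full induced metric with that of σ̄ is claimed only for horizontal lifts (it fails for all others, which gain the square of X ↦ g(σ_*X,ζ)); for every lift the equality is stated for the pullback of g restricted to the horizontal distribution. *)

theory Defs
  imports "HOL-Analysis.Analysis"
begin

section \<open>Smooth maps and manifolds\<close>

text \<open>
  \<open>smooth_upto k S f\<close> says that \<open>f\<close> is of class C^k on the open set \<open>S\<close>. Iterated derivatives are
  taken direction by direction, so the domain is meant to be finite-dimensional.
\<close>

primrec smooth_upto ::
    "nat \<Rightarrow> 'a::real_normed_vector set \<Rightarrow> ('a \<Rightarrow> 'b::real_normed_vector) \<Rightarrow> bool" where
  "smooth_upto 0 S f \<longleftrightarrow> continuous_on S f"
| "smooth_upto (Suc k) S f \<longleftrightarrow>
     (\<forall>x\<in>S. f differentiable (at x)) \<and>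
     (\<forall>v. smooth_upto k S (\<lambda>x. frechet_derivative f (at x) v))"

definition smooth_open :: "'a::real_normed_vector set \<Rightarrow> ('a \<Rightarrow> 'b::real_normed_vector) \<Rightarrow> bool" where
  "smooth_open S f \<longleftrightarrow> (\<forall>k. smooth_upto k S f)"

text \<open>Smoothness on an arbitrary subset (used for embedded submanifolds): local smooth extendability.\<close>

definition smooth_subset :: "'a::real_normed_vector set \<Rightarrow> ('a \<Rightarrow> 'b::real_normed_vector) \<Rightarrow> bool" where
  "smooth_subset S f \<longleftrightarrow>
     (\<forall>z\<in>S. \<exists>U F. open U \<and> z \<in> U \<and> smooth_open U F \<and> (\<forall>y\<in>S \<inter> U. F y = f y))"

type_synonym ('a, 'e) chart = "'a set \<times> ('a \<Rightarrow> 'e)"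

definition chart_inv :: "('a, 'e) chart \<Rightarrow> 'e \<Rightarrow> 'a" where
  "chart_inv c = inv_into (fst c) (snd c)"

definition is_chart :: "('a::topological_space, 'e::euclidean_space) chart \<Rightarrow> bool" where
  "is_chart c \<longleftrightarrow> open (fst c) \<and> open (snd c ` fst c) \<and>
     homeomorphism (fst c) (snd c ` fst c) (snd c) (chart_inv c)"

text \<open>
  A smooth atlas on the whole type \<open>'a\<close>, modelled on \<open>'e\<close>. The separation and countability
  requirements on a manifold are carried by the type classes of \<open>'a\<close> where this is used.
\<close>

definition smooth_atlas :: "('a::topological_space, 'e::euclidean_space) chart set \<Rightarrow> bool" where
  "smooth_atlas A \<longleftrightarrow> (\<forall>c\<in>A. is_chart c) \<and> (\<Union>c\<in>A. fst c) = UNIV \<and>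
     (\<forall>c\<in>A. \<forall>d\<in>A. smooth_open (snd c ` (fst c \<inter> fst d)) (snd d \<circ> chart_inv c))"

text \<open>
  A tangent vector at \<open>p\<close> is the family of its component vectors in all charts around \<open>p\<close>,
  related by the derivatives of the coordinate changes. Components with respect to
  charts not containing \<open>p\<close> are set to \<open>0\<close>, so that families are determined by the vector.
\<close>

type_synonym ('a, 'e) tvec = "('a, 'e) chart \<Rightarrow> 'e"

definition tangent_space ::
    "('a, 'e::euclidean_space) chart set \<Rightarrow> 'a \<Rightarrow> ('a, 'e) tvec set" where
  "tangent_space A p =
     {X. (\<forall>c\<in>A. \<forall>d\<in>A. p \<in> fst c \<inter> fst d \<longrightarrow>
             X d = frechet_derivative (snd d \<circ> chart_inv c) (at (snd c p)) (X c)) \<and>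
         (\<forall>c. \<not> (c \<in> A \<and> p \<in> fst c) \<longrightarrow> X c = 0)}"

definition smooth_fun ::
    "('a, 'e::euclidean_space) chart set \<Rightarrow> ('a \<Rightarrow> 'w::real_normed_vector) \<Rightarrow> bool" where
  "smooth_fun A f \<longleftrightarrow> (\<forall>c\<in>A. smooth_open (snd c ` fst c) (f \<circ> chart_inv c))"

text \<open>
  The differential of a map into a vector space, with all tangent spaces of the target identified
  with the target itself. By the chain rule the value on \<open>tangent_space A p\<close> does not depend on the
  selected chart. The map need only be defined near \<open>p\<close>.
\<close>

definition pushv ::
    "('a, 'e::euclidean_space) chart set \<Rightarrow> ('a \<Rightarrow> 'w::real_normed_vector) \<Rightarrow> 'a \<Rightarrow> ('a, 'e) tvec \<Rightarrow> 'w" where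
  "pushv A f p X =
     (let c = (SOME c. c \<in> A \<and> p \<in> fst c)
      in frechet_derivative (f \<circ> chart_inv c) (at (snd c p)) (X c))"

definition smooth_map ::
    "('a::topological_space, 'e::euclidean_space) chart set \<Rightarrow>
     ('b::topological_space, 'f::euclidean_space) chart set \<Rightarrow> ('a \<Rightarrow> 'b) \<Rightarrow> bool" where
  "smooth_map A B F \<longleftrightarrow> continuous_on UNIV F \<and>
     (\<forall>c\<in>A. \<forall>d\<in>B. smooth_open (snd c ` (fst c \<inter> F -` fst d)) (snd d \<circ> F \<circ> chart_inv c))"

definition pushm ::
    "('a, 'e::euclidean_space) chart set \<Rightarrow> ('b, 'f::euclidean_space) chart set \<Rightarrow>
     ('a \<Rightarrow> 'b) \<Rightarrow> 'a \<Rightarrow> ('a, 'e) tvec \<Rightarrow> ('b, 'f) tvec" where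
  "pushm A B F p X =
     (\<lambda>d. if d \<in> B \<and> F p \<in> fst d then pushv A (snd d \<circ> F) p X else 0)"

section \<open>The pseudohyperbolic space\<close>

text \<open>\<open>'n rvec\<close> is R^(n+1) for \<open>n = CARD('n)\<close>, as \<open>CARD('n option) = n + 1\<close>.\<close>

type_synonym 'n rvec = "real ^ 'n option"
type_synonym 'n rcovec = "'n rvec \<Rightarrow>\<^sub>L real"
type_synonym 'n amb = "'n rvec \<times> 'n rcovec"

definition amb_metric :: "'n::finite amb \<Rightarrow> 'n amb \<Rightarrow> real" where
  "amb_metric X Y = (1/2) * (blinfun_apply (snd X) (fst Y) + blinfun_apply (snd Y) (fst X))"

definition pseudohyp :: "'n::finite amb set" where
  "pseudohyp = {z. blinfun_apply (snd z) (fst z) = -1}"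

text \<open>The kernel of the differential at \<open>z\<close> of \<open>(v, \<alpha>) \<mapsto> \<alpha> v\<close>.\<close>

definition pseudohyp_tangent :: "'n::finite amb \<Rightarrow> 'n amb set" where
  "pseudohyp_tangent z =
     {X. blinfun_apply (snd X) (fst z) + blinfun_apply (snd z) (fst X) = 0}"

definition zeta :: "'n::finite amb \<Rightarrow> 'n amb" where
  "zeta z = (fst z, - snd z)"

definition horizontal_space :: "'n::finite amb \<Rightarrow> 'n amb set" where
  "horizontal_space z = {X \<in> pseudohyp_tangent z. amb_metric X (zeta z) = 0}"

text \<open>The \<open>g\<close>-orthogonal projection onto \<open>horizontal_space z\<close>; note that \<open>g(\<zeta>,\<zeta>) = 1\<close>.\<close>

definition hor_part :: "'n::finite amb \<Rightarrow> 'n amb \<Rightarrow> 'n amb" where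
  "hor_part z X = X - amb_metric X (zeta z) *\<^sub>R zeta z"

definition phi :: "'n::finite amb \<Rightarrow> 'n amb \<Rightarrow> 'n amb" where
  "phi z X = (fst (hor_part z X), - snd (hor_part z X))"

lemma amb_metric_zeta: "z \<in> pseudohyp \<Longrightarrow> amb_metric (zeta z) (zeta z) = 1"
  by (simp add: pseudohyp_def amb_metric_def zeta_def blinfun.bilinear_simps)

lemma horizontal_space_eq:
  "horizontal_space z = {X. blinfun_apply (snd z) (fst X) = 0 \<and> blinfun_apply (snd X) (fst z) = 0}"
  by (auto simp: horizontal_space_def pseudohyp_tangent_def amb_metric_def zeta_def
      blinfun.bilinear_simps)

lemma hor_part_in:
  assumes "z \<in> pseudohyp" "X \<in> pseudohyp_tangent z"
  shows "hor_part z X \<in> horizontal_space z"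
  using assms
  by (auto simp: horizontal_space_eq hor_part_def pseudohyp_def pseudohyp_tangent_def amb_metric_def
      zeta_def blinfun.bilinear_simps algebra_simps)

lemma phi_zeta: "z \<in> pseudohyp \<Longrightarrow> phi z (zeta z) = 0"
  by (simp add: phi_def hor_part_def amb_metric_zeta zero_prod_def)

lemma phi_horizontal: "X \<in> horizontal_space z \<Longrightarrow> phi z X = (fst X, - snd X)"
  by (simp add: phi_def hor_part_def horizontal_space_def)

lemma amb_metric_split:
  assumes "z \<in> pseudohyp"
  shows "amb_metric X Y = amb_metric (hor_part z X) (hor_part z Y)
           + amb_metric X (zeta z) * amb_metric Y (zeta z)"
proof -
  have lin: "amb_metric (a - s *\<^sub>R c) (b - t *\<^sub>R c) =
      amb_metric a b - t * amb_metric a c - s * amb_metric b c + s * t * amb_metric c c"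
    for a b c :: "'a amb" and s t
    by (simp add: amb_metric_def blinfun.bilinear_simps field_simps)
  show ?thesis
    unfolding hor_part_def lin amb_metric_zeta[OF assms] by (simp add: algebra_simps)
qed

section \<open>The para-complex hyperbolic space\<close>

definition flow :: "real \<Rightarrow> 'n::finite amb \<Rightarrow> 'n amb" where
  "flow t z = (exp t *\<^sub>R fst z, exp (- t) *\<^sub>R snd z)"

definition orbit :: "'n::finite amb \<Rightarrow> 'n amb set" where
  "orbit z = range (\<lambda>t. flow t z)"

lemma pseudohyp_nonempty: "pseudohyp \<noteq> ({} :: 'n::finite amb set)"
proof -
  have "(axis None 1, - blinfun_inner_right (axis None 1)) \<in> (pseudohyp :: 'n amb set)"
    by (simp add: pseudohyp_def blinfun.bilinear_simps inner_axis_axis)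
  then show ?thesis by blast
qed

text \<open>The points of the quotient by the action of R are the orbits in \<open>pseudohyp\<close>.\<close>

typedef (overloaded) ('n::finite) parahyp = "orbit ` (pseudohyp :: 'n amb set)"
  using pseudohyp_nonempty by blast

definition proj_minus :: "'n::finite amb \<Rightarrow> 'n parahyp" where
  "proj_minus z = Abs_parahyp (orbit z)"

instantiation parahyp :: (finite) topological_space
begin

definition open_parahyp :: "'a parahyp set \<Rightarrow> bool" where
  "open_parahyp U \<longleftrightarrow> openin (top_of_set pseudohyp) {z \<in> pseudohyp. proj_minus z \<in> U}"

instance
proof
  show "open (UNIV :: 'a parahyp set)"
    by (simp add: open_parahyp_def)
next
  fix S T :: "'a parahyp set"
  assume "open S" "open T"
  then have "openin (top_of_set pseudohyp)
      ({z \<in> pseudohyp. proj_minus z \<in> S} \<inter> {z \<in> pseudohyp. proj_minus z \<in> T})"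
    unfolding open_parahyp_def by (rule openin_Int)
  moreover have "{z \<in> pseudohyp. proj_minus z \<in> S} \<inter> {z \<in> pseudohyp. proj_minus z \<in> T} =
      {z \<in> pseudohyp. proj_minus z \<in> S \<inter> T}"
    by auto
  ultimately show "open (S \<inter> T)"
    by (simp add: open_parahyp_def)
next
  fix K :: "'a parahyp set set"
  assume "\<forall>S\<in>K. open S"
  then have "openin (top_of_set pseudohyp) (\<Union>S\<in>K. {z \<in> pseudohyp. proj_minus z \<in> S})"
    unfolding open_parahyp_def by blast
  moreover have "(\<Union>S\<in>K. {z \<in> pseudohyp. proj_minus z \<in> S}) =
      {z \<in> pseudohyp. proj_minus z \<in> \<Union>K}"
    by auto
  ultimately show "open (\<Union>K)"
    by (simp add: open_parahyp_def)
qed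

end

text \<open>
  The differential at \<open>z\<close> of a map defined on \<open>pseudohyp\<close>. A derivative within a hypersurface is
  only unique along tangent directions, so this is meant for arguments in \<open>pseudohyp_tangent z\<close>.
\<close>

definition hyp_diff ::
    "('n::finite amb \<Rightarrow> 'w::real_normed_vector) \<Rightarrow> 'n amb \<Rightarrow> 'n amb \<Rightarrow> 'w" where
  "hyp_diff f z = frechet_derivative f (at z within pseudohyp)"

text \<open>
  The smooth structure on the quotient, as its maximal atlas: the charts are those
  for which \<open>x \<circ> proj_minus\<close> is a smooth submersion. This is the unique smooth
  structure making \<open>proj_minus\<close> a submersion.
\<close>

definition parahyp_atlas :: "('n::finite parahyp, (real ^ 'n) \<times> (real ^ 'n)) chart set" where
  "parahyp_atlas =
     {(U, x). is_chart (U, x) \<and>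
        smooth_subset {z \<in> pseudohyp. proj_minus z \<in> U} (x \<circ> proj_minus) \<and>
        (\<forall>z\<in>pseudohyp. proj_minus z \<in> U \<longrightarrow>
           hyp_diff (x \<circ> proj_minus) z ` pseudohyp_tangent z = UNIV)}"

type_synonym 'n ptvec = "('n parahyp, (real ^ 'n) \<times> (real ^ 'n)) tvec"

definition proj_diff :: "'n::finite amb \<Rightarrow> 'n amb \<Rightarrow> 'n ptvec" where
  "proj_diff z w =
     (\<lambda>d. if d \<in> parahyp_atlas \<and> proj_minus z \<in> fst d then hyp_diff (snd d \<circ> proj_minus) z w else 0)"

text \<open>
  The para-Kaehler structure is transported from \<open>horizontal_space z\<close>
  by the isomorphism \<open>proj_diff z\<close>. The representative \<open>z\<close> of an
  orbit is immaterial because the flow preserves \<open>g\<close>, \<open>\<zeta>\<close> and \<open>phi\<close>.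
\<close>

definition repr :: "'n::finite parahyp \<Rightarrow> 'n amb" where
  "repr q = (SOME z. z \<in> pseudohyp \<and> proj_minus z = q)"

definition hor_lift :: "'n::finite amb \<Rightarrow> 'n ptvec \<Rightarrow> 'n amb" where
  "hor_lift z X = (THE w. w \<in> horizontal_space z \<and> proj_diff z w = X)"

definition parahyp_metric :: "'n::finite parahyp \<Rightarrow> 'n ptvec \<Rightarrow> 'n ptvec \<Rightarrow> real" where
  "parahyp_metric q X Y = amb_metric (hor_lift (repr q) X) (hor_lift (repr q) Y)"

definition parahyp_P :: "'n::finite parahyp \<Rightarrow> 'n ptvec \<Rightarrow> 'n ptvec" where
  "parahyp_P q X = proj_diff (repr q) (phi (repr q) (hor_lift (repr q) X))"

definition parahyp_omega :: "'n::finite parahyp \<Rightarrow> 'n ptvec \<Rightarrow> 'n ptvec \<Rightarrow> real" where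
  "parahyp_omega q X Y = parahyp_metric q X (parahyp_P q Y)"

section \<open>Immersions into the quotient\<close>

type_synonym ('a, 'n) atlas = "('a, real ^ 'n) chart set"

definition immersion_parahyp ::
    "('a::topological_space, 'n::finite) atlas \<Rightarrow> ('a \<Rightarrow> 'n parahyp) \<Rightarrow> bool" where
  "immersion_parahyp A s \<longleftrightarrow> smooth_map A parahyp_atlas s \<and>
     (\<forall>p. inj_on (pushm A parahyp_atlas s p) (tangent_space A p))"

definition metric_parahyp ::
    "('a, 'n::finite) atlas \<Rightarrow> ('a \<Rightarrow> 'n parahyp) \<Rightarrow> 'a \<Rightarrow>
     ('a, real ^ 'n) tvec \<Rightarrow> ('a, real ^ 'n) tvec \<Rightarrow> real" where
  "metric_parahyp A s p X Y =
     parahyp_metric (s p) (pushm A parahyp_atlas s p X) (pushm A parahyp_atlas s p Y)"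

definition lagrangian :: "('a, 'n::finite) atlas \<Rightarrow> ('a \<Rightarrow> 'n parahyp) \<Rightarrow> bool" where
  "lagrangian A s \<longleftrightarrow>
     (\<forall>p. \<forall>X\<in>tangent_space A p. \<forall>Y\<in>tangent_space A p.
        parahyp_omega (s p) (pushm A parahyp_atlas s p X) (pushm A parahyp_atlas s p Y) = 0)"

definition nondegenerate :: "('a, 'n::finite) atlas \<Rightarrow> ('a \<Rightarrow> 'n parahyp) \<Rightarrow> bool" where
  "nondegenerate A s \<longleftrightarrow>
     (\<forall>p. \<forall>X\<in>tangent_space A p.
        (\<forall>Y\<in>tangent_space A p. metric_parahyp A s p X Y = 0) \<longrightarrow> X = (\<lambda>_. 0))"

section \<open>Maps into the pseudohyperbolic space\<close>

definition is_lift ::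
    "('a, 'n::finite) atlas \<Rightarrow> ('a \<Rightarrow> 'n parahyp) \<Rightarrow> ('a \<Rightarrow> 'n amb) \<Rightarrow> bool" where
  "is_lift A s \<sigma> \<longleftrightarrow> smooth_fun A \<sigma> \<and> range \<sigma> \<subseteq> pseudohyp \<and> proj_minus \<circ> \<sigma> = s"

definition horizontal :: "('a, 'n::finite) atlas \<Rightarrow> ('a \<Rightarrow> 'n amb) \<Rightarrow> bool" where
  "horizontal A \<sigma> \<longleftrightarrow> (\<forall>p. \<forall>X\<in>tangent_space A p. pushv A \<sigma> p X \<in> horizontal_space (\<sigma> p))"

definition anti_invariant :: "('a, 'n::finite) atlas \<Rightarrow> ('a \<Rightarrow> 'n amb) \<Rightarrow> bool" where
  "anti_invariant A \<sigma> \<longleftrightarrow>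
     (\<forall>p. \<forall>X\<in>tangent_space A p. \<forall>Y\<in>tangent_space A p.
        amb_metric (phi (\<sigma> p) (pushv A \<sigma> p X)) (pushv A \<sigma> p Y) = 0)"

definition induced_metric ::
    "('a, 'n::finite) atlas \<Rightarrow> ('a \<Rightarrow> 'n amb) \<Rightarrow> 'a \<Rightarrow>
     ('a, real ^ 'n) tvec \<Rightarrow> ('a, real ^ 'n) tvec \<Rightarrow> real" where
  "induced_metric A \<sigma> p X Y = amb_metric (pushv A \<sigma> p X) (pushv A \<sigma> p Y)"

text \<open>
  The pullback of \<open>g\<close> restricted to the horizontal distribution. By \<open>amb_metric_split\<close>, it
  differs from \<open>induced_metric\<close> by the square of the 1-form
  \<open>X \<mapsto> g(\<sigma>_* X, \<zeta>)\<close>, so the two agree exactly for horizontal maps.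
\<close>

definition induced_hor_metric ::
    "('a, 'n::finite) atlas \<Rightarrow> ('a \<Rightarrow> 'n amb) \<Rightarrow> 'a \<Rightarrow>
     ('a, real ^ 'n) tvec \<Rightarrow> ('a, real ^ 'n) tvec \<Rightarrow> real" where
  "induced_hor_metric A \<sigma> p X Y =
     amb_metric (hor_part (\<sigma> p) (pushv A \<sigma> p X)) (hor_part (\<sigma> p) (pushv A \<sigma> p Y))"

definition scaled :: "('a \<Rightarrow> real) \<Rightarrow> ('a \<Rightarrow> 'w::real_vector) \<Rightarrow> 'a \<Rightarrow> 'w" where
  "scaled \<mu> f p = exp (\<mu> p) *\<^sub>R f p"

definition lift_mu ::
    "('a \<Rightarrow> 'n::finite rvec) \<Rightarrow> ('a \<Rightarrow> 'n rcovec) \<Rightarrow> ('a \<Rightarrow> real) \<Rightarrow> 'a \<Rightarrow> 'n amb" where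
  "lift_mu \<xi> \<nu> \<mu> p = (- scaled \<mu> \<xi> p, scaled (\<lambda>q. - \<mu> q) \<nu> p)"

section \<open>Centroaffine immersions\<close>

text \<open>The target is meant to have dimension one more than the manifold.\<close>

definition centroaffine ::
    "('a, 'e::euclidean_space) chart set \<Rightarrow> ('a \<Rightarrow> 'w::real_normed_vector) \<Rightarrow> bool" where
  "centroaffine A f \<longleftrightarrow> smooth_fun A f \<and>
     (\<forall>p. inj_on (pushv A f p) (tangent_space A p) \<and>
          {x + y | x y. x \<in> pushv A f p ` tangent_space A p \<and> y \<in> span {f p}} = UNIV \<and>
          pushv A f p ` tangent_space A p \<inter> span {f p} = {0})"

definition dual_immersion ::
    "('a, 'e::euclidean_space) chart set \<Rightarrow> ('a \<Rightarrow> 'w::real_normed_vector) \<Rightarrow> ('a \<Rightarrow> 'w \<Rightarrow>\<^sub>L real) \<Rightarrow> bool" where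
  "dual_immersion A f \<nu> \<longleftrightarrow>
     (\<forall>p. blinfun_apply (\<nu> p) (f p) = 1 \<and>
          (\<forall>X\<in>tangent_space A p. blinfun_apply (\<nu> p) (pushv A f p X) = 0))"

definition bidual :: "'w::real_normed_vector \<Rightarrow> ('w \<Rightarrow>\<^sub>L real) \<Rightarrow>\<^sub>L real" where
  "bidual w = blinfun.prod_left w"

lemma bidual_apply: "blinfun_apply (bidual w) \<alpha> = blinfun_apply \<alpha> w"
  by (simp add: bidual_def)

end

theory Submission
  imports Defs
begin

text \<open>Write a lift as \<open>(-\<xi>, \<nu>)\<close>. Since the quotient map is a pseudo-Riemannian submersion with vertical field \<open>\<zeta>\<close>,
  the metric and symplectic form pulled back by the map into the quotient are those of the horizontal
  parts of \<open>(-\<xi>\<^sub>*X, \<nu>\<^sub>*X)\<close>. The Lagrangian condition becomes the symmetry of \<open>\<nu>\<^sub>*X(\<xi>\<^sub>*Y)\<close>, which says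
  both that the lift is \<open>\<phi>\<close>-anti-invariant and that the 1-form \<open>X \<mapsto> \<nu>(\<xi>\<^sub>*X)\<close> is closed. Rescaling by
  \<open>\<mu>\<close> adds \<open>d\<mu>\<close> to this form, and it vanishes exactly for horizontal lifts; so horizontal lifts
  correspond to the primitives of a closed form, which exist on a simply connected manifold and are
  unique up to constants. Global primitives are glued from local ones along paths; lifts exist
  because normalising \<open>v\<close> to length 1 is a global section of the quotient map.\<close>

section \<open>Calculus of smooth maps\<close>

text \<open>The charts of the quotient are specified only by a property
  (\<open>x \<circ> proj_minus\<close> is a smooth submersion), and a tangent vector of the quotient
  is a family indexed by all such charts. Nothing can be read off from such a family until enough
  charts are exhibited: \<open>hor_lift\<close> describes a definite vector only once
  \<open>proj_diff z\<close> is known to be injective on \<open>horizontal_space z\<close>. The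
  affine charts serve this purpose, and they also reduce the smoothness of a lift to explicit
  formulas. From then on the structure of the quotient can be evaluated at any point of an orbit,
  and all work is done on the lift. A second obstacle is that simple connectedness speaks of merely
  continuous loops and homotopies, along which a 1-form cannot be integrated. Integration is
  therefore replaced by continuation: a function on the parameter interval or square that differs
  from every local primitive by a locally constant function. The centroaffine property is
  nondegeneracy seen on one factor: a tangent vector pushed into the line of \<open>\<xi>\<close> or
  of \<open>\<nu>\<close> lies in the radical of the metric, and a dimension count does the
  rest.\<close>

lemma smooth_upto_cong:
  assumes "open S" "\<And>x. x \<in> S \<Longrightarrow> f x = g x" "smooth_upto k S f"
  shows "smooth_upto k S g"
  using assms(2,3)
proof (induction k arbitrary: f g)
  case 0
  then show ?case by (simp cong: continuous_on_cong)
next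
  case (Suc k)
  have "(g has_derivative frechet_derivative f (at x)) (at x)" if "x \<in> S" for x
  proof (rule has_derivative_transform_within_open[OF _ assms(1) that])
    show "(f has_derivative frechet_derivative f (at x)) (at x)"
      using Suc.prems(2) that by (simp add: frechet_derivative_works)
  qed (use Suc.prems(1) in auto)
  then have d: "g differentiable at x" "frechet_derivative f (at x) = frechet_derivative g (at x)"
    if "x \<in> S" for x
    using frechet_derivative_at that differentiableI by blast+
  show ?case
    unfolding smooth_upto.simps(2)
  proof (intro conjI ballI allI d(1))
    show "smooth_upto k S (\<lambda>x. frechet_derivative g (at x) v)" for v
    proof (rule Suc.IH)
      show "smooth_upto k S (\<lambda>x. frechet_derivative f (at x) v)"
        using Suc.prems(2) by simp
    qed (simp add: d(2))
  qed
qed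

lemma smooth_upto_Suc_derivI:
  assumes "open S" "\<And>x. x \<in> S \<Longrightarrow> (f has_derivative f' x) (at x)"
    and "\<And>v. smooth_upto k S (\<lambda>x. f' x v)"
  shows "smooth_upto (Suc k) S f"
proof -
  have "f' x v = frechet_derivative f (at x) v" if "x \<in> S" for x v
    using frechet_derivative_at[OF assms(2)[OF that]] by simp
  then have "smooth_upto k S (\<lambda>x. frechet_derivative f (at x) v)" for v
    by (rule smooth_upto_cong[OF assms(1) _ assms(3)[of v]])
  then show ?thesis
    using assms(2) by (auto simp: differentiable_def)
qed

lemma smooth_upto_has_derivative:
  "smooth_upto (Suc k) S f \<Longrightarrow> x \<in> S \<Longrightarrow> (f has_derivative frechet_derivative f (at x)) (at x)"
  using frechet_derivative_works by auto

lemma smooth_upto_SucD: "smooth_upto (Suc k) S f \<Longrightarrow> smooth_upto k S f"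
proof (induction k arbitrary: f)
  case 0
  then show ?case
    by (auto simp: continuous_on_eq_continuous_within differentiable_imp_continuous_within
        intro: continuous_at_imp_continuous_at_within)
next
  case (Suc k)
  show ?case
    unfolding smooth_upto.simps(2)[of k]
  proof (intro conjI allI ballI)
    show "f differentiable at x" if "x \<in> S" for x
      using Suc.prems that by (simp only: smooth_upto.simps(2))
    show "smooth_upto k S (\<lambda>x. frechet_derivative f (at x) v)" for v
      using Suc.prems smooth_upto.simps(2)[of "Suc k" S f] by (intro Suc.IH) blast
  qed
qed

lemma smooth_upto_const: "smooth_upto k S (\<lambda>x. c)"
  by (induction k arbitrary: c) auto

lemma smooth_upto_linear:
  assumes "bounded_linear L" "smooth_upto k S f" "open S"
  shows "smooth_upto k S (\<lambda>x. L (f x))"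
  using assms(2)
proof (induction k arbitrary: f)
  case 0
  then show ?case by (simp add: assms(1) bounded_linear.continuous_on)
next
  case (Suc k)
  show ?case
    by (rule smooth_upto_Suc_derivI[OF assms(3)
          bounded_linear.has_derivative[OF assms(1) smooth_upto_has_derivative[OF Suc.prems]]])
       (use Suc in auto)
qed

lemma smooth_upto_id: "open S \<Longrightarrow> smooth_upto k S (\<lambda>x. x)"
proof (cases k)
  case (Suc j)
  assume "open S"
  then show ?thesis
    unfolding Suc by (rule smooth_upto_Suc_derivI[OF _ has_derivative_ident]) (rule smooth_upto_const)
qed simp

lemma smooth_upto_add:
  assumes "open S" "smooth_upto k S f" "smooth_upto k S g"
  shows "smooth_upto k S (\<lambda>x. f x + g x)"
  using assms(2,3)
proof (induction k arbitrary: f g)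
  case 0
  then show ?case by (simp add: continuous_on_add)
next
  case (Suc k)
  show ?case
    by (rule smooth_upto_Suc_derivI[OF assms(1) has_derivative_add
          [OF smooth_upto_has_derivative[OF Suc.prems(1)] smooth_upto_has_derivative[OF Suc.prems(2)]]])
       (use Suc in auto)
qed

lemma (in bounded_bilinear) smooth_upto:
  assumes "open S" "smooth_upto k S f" "smooth_upto k S g"
  shows "smooth_upto k S (\<lambda>x. prod (f x) (g x))"
  using assms(2,3)
proof (induction k arbitrary: f g)
  case 0
  then show ?case by (simp add: continuous_on)
next
  case (Suc k)
  show ?case
  proof (rule smooth_upto_Suc_derivI[OF assms(1)
        FDERIV[OF smooth_upto_has_derivative[OF Suc.prems(1)] smooth_upto_has_derivative[OF Suc.prems(2)]]])
    show "smooth_upto k S (\<lambda>x. prod (f x) (frechet_derivative g (at x) v) +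
        prod (frechet_derivative f (at x) v) (g x))" for v
      using Suc.prems by (intro smooth_upto_add assms(1) Suc.IH smooth_upto_SucD[OF Suc.prems(1)]
          smooth_upto_SucD[OF Suc.prems(2)]) simp_all
  qed
qed

lemma smooth_upto_sum:
  assumes "open S" "\<And>i. i \<in> I \<Longrightarrow> smooth_upto k S (f i)"
  shows "smooth_upto k S (\<lambda>x. \<Sum>i\<in>I. f i x)"
  using assms(2)
  by (induction I rule: infinite_finite_induct) (auto intro: smooth_upto_const smooth_upto_add assms(1))

text \<open>The derivative of \<open>f\<close> enters along the moving direction
  \<open>frechet_derivative g (at x) v\<close>, while the induction hypothesis speaks of fixed
  directions only. Expanding the moving direction in \<open>Basis\<close> leaves finitely many fixed
  ones with smooth coefficients; hence the Euclidean type in the middle.\<close>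

lemma smooth_upto_compose:
  fixes g :: "'a::real_normed_vector \<Rightarrow> 'b::euclidean_space"
  assumes "open S" "open T" "smooth_upto k S g" "smooth_upto k T f" "g ` S \<subseteq> T"
  shows "smooth_upto k S (\<lambda>x. f (g x))"
  using assms(3,4)
proof (induction k arbitrary: f)
  case 0
  then show ?case using assms(5) by (auto intro: continuous_on_compose2)
next
  case (Suc k)
  have d: "((\<lambda>x. f (g x)) has_derivative
      (\<lambda>v. \<Sum>b\<in>Basis. (frechet_derivative g (at x) v \<bullet> b) *\<^sub>R frechet_derivative f (at (g x)) b)) (at x)"
    if "x \<in> S" for x
  proof -
    have f: "(f has_derivative frechet_derivative f (at (g x))) (at (g x))"
      using smooth_upto_has_derivative[OF Suc.prems(2)] assms(5) that by blast
    interpret f': bounded_linear "frechet_derivative f (at (g x))"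
      using f by (rule has_derivative_bounded_linear)
    have "frechet_derivative f (at (g x)) w = (\<Sum>b\<in>Basis. (w \<bullet> b) *\<^sub>R frechet_derivative f (at (g x)) b)" for w
    proof -
      have "frechet_derivative f (at (g x)) w =
          frechet_derivative f (at (g x)) (\<Sum>b\<in>Basis. (w \<bullet> b) *\<^sub>R b)"
        by (simp only: euclidean_representation)
      then show ?thesis by (simp only: f'.sum f'.scaleR)
    qed
    then show ?thesis
      by (rule has_derivative_eq_rhs[OF has_derivative_compose
            [OF smooth_upto_has_derivative[OF Suc.prems(1) that] f] ext])
  qed
  show ?case
  proof (rule smooth_upto_Suc_derivI[OF assms(1) d])
    show "smooth_upto k S (\<lambda>x. \<Sum>b\<in>Basis. (frechet_derivative g (at x) v \<bullet> b) *\<^sub>R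
        frechet_derivative f (at (g x)) b)" for v
    proof (intro smooth_upto_sum bounded_bilinear.smooth_upto[OF bounded_bilinear_scaleR]
          smooth_upto_linear[OF bounded_linear_inner_left] assms(1))
      show "smooth_upto k S (\<lambda>x. frechet_derivative g (at x) v)"
        using Suc.prems(1) by simp
      show "smooth_upto k S (\<lambda>x. frechet_derivative f (at (g x)) b)" for b
        using Suc.prems(2) by (intro Suc.IH[OF smooth_upto_SucD[OF Suc.prems(1)]]) simp
    qed
  qed
qed

lemma smooth_upto_locally:
  assumes "\<And>x. x \<in> S \<Longrightarrow> \<exists>U. open U \<and> x \<in> U \<and> smooth_upto k U f"
  shows "smooth_upto k S f"
  using assms
proof (induction k arbitrary: f)
  case 0
  then show ?case
    by (metis continuous_at_imp_continuous_on continuous_on_eq_continuous_at smooth_upto.simps(1))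
next
  case (Suc k)
  have "f differentiable at x" if "x \<in> S" for x
    using Suc.prems[OF that] by auto
  moreover have "smooth_upto k S (\<lambda>x. frechet_derivative f (at x) v)" for v
    by (rule Suc.IH) (use Suc.prems in force)
  ultimately show ?case by simp
qed

lemma smooth_openD: "smooth_open S f \<Longrightarrow> smooth_upto k S f"
  by (simp add: smooth_open_def)

lemma smooth_open_has_derivative:
  "smooth_open S f \<Longrightarrow> x \<in> S \<Longrightarrow> (f has_derivative frechet_derivative f (at x)) (at x)"
  by (rule smooth_upto_has_derivative[OF smooth_openD])

lemma smooth_open_imp_continuous_on: "smooth_open S f \<Longrightarrow> continuous_on S f"
  using smooth_openD[of S f 0] by simp

lemma smooth_open_frechet: "smooth_open S f \<Longrightarrow> smooth_open S (\<lambda>x. frechet_derivative f (at x) v)"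
  unfolding smooth_open_def
proof
  fix k assume "\<forall>k. smooth_upto k S f"
  then have "smooth_upto (Suc k) S f" by blast
  then show "smooth_upto k S (\<lambda>x. frechet_derivative f (at x) v)" by simp
qed

lemma smooth_open_cong:
  "open S \<Longrightarrow> (\<And>x. x \<in> S \<Longrightarrow> f x = g x) \<Longrightarrow> smooth_open S f \<Longrightarrow> smooth_open S g"
  unfolding smooth_open_def by (blast intro: smooth_upto_cong)

lemma smooth_open_derivI:
  assumes "open S" "\<And>x. x \<in> S \<Longrightarrow> (f has_derivative f' x) (at x)"
    and "\<And>v. smooth_open S (\<lambda>x. f' x v)"
  shows "smooth_open S f"
  unfolding smooth_open_def
proof
  fix k
  have "smooth_upto (Suc k) S f"
    by (rule smooth_upto_Suc_derivI[OF assms(1,2)]) (auto intro: smooth_openD assms(3))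
  then show "smooth_upto k S f" by (rule smooth_upto_SucD)
qed

lemma smooth_open_const [intro, simp]: "smooth_open S (\<lambda>x. c)"
  by (simp add: smooth_open_def smooth_upto_const)

lemma smooth_open_id [intro]: "open S \<Longrightarrow> smooth_open S (\<lambda>x. x)"
  by (simp add: smooth_open_def smooth_upto_id)

lemma smooth_open_linear:
  "bounded_linear L \<Longrightarrow> open S \<Longrightarrow> smooth_open S f \<Longrightarrow> smooth_open S (\<lambda>x. L (f x))"
  by (simp add: smooth_open_def smooth_upto_linear)

lemma smooth_open_add [intro]:
  "open S \<Longrightarrow> smooth_open S f \<Longrightarrow> smooth_open S g \<Longrightarrow> smooth_open S (\<lambda>x. f x + g x)"
  by (simp add: smooth_open_def smooth_upto_add)

lemma smooth_open_uminus [intro]: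
  "open S \<Longrightarrow> smooth_open S f \<Longrightarrow> smooth_open S (\<lambda>x. - f x)"
  by (rule smooth_open_linear[OF bounded_linear_minus[OF bounded_linear_ident]])

lemma smooth_open_diff [intro]:
  "open S \<Longrightarrow> smooth_open S f \<Longrightarrow> smooth_open S g \<Longrightarrow> smooth_open S (\<lambda>x. f x - g x)"
  using smooth_open_add[of S f "\<lambda>x. - g x"] by auto

lemma (in bounded_bilinear) smooth_open:
  "open S \<Longrightarrow> smooth_open S f \<Longrightarrow> smooth_open S g \<Longrightarrow> smooth_open S (\<lambda>x. prod (f x) (g x))"
  by (simp add: smooth_open_def smooth_upto)

lemmas smooth_open_scaleR [intro] = bounded_bilinear.smooth_open[OF bounded_bilinear_scaleR]
lemmas smooth_open_mult [intro] = bounded_bilinear.smooth_open[OF bounded_bilinear_mult]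
lemmas smooth_open_inner [intro] = bounded_bilinear.smooth_open[OF bounded_bilinear_inner]
lemmas smooth_open_blinfun_apply [intro] =
  bounded_bilinear.smooth_open[OF bounded_bilinear_blinfun_apply]
lemmas smooth_open_fst [intro] = smooth_open_linear[OF bounded_linear_fst]
lemmas smooth_open_snd [intro] = smooth_open_linear[OF bounded_linear_snd]

lemma smooth_open_sum [intro]:
  "open S \<Longrightarrow> (\<And>i. i \<in> I \<Longrightarrow> smooth_open S (f i)) \<Longrightarrow> smooth_open S (\<lambda>x. \<Sum>i\<in>I. f i x)"
  by (simp add: smooth_open_def smooth_upto_sum)

lemma smooth_open_Pair [intro]:
  assumes "open S" "smooth_open S f" "smooth_open S g"
  shows "smooth_open S (\<lambda>x. (f x, g x))"
proof -
  have "smooth_open S (\<lambda>x. (f x, 0) + (0, g x))"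
    by (intro smooth_open_add assms smooth_open_linear[of "\<lambda>y. (y, 0)"] smooth_open_linear[of "Pair 0"]
        bounded_linear_Pair bounded_linear_ident bounded_linear_zero)
  then show ?thesis by simp
qed

lemma smooth_open_vec_lambda [intro]:
  fixes f :: "'a::real_normed_vector \<Rightarrow> 'i::finite \<Rightarrow> real"
  assumes "open S" "\<And>i. smooth_open S (\<lambda>x. f x i)"
  shows "smooth_open S (\<lambda>x. \<chi> i. f x i)"
proof -
  have "(\<Sum>i\<in>UNIV. f x i *\<^sub>R axis i (1::real)) = (\<chi> i. f x i)" for x
    by (simp add: vec_eq_iff axis_def if_distrib cong: if_cong)
  moreover have "smooth_open S (\<lambda>x. \<Sum>i\<in>UNIV. f x i *\<^sub>R axis i (1::real))"
    using assms by (intro smooth_open_sum smooth_open_scaleR) auto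
  ultimately show ?thesis by simp
qed

lemma smooth_open_vec_nth [intro]: "open S \<Longrightarrow> smooth_open S f \<Longrightarrow> smooth_open S (\<lambda>x. f x $ i)"
  by (rule smooth_open_linear[OF bounded_linear_vec_nth])

lemma smooth_open_compose:
  fixes g :: "'a::real_normed_vector \<Rightarrow> 'b::euclidean_space"
  shows "open S \<Longrightarrow> open T \<Longrightarrow> smooth_open S g \<Longrightarrow> smooth_open T f \<Longrightarrow> g ` S \<subseteq> T \<Longrightarrow>
    smooth_open S (\<lambda>x. f (g x))"
  by (simp add: smooth_open_def smooth_upto_compose)

lemma smooth_open_divide_const [intro]:
  "open S \<Longrightarrow> smooth_open S f \<Longrightarrow> smooth_open S (\<lambda>x. f x / (c::real))"
  by (rule smooth_open_linear[OF bounded_linear_divide])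

lemma smooth_open_locally:
  assumes "\<And>x. x \<in> S \<Longrightarrow> \<exists>U. open U \<and> x \<in> U \<and> smooth_open U f"
  shows "smooth_open S f"
  unfolding smooth_open_def
  by (intro allI smooth_upto_locally) (meson assms smooth_openD)

lemma smooth_open_exp [intro]:
  fixes f :: "'a::real_normed_vector \<Rightarrow> real"
  assumes "open S" "smooth_open S f"
  shows "smooth_open S (\<lambda>x. exp (f x))"
proof -
  have "smooth_upto k UNIV (exp :: real \<Rightarrow> real)" for k
  proof (induction k)
    case (Suc k)
    show ?case
      by (rule smooth_upto_Suc_derivI[where f' = "\<lambda>x v. exp x * v"])
         (auto intro!: Suc bounded_bilinear.smooth_upto[OF bounded_bilinear_mult] smooth_upto_const
           has_derivative_eq_rhs[OF has_derivative_exp])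
  qed (auto intro: continuous_intros)
  then show ?thesis
    using smooth_open_compose[OF assms(1) open_UNIV assms(2)] by (auto simp: smooth_open_def)
qed

text \<open>The derivative is built from the same reciprocal and the derivative of \<open>f\<close>,
  so each level of smoothness follows from the previous one for the same function, as for
  \<open>exp\<close>.\<close>

lemma smooth_open_inverse [intro]:
  fixes f :: "'a::real_normed_vector \<Rightarrow> real"
  assumes "open S" "smooth_open S f" "\<And>x. x \<in> S \<Longrightarrow> f x \<noteq> 0"
  shows "smooth_open S (\<lambda>x. inverse (f x))"
proof -
  have "smooth_upto k S (\<lambda>x. inverse (f x))" for k
  proof (induction k)
    case 0
    then show ?case
      using assms by (simp add: continuous_on_inverse smooth_open_imp_continuous_on)
  next
    case (Suc k)
    show ?case
    proof (rule smooth_upto_Suc_derivI[OF assms(1) Deriv.has_derivative_inverse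
          [OF _ smooth_open_has_derivative[OF assms(2)]]])
      show "smooth_upto k S (\<lambda>x. - (inverse (f x) * frechet_derivative f (at x) v * inverse (f x)))" for v
        by (intro Suc bounded_bilinear.smooth_upto[OF bounded_bilinear_mult] assms(1,2) smooth_openD
            smooth_open_frechet smooth_upto_linear[OF bounded_linear_minus[OF bounded_linear_ident]])
    qed (use assms(3) in auto)
  qed
  then show ?thesis by (simp add: smooth_open_def)
qed

lemma smooth_open_ln [intro]:
  fixes f :: "'a::real_normed_vector \<Rightarrow> real"
  assumes "open S" "smooth_open S f" "\<And>x. x \<in> S \<Longrightarrow> f x > 0"
  shows "smooth_open S (\<lambda>x. ln (f x))"
proof (rule smooth_open_derivI[OF assms(1)])
  show "((\<lambda>x. ln (f x)) has_derivative (\<lambda>v. frechet_derivative f (at x) v * inverse (f x))) (at x)"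
    if "x \<in> S" for x
    by (rule has_derivative_eq_rhs[OF has_derivative_ln[OF assms(3)[OF that]
          smooth_open_has_derivative[OF assms(2) that]]])
       (simp add: fun_eq_iff field_simps)
  show "smooth_open S (\<lambda>x. frechet_derivative f (at x) v * inverse (f x))" for v
    using less_imp_neq[OF assms(3)]
    by (intro smooth_open_mult smooth_open_inverse smooth_open_frechet assms(1,2)) auto
qed

lemma has_vector_derivative_along_line:
  assumes "(g has_derivative g') (at (z + r *\<^sub>R w))"
  shows "((\<lambda>r. g (z + r *\<^sub>R w)) has_vector_derivative g' w) (at r within T)"
proof -
  have "((\<lambda>r. z + r *\<^sub>R w) has_derivative (\<lambda>h. h *\<^sub>R w)) (at r within T)"
    by (auto intro!: derivative_eq_intros)
  then have "((\<lambda>r. g (z + r *\<^sub>R w)) has_derivative (\<lambda>h. g' (h *\<^sub>R w))) (at r within T)"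
    by (rule has_derivative_compose) (rule assms)
  then show ?thesis
    using has_derivative_bounded_linear[OF assms]
    by (simp add: has_vector_derivative_def bounded_linear.linear linear_scale)
qed

text \<open>Writing \<open>f(x + s u + t v) - f(x + t v)\<close> as an integral over \<open>[0, s]\<close>, differentiating
  under the integral sign in \<open>t\<close> and then in the upper limit \<open>s\<close> exchanges the derivatives.\<close>

lemma second_derivative_symmetric:
  fixes f :: "'a::real_normed_vector \<Rightarrow> 'b::banach"
  assumes "open S" "smooth_open S f" "x \<in> S"
  shows "frechet_derivative (\<lambda>y. frechet_derivative f (at y) u) (at x) v =
         frechet_derivative (\<lambda>y. frechet_derivative f (at y) v) (at x) u"
proof -
  define P where "P w y = frechet_derivative f (at y) w" for w y
  define Q where "Q y = frechet_derivative (P u) (at y) v" for y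
  have Ps: "smooth_open S (P w)" for w
    unfolding P_def by (rule smooth_open_frechet[OF assms(2)])
  have Qc: "continuous_on S Q"
    unfolding Q_def by (intro smooth_open_imp_continuous_on smooth_open_frechet Ps)
  obtain e where e: "e > 0" "ball x e \<subseteq> S"
    using assms(1,3) openE by blast
  \<comment> \<open>Small enough that \<open>pt r t\<close> stays in \<open>ball x e\<close> for
    parameters up to \<open>d\<close>; the summand 1 keeps the denominator positive when
    \<open>u\<close> and \<open>v\<close> both vanish.\<close>
  define d where "d = e / (1 + norm u + norm v)"
  have d: "d > 0"
    using e(1) by (auto simp: d_def intro!: divide_pos_pos add_pos_nonneg)
  define pt where "pt r t = x + r *\<^sub>R u + t *\<^sub>R v" for r t
  have ptS: "pt r t \<in> S" if "r \<in> {0..d}" "t \<in> {0..d}" for r t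
  proof -
    have "norm (r *\<^sub>R u + t *\<^sub>R v) \<le> d * norm u + d * norm v"
      using that by (intro order.trans[OF norm_triangle_ineq] add_mono) (auto intro!: mult_right_mono)
    also have "\<dots> < d * (1 + norm u + norm v)"
      using d by (simp add: algebra_simps)
    also have "\<dots> = e"
      using add_pos_nonneg[of 1 "norm u + norm v"] by (simp add: d_def)
    finally have "dist x (pt r t) < e"
      by (simp add: pt_def dist_norm norm_minus_commute add.commute)
    then show ?thesis using e(2) by auto
  qed
  have du: "((\<lambda>r. g (pt r t)) has_vector_derivative frechet_derivative g (at (pt r t)) u) (at r within T)"
    if "smooth_open S g" "r \<in> {0..d}" "t \<in> {0..d}" for g :: "'a \<Rightarrow> 'b" and r t T
    using has_vector_derivative_along_line[of g "frechet_derivative g (at (pt r t))" "x + t *\<^sub>R v" r u]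
      smooth_open_has_derivative[OF that(1) ptS[OF that(2,3)]]
    by (simp add: pt_def algebra_simps)
  have dv: "((\<lambda>t. g (pt r t)) has_vector_derivative frechet_derivative g (at (pt r t)) v) (at t within T)"
    if "smooth_open S g" "r \<in> {0..d}" "t \<in> {0..d}" for g :: "'a \<Rightarrow> 'b" and r t T
    using has_vector_derivative_along_line[of g "frechet_derivative g (at (pt r t))" "x + r *\<^sub>R u" t v]
      smooth_open_has_derivative[OF that(1) ptS[OF that(2,3)]]
    by (simp add: pt_def)
  have ptc: "continuous_on K (\<lambda>(t, r). pt r t)" for K
    unfolding pt_def split_beta by (intro continuous_intros)
  have A: "((\<lambda>r. P u (pt r t)) has_integral f (pt s t) - f (pt 0 t)) {0..s}"
    if "s \<in> {0..d}" "t \<in> {0..d}" for s t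
    using that by (intro fundamental_theorem_of_calculus) (auto simp: P_def intro!: du assms(2))
  \<comment> \<open>Both sides are the derivative at \<open>t = 0\<close> of
    \<open>f (pt s t) - f (pt 0 t)\<close>, on the right taken under the integral sign. One-sided
    derivatives suffice, so all parameters stay in \<open>{0..d}\<close>.\<close>
  have B: "P v (pt s 0) - P v (pt 0 0) = integral {0..s} (\<lambda>r. Q (pt r 0))" if s: "s \<in> {0..d}" for s
  proof -
    have "((\<lambda>t. integral (cbox 0 s) (\<lambda>r. P u (pt r t))) has_vector_derivative
        integral (cbox 0 s) (\<lambda>r. Q (pt r 0))) (at 0 within {0..d})"
    proof (rule leibniz_rule_vector_derivative)
      show "((\<lambda>t. P u (pt r t)) has_vector_derivative Q (pt r t)) (at t within {0..d})"
        if "t \<in> {0..d}" "r \<in> cbox 0 s" for t r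
        unfolding Q_def using that s by (intro dv Ps) auto
      show "(\<lambda>r. P u (pt r t)) integrable_on cbox 0 s" if "t \<in> {0..d}" for t
        using A[OF s that] by auto
      have "continuous_on ({0..d} \<times> {0..s}) (\<lambda>z. Q ((\<lambda>(t, r). pt r t) z))"
        using s ptS by (intro continuous_on_compose2[OF Qc ptc]) auto
      then show "continuous_on ({0..d} \<times> cbox 0 s) (\<lambda>(t, r). Q (pt r t))"
        by (simp add: split_beta)
    qed (use d in auto)
    then have "((\<lambda>t. f (pt s t) - f (pt 0 t)) has_vector_derivative
        integral {0..s} (\<lambda>r. Q (pt r 0))) (at 0 within {0..d})"
      unfolding box_real
      by (rule has_vector_derivative_transform[rotated 2])
         (use integral_unique[OF A[OF s]] d in auto)
    moreover have "((\<lambda>t. f (pt s t) - f (pt 0 t)) has_vector_derivative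
        P v (pt s 0) - P v (pt 0 0)) (at 0 within {0..d})"
      unfolding P_def using d s by (intro has_vector_derivative_diff dv assms(2)) auto
    ultimately show ?thesis
      by (rule vector_derivative_unique_within[rotated, symmetric]) (use d in \<open>simp add: at_within_Icc_at_right\<close>)
  qed
  have "((\<lambda>s. integral {0..s} (\<lambda>r. Q (pt r 0))) has_vector_derivative Q (pt 0 0)) (at 0 within {0..d})"
  proof (rule integral_has_vector_derivative)
    show "continuous_on {0..d} (\<lambda>r. Q (pt r 0))"
    proof (rule continuous_on_compose2[OF Qc])
      show "continuous_on {0..d} (\<lambda>r. pt r 0)"
        unfolding pt_def by (intro continuous_intros)
      show "(\<lambda>r. pt r 0) ` {0..d} \<subseteq> S"
        using ptS d by auto
    qed
  qed (use d in auto)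
  then have "((\<lambda>s. P v (pt s 0) - P v (pt 0 0)) has_vector_derivative Q (pt 0 0)) (at 0 within {0..d})"
    by (rule has_vector_derivative_transform[rotated 2]) (use B d in auto)
  moreover have "((\<lambda>s. P v (pt s 0) - P v (pt 0 0)) has_vector_derivative
      frechet_derivative (P v) (at (pt 0 0)) u - 0) (at 0 within {0..d})"
    using d by (intro has_vector_derivative_diff du Ps has_vector_derivative_const) auto
  ultimately have "frechet_derivative (P v) (at (pt 0 0)) u = Q (pt 0 0)"
    using d by (intro vector_derivative_unique_within[of 0 "{0..d}"]) (auto simp: at_within_Icc_at_right)
  then show ?thesis
    by (simp add: Q_def P_def[abs_def] pt_def)
qed

section \<open>The Poincare lemma on a ball\<close>

text \<open>The primitive is the integral of the form along the segment from the centre. By symmetry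
  its gradient is the integral of \<open>H x t\<close>, which is the \<open>t\<close>-derivative of
  \<open>t *\<^sub>R G (pt x t)\<close> and hence integrates to \<open>G x\<close>.\<close>

lemma poincare_lemma:
  fixes G :: "'e::euclidean_space \<Rightarrow> 'e"
  assumes "open S" "smooth_open S G" "ball c r \<subseteq> S"
    and sym: "\<And>x u w. x \<in> S \<Longrightarrow>
      frechet_derivative G (at x) u \<bullet> w = frechet_derivative G (at x) w \<bullet> u"
  obtains h :: "'e \<Rightarrow> real" where "\<And>x. x \<in> ball c r \<Longrightarrow> (h has_derivative (\<lambda>u. G x \<bullet> u)) (at x)"
proof -
  define D where "D x = frechet_derivative G (at x)" for x
  define pt where "pt x t = c + t *\<^sub>R (x - c)" for x and t :: real
  define H where "H x t = t *\<^sub>R D (pt x t) (x - c) + G (pt x t)" for x t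
  define h where "h x = integral (cbox 0 1) (\<lambda>t. G (pt x t) \<bullet> (x - c))" for x
  have ptB: "pt x t \<in> ball c r" if "x \<in> ball c r" "t \<in> {0..1}" for x t
  proof -
    have "norm (t *\<^sub>R (x - c)) \<le> 1 * norm (x - c)"
      using that(2) unfolding norm_scaleR by (intro mult_right_mono) auto
    then show ?thesis
      using that(1) by (auto simp: pt_def dist_norm norm_minus_commute)
  qed
  then have ptS: "pt x t \<in> S" if "x \<in> ball c r" "t \<in> {0..1}" for x t
    using assms(3) that by blast
  have GD: "(G has_derivative D (pt x t)) (at (pt x t))" if "x \<in> ball c r" "t \<in> {0..1}" for x t
    unfolding D_def using smooth_open_has_derivative[OF assms(2) ptS[OF that]] .
  have Dlin: "linear (D (pt x t))" if "x \<in> ball c r" "t \<in> {0..1}" for x t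
    using GD[OF that] has_derivative_bounded_linear bounded_linear.linear by blast
  have ptc: "continuous_on K (\<lambda>(x, t). pt x t)" for K
    unfolding pt_def split_beta by (intro continuous_intros)
  have Gc: "continuous_on S G" and Dc: "continuous_on S (\<lambda>y. D y b)" for b
    unfolding D_def using assms(2) by (auto intro: smooth_open_imp_continuous_on smooth_open_frechet)
  have Gpt: "continuous_on (ball c r \<times> {0..1}) (\<lambda>z. G ((\<lambda>(x, t). pt x t) z))"
    using ptS by (intro continuous_on_compose2[OF Gc ptc]) auto
  have Dpt: "continuous_on (ball c r \<times> {0..1}) (\<lambda>z. D ((\<lambda>(x, t). pt x t) z) b)" for b
    using ptS by (intro continuous_on_compose2[OF Dc ptc]) auto
  have Hc: "continuous_on (ball c r \<times> {0..1}) (\<lambda>(x, t). H x t)"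
  proof -
    have "continuous_on (ball c r \<times> {0..1}) (\<lambda>(x, t).
        t *\<^sub>R (\<Sum>b\<in>Basis. ((x - c) \<bullet> b) *\<^sub>R D (pt x t) b) + G (pt x t))"
      using Gpt Dpt unfolding split_beta by (intro continuous_intros) auto
    moreover have "D (pt x t) (x - c) = (\<Sum>b\<in>Basis. ((x - c) \<bullet> b) *\<^sub>R D (pt x t) b)"
      if "x \<in> ball c r" "t \<in> {0..1}" for x t
    proof -
      have "D (pt x t) (\<Sum>b\<in>Basis. ((x - c) \<bullet> b) *\<^sub>R b) =
          (\<Sum>b\<in>Basis. ((x - c) \<bullet> b) *\<^sub>R D (pt x t) b)"
        using Dlin[OF that] by (simp add: linear_sum linear_scale)
      then show ?thesis by (simp add: euclidean_representation)
    qed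
    ultimately show ?thesis
      by (subst continuous_on_cong[OF refl]) (auto simp: H_def)
  qed
  have d: "((\<lambda>t. t *\<^sub>R G (pt x t)) has_vector_derivative H x t) (at t within {0..1})"
    if "x \<in> ball c r" "t \<in> {0..1}" for x t
  proof -
    have "((\<lambda>t. G (c + t *\<^sub>R (x - c))) has_vector_derivative D (pt x t) (x - c)) (at t within {0..1})"
      by (rule has_vector_derivative_along_line) (use GD[OF that] in \<open>simp add: pt_def\<close>)
    then show ?thesis
      unfolding H_def pt_def
      by (auto intro!: has_vector_derivative_eq_rhs[OF has_vector_derivative_scaleR[OF DERIV_ident]])
  qed
  have HI: "(H x has_integral G x) {0..1}" if "x \<in> ball c r" for x
    using fundamental_theorem_of_calculus[OF _ d[OF that]] by (simp add: pt_def)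
  have "(h has_derivative (\<lambda>u. G x \<bullet> u)) (at x)" if x: "x \<in> ball c r" for x
  proof -
    have "(h has_derivative integral (cbox 0 1) (\<lambda>t. blinfun_inner_right (H x t))) (at x within ball c r)"
      unfolding h_def
    proof (rule leibniz_rule)
      fix y t assume y: "y \<in> ball c r" and t: "t \<in> cbox 0 (1::real)"
      then have t': "t \<in> {0..1}" by simp
      have "((\<lambda>x. pt x t) has_derivative (\<lambda>u. t *\<^sub>R u)) (at y within ball c r)"
        unfolding pt_def by (auto intro!: derivative_eq_intros)
      then have 1: "((\<lambda>x. G (pt x t)) has_derivative (\<lambda>u. D (pt y t) (t *\<^sub>R u))) (at y within ball c r)"
        by (rule has_derivative_compose) (rule GD[OF y t'])
      have 2: "((\<lambda>x. G (pt x t) \<bullet> (x - c)) has_derivative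
          (\<lambda>u. G (pt y t) \<bullet> (u - 0) + D (pt y t) (t *\<^sub>R u) \<bullet> (y - c))) (at y within ball c r)"
        by (intro has_derivative_inner 1 has_derivative_diff has_derivative_ident has_derivative_const)
      \<comment> \<open>The symmetry hypothesis moves the increment \<open>u\<close> out of the
        derivative, so that the derivative of the integrand is the inner product of
        \<open>H y t\<close> with \<open>u\<close>.\<close>
      have "D (pt y t) (t *\<^sub>R u) \<bullet> (y - c) = t * (D (pt y t) (y - c) \<bullet> u)" for u
        using sym[OF ptS[OF y t'], of u "y - c"] linear_scale[OF Dlin[OF y t'], of t u] by (simp add: D_def)
      then have "(\<lambda>u. G (pt y t) \<bullet> (u - 0) + D (pt y t) (t *\<^sub>R u) \<bullet> (y - c)) =
          blinfun_apply (blinfun_inner_right (H y t))"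
        by (simp add: fun_eq_iff H_def inner_add_left)
      then show "((\<lambda>x. G (pt x t) \<bullet> (x - c)) has_derivative
          blinfun_apply (blinfun_inner_right (H y t))) (at y within ball c r)"
        using 2 by simp
    next
      fix y assume y: "y \<in> ball c r"
      have "continuous_on {0..1} (\<lambda>t. G (pt y t) \<bullet> (y - c))"
        using ptS[OF y] by (intro continuous_intros continuous_on_compose2[OF Gc])
          (auto simp: pt_def intro!: continuous_intros)
      then show "(\<lambda>t. G (pt y t) \<bullet> (y - c)) integrable_on cbox 0 1"
        by (simp add: integrable_continuous_interval)
    next
      show "continuous_on (ball c r \<times> cbox 0 1) (\<lambda>(x, t). blinfun_inner_right (H x t))"
        using bounded_linear.continuous_on[OF bounded_linear_blinfun_inner_right Hc]
        by (simp add: split_beta)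
    qed (use x in auto)
    moreover have "integral (cbox 0 1) (\<lambda>t. blinfun_inner_right (H x t)) = blinfun_inner_right (G x)"
      using has_integral_linear[OF HI[OF x] bounded_linear_blinfun_inner_right]
      by (simp add: o_def integral_unique)
    ultimately show ?thesis
      using x by (simp add: at_within_open[OF x] o_def)
  qed
  then show thesis by (rule that)
qed

section \<open>Local primitives on simply connected spaces\<close>

text \<open>Abstracts a closed 1-form to its local primitives and forgets derivatives: what remains
  is that two of them differ by a locally constant function. Constancy is asked only near each
  common point, since an overlap may be disconnected.\<close>

locale local_system =
  fixes F :: "('m::topological_space set \<times> ('m \<Rightarrow> real)) set"
  assumes open_dom: "(U, h) \<in> F \<Longrightarrow> open U"
    and cover: "\<exists>U h. (U, h) \<in> F \<and> p \<in> U"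
    and compat: "(U, h) \<in> F \<Longrightarrow> (V, k) \<in> F \<Longrightarrow> p \<in> U \<Longrightarrow> p \<in> V \<Longrightarrow>
      \<forall>\<^sub>F q in nhds p. h q - k q = h p - k p"
begin

text \<open>\<open>H\<close> plays the role of the integral of the form along
  \<open>\<gamma>\<close> up to the current parameter, but needs no differentiability of
  \<open>\<gamma>\<close>. The parameter space is left arbitrary so that paths and homotopy squares
  are treated alike.\<close>

definition primitive :: "('x::topological_space \<Rightarrow> 'm) \<Rightarrow> 'x set \<Rightarrow> ('x \<Rightarrow> real) \<Rightarrow> bool" where
  "primitive \<gamma> K H \<longleftrightarrow> (\<forall>x\<in>K. \<forall>(U, h)\<in>F. \<gamma> x \<in> U \<longrightarrow>
     (\<forall>\<^sub>F y in at x within K. H y - h (\<gamma> y) = H x - h (\<gamma> x)))"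

lemma primitiveD:
  "primitive \<gamma> K H \<Longrightarrow> x \<in> K \<Longrightarrow> (U, h) \<in> F \<Longrightarrow> \<gamma> x \<in> U \<Longrightarrow>
    \<forall>\<^sub>F y in at x within K. H y - h (\<gamma> y) = H x - h (\<gamma> x)"
  unfolding primitive_def by blast

text \<open>Near each parameter both functions are a constant plus the same local function along
  \<open>\<gamma>\<close>, so their difference is locally constant.\<close>

lemma primitive_diff_const:
  assumes "primitive \<gamma> K H" "primitive \<gamma> K H'" "connected K" "x \<in> K" "y \<in> K"
  shows "H y - H x = H' y - H' x"
proof -
  have "(\<lambda>z. H z - H' z) x = (\<lambda>z. H z - H' z) y"
  proof (rule connected_local_const[OF assms(3-5)], intro ballI)
    fix z assume z: "z \<in> K"
    obtain U h where U: "(U, h) \<in> F" "\<gamma> z \<in> U" using cover by blast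
    show "\<forall>\<^sub>F w in at z within K. H z - H' z = H w - H' w"
      using primitiveD[OF assms(1) z U] primitiveD[OF assms(2) z U] by eventually_elim simp
  qed
  then show ?thesis by simp
qed

lemma primitive_subset: "primitive \<gamma> K H \<Longrightarrow> L \<subseteq> K \<Longrightarrow> primitive \<gamma> L H"
  unfolding primitive_def by (blast intro: filter_leD[OF at_le])

lemma primitive_compose:
  assumes "primitive \<gamma> K H" "continuous_on L g" "g ` L \<subseteq> K"
  shows "primitive (\<lambda>x. \<gamma> (g x)) L (\<lambda>x. H (g x))"
  unfolding primitive_def
proof (intro ballI, clarify)
  fix x U h assume x: "x \<in> L" and U: "(U, h) \<in> F" "\<gamma> (g x) \<in> U"
  have gx: "g x \<in> K" using x assms(3) by blast
  have "\<forall>\<^sub>F y in at (g x) within K. H y - h (\<gamma> y) = H (g x) - h (\<gamma> (g x))"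
    by (rule primitiveD[OF assms(1) gx U])
  then obtain N where N: "open N" "g x \<in> N"
    "\<And>y. y \<in> N \<Longrightarrow> y \<in> K \<Longrightarrow> H y - h (\<gamma> y) = H (g x) - h (\<gamma> (g x))"
    unfolding eventually_at_topological by metis
  have "\<forall>\<^sub>F y in at x within L. g y \<in> N"
    using assms(2) x N(1,2) by (auto simp: continuous_on_def intro: topological_tendstoD)
  moreover have "\<forall>\<^sub>F y in at x within L. y \<in> L"
    by (simp add: eventually_at_filter)
  ultimately show "\<forall>\<^sub>F y in at x within L. H (g y) - h (\<gamma> (g y)) = H (g x) - h (\<gamma> (g x))"
    by eventually_elim (use N(3) assms(3) in blast)
qed

lemma primitive_cong:
  assumes "\<And>x. x \<in> K \<Longrightarrow> \<gamma> x = \<gamma>' x" "primitive \<gamma> K H"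
  shows "primitive \<gamma>' K H"
  unfolding primitive_def
proof (intro ballI, clarify)
  fix x U h assume x: "x \<in> K" and U: "(U, h) \<in> F" "\<gamma>' x \<in> U"
  have "\<forall>\<^sub>F y in at x within K. y \<in> K" by (simp add: eventually_at_filter)
  then show "\<forall>\<^sub>F y in at x within K. H y - h (\<gamma>' y) = H x - h (\<gamma>' x)"
    using primitiveD[OF assms(2) x U(1)] U(2) assms(1) x by (auto elim: eventually_elim2)
qed

lemma primitive_in_domain:
  assumes "(U, h) \<in> F" "continuous_on K \<gamma>" "\<gamma> ` K \<subseteq> U"
  shows "primitive \<gamma> K (\<lambda>x. h (\<gamma> x))"
  unfolding primitive_def
proof (intro ballI, clarify)
  fix x V k assume x: "x \<in> K" and V: "(V, k) \<in> F" "\<gamma> x \<in> V"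
  have "filterlim \<gamma> (nhds (\<gamma> x)) (at x within K)"
    using assms(2) x by (auto simp: continuous_on_def)
  then show "\<forall>\<^sub>F y in at x within K. h (\<gamma> y) - k (\<gamma> y) = h (\<gamma> x) - k (\<gamma> x)"
    using eventually_compose_filterlim[OF compat[OF assms(1) V(1) _ V(2)]] assms(3) x by blast
qed

text \<open>On a connected overlap the two primitives differ by a single constant, which is absorbed
  into the second one. Since the pieces are closed, a point outside a piece has no nearby points of
  it, so the two pieces can be checked separately.\<close>

lemma primitive_glue:
  fixes \<gamma> :: "'x::topological_space \<Rightarrow> 'm"
  assumes "primitive \<gamma> A H" "primitive \<gamma> B H'" "closed A" "closed B" "connected (A \<inter> B)"
  shows "\<exists>H. primitive \<gamma> (A \<union> B) H"
proof -
  have "\<exists>c. \<forall>x\<in>A \<inter> B. H x = H' x + c"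
  proof (cases "A \<inter> B = {}")
    case False
    then obtain z where z: "z \<in> A \<inter> B" by blast
    have "H x = H' x + (H z - H' z)" if "x \<in> A \<inter> B" for x
      using primitive_diff_const[OF primitive_subset[OF assms(1)] primitive_subset[OF assms(2)] assms(5) z that]
      by simp
    then show ?thesis by blast
  qed auto
  then obtain c where c: "\<And>x. x \<in> A \<Longrightarrow> x \<in> B \<Longrightarrow> H x = H' x + c" by blast
  define G where "G x = (if x \<in> A then H x else H' x + c)" for x
  have GB: "G x = H' x + c" if "x \<in> B" for x
    using c that by (simp add: G_def)
  have ev: "\<forall>\<^sub>F y in at x within T. P y" if "\<And>y. y \<in> T \<Longrightarrow> P y" for x :: 'x and T P
    using that by (auto simp: eventually_at_filter)
  have "primitive \<gamma> (A \<union> B) G"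
    unfolding primitive_def
  proof (intro ballI, clarify)
    fix x U h assume x: "x \<in> A \<union> B" and U: "(U, h) \<in> F" "\<gamma> x \<in> U"
    have 1: "\<forall>\<^sub>F y in at x within A. G y - h (\<gamma> y) = G x - h (\<gamma> x)"
    proof (cases "x \<in> A")
      case True
      have "\<forall>\<^sub>F y in at x within A. y \<in> A" by (rule ev)
      then show ?thesis
        using primitiveD[OF assms(1) True U] by eventually_elim (use True in \<open>simp add: G_def\<close>)
    next
      case False
      have "\<forall>\<^sub>F y in at x within A. y \<in> - A"
        using assms(3) False unfolding eventually_at_topological by (auto intro!: exI[of _ "- A"])
      moreover have "\<forall>\<^sub>F y in at x within A. y \<in> A" by (rule ev)
      ultimately show ?thesis by eventually_elim simp
    qed
    have 2: "\<forall>\<^sub>F y in at x within B. G y - h (\<gamma> y) = G x - h (\<gamma> x)"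
    proof (cases "x \<in> B")
      case True
      have "\<forall>\<^sub>F y in at x within B. y \<in> B" by (rule ev)
      then show ?thesis
        using primitiveD[OF assms(2) True U] by eventually_elim (use True in \<open>simp add: GB\<close>)
    next
      case False
      have "\<forall>\<^sub>F y in at x within B. y \<in> - B"
        using assms(4) False unfolding eventually_at_topological by (auto intro!: exI[of _ "- B"])
      moreover have "\<forall>\<^sub>F y in at x within B. y \<in> B" by (rule ev)
      ultimately show ?thesis by eventually_elim simp
    qed
    show "\<forall>\<^sub>F y in at x within A \<union> B. G y - h (\<gamma> y) = G x - h (\<gamma> x)"
      unfolding at_within_union eventually_sup using 1 2 by blast
  qed
  then show ?thesis by blast
qed

text \<open>The square is cut into cells that each map into one domain, by two bisection arguments:
  cells are joined to a thin strip around each first coordinate \<open>x\<close>, then strips are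
  joined to the square. Consecutive pieces always meet in a product of intervals, which is
  connected.\<close>

lemma primitive_square:
  fixes \<Gamma> :: "real \<times> real \<Rightarrow> 'm"
  assumes cont: "continuous_on ({0..1} \<times> {0..1}) \<Gamma>"
  obtains H where "primitive \<Gamma> ({0..1} \<times> {0..1}) H"
proof -
  define I :: "real set" where "I = {0..1}"
  have I: "closed I" "convex I" by (auto simp: I_def)
  have cl: "closed (({a..b} \<inter> I) \<times> ({c..d} \<inter> I))" for a b c d
    using I by (intro closed_Times closed_Int) auto
  have cn: "connected (({a..b} \<inter> I) \<times> ({c..d} \<inter> I))" for a b c d
    using I by (intro convex_connected convex_Times convex_Int) auto
  \<comment> \<open>The half-width is quantified inside \<open>Q\<close> because joining two pieces
    keeps only the smaller of their widths. Intersecting with \<open>I\<close> takes care of strips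
    that stick out of the square.\<close>
  define Q where "Q x c d \<longleftrightarrow> (\<exists>\<delta>>0. \<exists>H. primitive \<Gamma> (({x-\<delta>..x+\<delta>} \<inter> I) \<times> ({c..d} \<inter> I)) H)" for x c d
  have Q: "Q x 0 1" if x: "x \<in> I" for x
  proof -
    have "(0::real) \<le> 1" by simp
    then show ?thesis
    proof (induction rule: Bolzano)
      case (trans a b c)
      obtain d1 H1 where 1: "d1 > 0" "primitive \<Gamma> (({x-d1..x+d1} \<inter> I) \<times> ({a..b} \<inter> I)) H1"
        using trans(1) unfolding Q_def by blast
      obtain d2 H2 where 2: "d2 > 0" "primitive \<Gamma> (({x-d2..x+d2} \<inter> I) \<times> ({b..c} \<inter> I)) H2"
        using trans(2) unfolding Q_def by blast
      define d where "d = min d1 d2"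
      let ?J = "{x-d..x+d} \<inter> I"
      have "\<exists>H. primitive \<Gamma> (?J \<times> ({a..b} \<inter> I) \<union> ?J \<times> ({b..c} \<inter> I)) H"
      proof (rule primitive_glue[OF primitive_subset[OF 1(2)] primitive_subset[OF 2(2)] cl cl])
        have "?J \<times> ({a..b} \<inter> I) \<inter> ?J \<times> ({b..c} \<inter> I) = ?J \<times> ({b..b} \<inter> I)"
          using trans(3,4) by auto
        then show "connected (?J \<times> ({a..b} \<inter> I) \<inter> ?J \<times> ({b..c} \<inter> I))"
          by (simp only: cn)
      qed (auto simp: d_def)
      moreover have "?J \<times> ({a..b} \<inter> I) \<union> ?J \<times> ({b..c} \<inter> I) = ?J \<times> ({a..c} \<inter> I)"
        using trans(3,4) by auto
      moreover have "d > 0" using 1 2 by (simp add: d_def)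
      ultimately show ?case unfolding Q_def by metis
    next
      case (local y)
      then have y: "y \<in> I" by (simp add: I_def)
      obtain U h where U: "(U, h) \<in> F" "\<Gamma> (x, y) \<in> U" using cover by blast
      obtain W where W: "open W" "W \<inter> I \<times> I = \<Gamma> -` U \<inter> I \<times> I"
        using cont open_dom[OF U(1)] unfolding continuous_on_open_invariant I_def by blast
      have xyW: "(x, y) \<in> W" using W(2) U(2) x y by blast
      obtain A B where "open A" "open B" "(x, y) \<in> A \<times> B" "A \<times> B \<subseteq> W"
        by (rule open_prod_elim[OF W(1) xyW])
      then have AB: "open A" "open B" "x \<in> A" "y \<in> B" "A \<times> B \<subseteq> W" by auto
      obtain d1 where d1: "d1 > 0" "cball x d1 \<subseteq> A" using AB(1,3) open_contains_cball by blast
      obtain d2 where d2: "d2 > 0" "cball y d2 \<subseteq> B" using AB(2,4) open_contains_cball by blast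
      have "Q x a b" if ab: "a \<le> y \<and> y \<le> b \<and> b - a < d2" for a b
      proof -
        let ?K = "({x-d1..x+d1} \<inter> I) \<times> ({a..b} \<inter> I)"
        have "{x-d1..x+d1} \<subseteq> A" "{a..b} \<subseteq> B"
          using d1(2) d2(2) ab by (auto simp: subset_iff dist_real_def)
        then have "?K \<subseteq> W \<inter> I \<times> I" using AB(5) by blast
        then have "\<Gamma> ` ?K \<subseteq> U" using W(2) by blast
        moreover have "continuous_on ?K \<Gamma>"
          using cont by (rule continuous_on_subset) (auto simp: I_def)
        ultimately have "primitive \<Gamma> ?K (\<lambda>z. h (\<Gamma> z))"
          by (intro primitive_in_domain[OF U(1)])
        then show ?thesis unfolding Q_def using d1(1) by blast
      qed
      then show ?case using d2(1) by blast
    qed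
  qed
  define P where "P a b \<longleftrightarrow> (\<exists>H. primitive \<Gamma> (({a..b} \<inter> I) \<times> ({0..1} \<inter> I)) H)" for a b
  have "(0::real) \<le> 1" by simp
  then have "P 0 1"
  proof (induction rule: Bolzano)
    case (trans a b c)
    obtain H1 where 1: "primitive \<Gamma> (({a..b} \<inter> I) \<times> ({0..1} \<inter> I)) H1"
      using trans(1) unfolding P_def by blast
    obtain H2 where 2: "primitive \<Gamma> (({b..c} \<inter> I) \<times> ({0..1} \<inter> I)) H2"
      using trans(2) unfolding P_def by blast
    let ?J = "{0..1} \<inter> I"
    have "\<exists>H. primitive \<Gamma> (({a..b} \<inter> I) \<times> ?J \<union> ({b..c} \<inter> I) \<times> ?J) H"
    proof (rule primitive_glue[OF 1 2 cl cl])
      have "({a..b} \<inter> I) \<times> ?J \<inter> ({b..c} \<inter> I) \<times> ?J = ({b..b} \<inter> I) \<times> ?J"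
        using trans(3,4) by auto
      then show "connected (({a..b} \<inter> I) \<times> ?J \<inter> ({b..c} \<inter> I) \<times> ?J)"
        by (simp only: cn)
    qed
    moreover have "({a..b} \<inter> I) \<times> ?J \<union> ({b..c} \<inter> I) \<times> ?J = ({a..c} \<inter> I) \<times> ?J"
      using trans(3,4) by auto
    ultimately show ?case unfolding P_def by metis
  next
    case (local x)
    then have "x \<in> I" by (simp add: I_def)
    from Q[OF this] obtain d H where dH: "d > 0" "primitive \<Gamma> (({x-d..x+d} \<inter> I) \<times> ({0..1} \<inter> I)) H"
      unfolding Q_def by blast
    have "P a b" if "a \<le> x \<and> x \<le> b \<and> b - a < d" for a b
    proof -
      have "primitive \<Gamma> (({a..b} \<inter> I) \<times> ({0..1} \<inter> I)) H"
        by (rule primitive_subset[OF dH(2)]) (use that in auto)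
      then show ?thesis unfolding P_def by blast
    qed
    then show ?case using dH(1) by blast
  qed
  then show thesis
    using that unfolding P_def I_def by auto
qed

text \<open>The integral of the form along a path. It is a relation because the existence of a
  primitive and the independence of its choice are proved separately.\<close>

definition increment :: "(real \<Rightarrow> 'm) \<Rightarrow> real \<Rightarrow> bool" where
  "increment \<gamma> r \<longleftrightarrow> (\<exists>H. primitive \<gamma> {0..1} H \<and> r = H 1 - H 0)"

text \<open>The path is regarded as a square that does not depend on its first parameter.\<close>

lemma increment_exists:
  assumes "path \<gamma>"
  shows "\<exists>r. increment \<gamma> r"
proof -
  have "continuous_on ({0..1::real} \<times> {0..1::real}) (\<lambda>z. \<gamma> (snd z))"
    using assms unfolding path_def by (rule continuous_on_compose2) (auto intro: continuous_intros)
  then obtain H where "primitive (\<lambda>z. \<gamma> (snd z)) ({0..1::real} \<times> {0..1::real}) H"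
    by (rule primitive_square)
  then have "primitive (\<lambda>t. \<gamma> (snd (0::real, t))) {0..1} (\<lambda>t. H (0, t))"
    by (rule primitive_compose) (auto intro!: continuous_intros)
  then show ?thesis
    unfolding increment_def by auto
qed

lemma increment_unique: "increment \<gamma> r \<Longrightarrow> increment \<gamma> r' \<Longrightarrow> r = r'"
  unfolding increment_def
  by (metis atLeastAtMost_iff connected_Icc order_refl primitive_diff_const zero_le_one)

text \<open>Obtained by restriction instead of gluing: a primitive along the joined path,
  reparametrised over each half, is a primitive along each piece.\<close>

lemma increment_join:
  assumes "increment (\<gamma> +++ \<beta>) r" "pathfinish \<gamma> = pathstart \<beta>"
  obtains r1 r2 where "increment \<gamma> r1" "increment \<beta> r2" "r = r1 + r2"
proof -
  obtain H where H: "primitive (\<gamma> +++ \<beta>) {0..1} H" "r = H 1 - H 0"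
    using assms(1) unfolding increment_def by blast
  have "primitive (\<lambda>t. (\<gamma> +++ \<beta>) (t / 2)) {0..1} (\<lambda>t. H (t / 2))"
    by (rule primitive_compose[OF H(1)]) (auto intro!: continuous_intros)
  then have "primitive \<gamma> {0..1} (\<lambda>t. H (t / 2))"
    by (rule primitive_cong[rotated]) (auto simp: joinpaths_def)
  then have 1: "increment \<gamma> (H (1/2) - H 0)"
    unfolding increment_def by force
  have "primitive (\<lambda>t. (\<gamma> +++ \<beta>) ((t + 1) / 2)) {0..1} (\<lambda>t. H ((t + 1) / 2))"
    by (rule primitive_compose[OF H(1)]) (auto intro!: continuous_intros)
  then have "primitive \<beta> {0..1} (\<lambda>t. H ((t + 1) / 2))"
    by (rule primitive_cong[rotated])
       (use assms(2) in \<open>auto simp: joinpaths_def pathfinish_def pathstart_def add_divide_distrib\<close>)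
  then have 2: "increment \<beta> (H 1 - H (1/2))"
    unfolding increment_def by force
  show thesis
    by (rule that[OF 1 2]) (simp add: H(2))
qed

lemma increment_reverse:
  assumes "increment \<gamma> r"
  shows "increment (reversepath \<gamma>) (- r)"
proof -
  obtain H where H: "primitive \<gamma> {0..1} H" "r = H 1 - H 0"
    using assms(1) unfolding increment_def by blast
  have "primitive (\<lambda>t. \<gamma> (1 - t)) {0..1} (\<lambda>t. H (1 - t))"
    by (rule primitive_compose[OF H(1)]) (auto intro!: continuous_intros)
  then show ?thesis
    unfolding increment_def reversepath_def using H(2) by force
qed

text \<open>Every stage of the homotopy is a loop, so the two sides of the square traced by the ends
  of the stages are the same path and have equal increments. The side of the constant loop
  contributes zero, which leaves zero for the side that is \<open>\<gamma>\<close>.\<close>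

lemma increment_loop:
  assumes "homotopic_loops UNIV \<gamma> (\<lambda>t. a)" "increment \<gamma> r"
  shows "r = 0"
proof -
  obtain \<Gamma> where \<Gamma>: "continuous_on ({0..1::real} \<times> {0..1::real}) \<Gamma>"
      "\<forall>x\<in>{0..1}. \<Gamma> (0, x) = \<gamma> x" "\<forall>x\<in>{0..1}. \<Gamma> (1, x) = a"
      "\<forall>t\<in>{0..1}. pathfinish (\<Gamma> \<circ> Pair t) = pathstart (\<Gamma> \<circ> Pair t)"
    using assms(1) unfolding homotopic_loops by blast
  obtain H where H: "primitive \<Gamma> ({0..1} \<times> {0..1}) H"
    using primitive_square[OF \<Gamma>(1)] .
  have t: "primitive (\<lambda>s. \<Gamma> (s, i)) {0..1} (\<lambda>s. H (s, i))"
    and s: "primitive (\<lambda>s. \<Gamma> (i, s)) {0..1} (\<lambda>s. H (i, s))" if "i \<in> {0..1}" for i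
    using that by (auto intro!: primitive_compose[OF H] continuous_intros)
  have "primitive (\<lambda>s. \<Gamma> (s, 0)) {0..1} (\<lambda>s. H (s, 1))"
    by (rule primitive_cong[OF _ t]) (use \<Gamma>(4) in \<open>auto simp: pathfinish_def pathstart_def\<close>)
  then have "H (1, 1) - H (0, 1) = H (1, 0) - H (0, 0)"
    by (rule primitive_diff_const[OF _ t]) auto
  moreover have "primitive (\<lambda>s. a) {0..1} (\<lambda>s. H (1, s))"
    by (rule primitive_cong[OF _ s]) (use \<Gamma>(3) in auto)
  then have "H (1, 1) - H (1, 0) = 0 - 0"
    by (rule primitive_diff_const[where H' = "\<lambda>s. 0"]) (auto simp: primitive_def)
  ultimately have "H (0, 1) - H (0, 0) = 0"
    by linarith
  moreover have "primitive \<gamma> {0..1} (\<lambda>s. H (0, s))"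
    by (rule primitive_cong[OF _ s]) (use \<Gamma>(2) in auto)
  then have "increment \<gamma> (H (0, 1) - H (0, 0))"
    unfolding increment_def by blast
  ultimately show ?thesis
    using increment_unique assms(2) by metis
qed

text \<open>\<open>h p\<close> is the increment along a chosen path from a base point to
  \<open>p\<close>. Loops have increment zero, so within a path-connected part of one domain
  \<open>h\<close> changes exactly as the local function does.\<close>

theorem global_primitive:
  assumes sc: "simply_connected (UNIV :: 'm set)"
    and lpc: "\<And>(p::'m) U. open U \<Longrightarrow> p \<in> U \<Longrightarrow> \<exists>V. open V \<and> p \<in> V \<and> V \<subseteq> U \<and> path_connected V"
  shows "\<exists>h. \<forall>p. \<forall>(U, k)\<in>F. p \<in> U \<longrightarrow> (\<forall>\<^sub>F q in nhds p. h q - k q = h p - k p)"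
proof -
  have loops: "homotopic_loops UNIV \<gamma> (\<lambda>t. a)" if "path \<gamma>" "pathfinish \<gamma> = pathstart \<gamma>" for \<gamma> and a :: 'm
    using sc[unfolded simply_connected_def, rule_format, of \<gamma> "\<lambda>t. a"] that
    by (simp add: path_def pathfinish_def pathstart_def)
  \<comment> \<open>Two constant loops are homotopic as well, and the track of the base point under
    the homotopy joins \<open>p\<close> to \<open>q\<close>.\<close>
  have "\<exists>g. path g \<and> pathstart g = p \<and> pathfinish g = q" for p q :: 'm
  proof -
    obtain \<Gamma> where \<Gamma>: "continuous_on ({0..1::real} \<times> {0..1::real}) \<Gamma>"
      "\<forall>x\<in>{0..1}. \<Gamma> (0, x) = p" "\<forall>x\<in>{0..1}. \<Gamma> (1, x) = q"
    proof -
      have "homotopic_loops UNIV (\<lambda>t. p) (\<lambda>t. q)"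
        by (rule loops) (auto simp: path_def pathfinish_def pathstart_def)
      then show thesis using that unfolding homotopic_loops by blast
    qed
    have "continuous_on {0..1} (\<lambda>t. \<Gamma> (t, 0))"
      by (rule continuous_on_compose2[OF \<Gamma>(1)]) (auto intro!: continuous_intros)
    then show ?thesis
      using \<Gamma>(2,3) by (intro exI[of _ "\<lambda>t. \<Gamma> (t, 0)"]) (auto simp: path_def pathstart_def pathfinish_def)
  qed
  then obtain g where g: "\<And>p q :: 'm. path (g p q)" "\<And>p q. pathstart (g p q) = p"
      "\<And>p q. pathfinish (g p q) = q"
    by metis
  obtain a :: 'm where True by blast
  obtain h where h: "\<And>p. increment (g a p) (h p)"
    using increment_exists[OF g(1)] by metis
  have "\<forall>\<^sub>F q in nhds p. h q - k q = h p - k p" if U: "(U, k) \<in> F" "p \<in> U" for p U k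
  proof -
    obtain V where V: "open V" "p \<in> V" "V \<subseteq> U" "path_connected V"
      using lpc[OF open_dom[OF U(1)] U(2)] by blast
    have "h q - k q = h p - k p" if q: "q \<in> V" for q
    proof -
      obtain \<beta> where \<beta>: "path \<beta>" "path_image \<beta> \<subseteq> V" "pathstart \<beta> = p" "pathfinish \<beta> = q"
        using V(2,4) q unfolding path_connected_def by blast
      have "primitive \<beta> {0..1} (\<lambda>t. k (\<beta> t))"
        using \<beta>(1,2) V(3) by (intro primitive_in_domain[OF U(1)]) (auto simp: path_def path_image_def)
      then have \<beta>i: "increment \<beta> (k q - k p)"
        unfolding increment_def using \<beta>(3,4) by (auto simp: pathstart_def pathfinish_def)
      \<comment> \<open>Out to \<open>p\<close>, inside \<open>V\<close> to \<open>q\<close>, and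
        back to the base point: that the increment vanishes reads
        \<open>h p + (k q - k p) - h q = 0\<close>.\<close>
      let ?l = "(g a p +++ \<beta>) +++ reversepath (g a q)"
      have l: "path ?l" "pathfinish ?l = pathstart ?l"
        using \<beta> g by auto
      obtain r where r: "increment ?l r" using increment_exists[OF l(1)] by blast
      have "r = 0" by (rule increment_loop[OF loops[OF l] r])
      obtain r1 r2 where r12: "increment (g a p +++ \<beta>) r1" "increment (reversepath (g a q)) r2" "r = r1 + r2"
        by (rule increment_join[OF r]) (use \<beta> g in auto)
      obtain r3 r4 where r34: "increment (g a p) r3" "increment \<beta> r4" "r1 = r3 + r4"
        by (rule increment_join[OF r12(1)]) (use \<beta> g in auto)
      have "r2 = - h q" "r3 = h p" "r4 = k q - k p"
        using increment_unique r12(2) r34(1,2) increment_reverse[OF h] h \<beta>i by blast+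
      then show ?thesis
        using \<open>r = 0\<close> r12(3) r34(3) by simp
    qed
    then show ?thesis
      using V(1,2) unfolding eventually_nhds by blast
  qed
  then show ?thesis by blast
qed

end

section \<open>Charts, tangent vectors and closed 1-forms\<close>

locale atlas =
  fixes A :: "('m::topological_space, 'e::euclidean_space) chart set"
  assumes atlas: "smooth_atlas A"
begin

lemma
  assumes "c \<in> A"
  shows open_chart_dom: "open (fst c)"
    and open_chart_image: "open (snd c ` fst c)"
    and chart_inv_left: "p \<in> fst c \<Longrightarrow> chart_inv c (snd c p) = p"
    and chart_inv_right: "x \<in> snd c ` fst c \<Longrightarrow> snd c (chart_inv c x) = x"
    and chart_inv_mem: "x \<in> snd c ` fst c \<Longrightarrow> chart_inv c x \<in> fst c"
    and continuous_on_chart: "continuous_on (fst c) (snd c)"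
    and continuous_on_chart_inv: "continuous_on (snd c ` fst c) (chart_inv c)"
  using assms atlas unfolding smooth_atlas_def is_chart_def homeomorphism_def by auto

lemma chart_at: obtains c where "c \<in> A" "p \<in> fst c"
  using atlas unfolding smooth_atlas_def by blast

lemma open_chart_image_Int:
  assumes "c \<in> A" "open W"
  shows "open (snd c ` (fst c \<inter> W))"
proof -
  have "snd c ` (fst c \<inter> W) = snd c ` fst c \<inter> chart_inv c -` W"
    using chart_inv_left[OF assms(1)] by auto
  then show ?thesis
    using continuous_open_preimage[OF continuous_on_chart_inv open_chart_image] assms by simp
qed

lemma open_chart_preimage:
  assumes "c \<in> A" "open B"
  shows "open (fst c \<inter> snd c -` B)"
  using continuous_open_preimage[OF continuous_on_chart open_chart_dom] assms by simp

definition trans_deriv :: "('m, 'e) chart \<Rightarrow> ('m, 'e) chart \<Rightarrow> 'm \<Rightarrow> 'e \<Rightarrow> 'e" where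
  "trans_deriv c d p = frechet_derivative (snd d \<circ> chart_inv c) (at (snd c p))"

lemma trans_has_derivative:
  assumes "c \<in> A" "d \<in> A" "p \<in> fst c" "p \<in> fst d"
  shows "((snd d \<circ> chart_inv c) has_derivative trans_deriv c d p) (at (snd c p))"
  unfolding trans_deriv_def
  by (rule smooth_open_has_derivative[of "snd c ` (fst c \<inter> fst d)"])
     (use assms atlas in \<open>auto simp: smooth_atlas_def\<close>)

lemma has_derivative_change_chart:
  assumes "c \<in> A" "d \<in> A" "p \<in> fst c" "p \<in> fst d"
    and "((f \<circ> chart_inv d) has_derivative D) (at (snd d p))"
  shows "((f \<circ> chart_inv c) has_derivative (\<lambda>u. D (trans_deriv c d p u))) (at (snd c p))"
proof (rule has_derivative_transform_within_open)
  have "((f \<circ> chart_inv d) has_derivative D) (at ((snd d \<circ> chart_inv c) (snd c p)))"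
    using assms(5) chart_inv_left[OF assms(1,3)] by simp
  then show "((\<lambda>x. (f \<circ> chart_inv d) ((snd d \<circ> chart_inv c) x)) has_derivative
      (\<lambda>u. D (trans_deriv c d p u))) (at (snd c p))"
    by (rule has_derivative_compose[OF trans_has_derivative[OF assms(1-4)]])
  show "open (snd c ` (fst c \<inter> fst d))"
    by (rule open_chart_image_Int[OF assms(1) open_chart_dom[OF assms(2)]])
  show "(f \<circ> chart_inv d) ((snd d \<circ> chart_inv c) x) = (f \<circ> chart_inv c) x"
    if x: "x \<in> snd c ` (fst c \<inter> fst d)" for x
  proof -
    obtain q where q: "q \<in> fst c" "q \<in> fst d" "x = snd c q" using x by blast
    then show ?thesis
      using chart_inv_left[OF assms(1) q(1)] chart_inv_left[OF assms(2) q(2)] by simp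
  qed
qed (use assms(3,4) in blast)

lemma trans_deriv_trans:
  assumes "c \<in> A" "d \<in> A" "e \<in> A" "p \<in> fst c" "p \<in> fst d" "p \<in> fst e"
  shows "trans_deriv d e p (trans_deriv c d p u) = trans_deriv c e p u"
  using has_derivative_unique[OF has_derivative_change_chart[OF assms(1,2,4,5)
        trans_has_derivative[OF assms(2,3,5,6)]] trans_has_derivative[OF assms(1,3,4,6)]]
  by metis

lemma trans_deriv_self:
  assumes "c \<in> A" "p \<in> fst c"
  shows "trans_deriv c c p = id"
proof -
  have "((snd c \<circ> chart_inv c) has_derivative id) (at (snd c p))"
  proof (rule has_derivative_transform_within_open[where f = "\<lambda>x. x"])
    show "((\<lambda>x. x) has_derivative id) (at (snd c p))"
      using has_derivative_ident by (simp add: id_def)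
    show "open (snd c ` fst c)" by (rule open_chart_image[OF assms(1)])
  qed (use assms chart_inv_right[OF assms(1)] in simp_all)
  then show ?thesis
    using has_derivative_unique trans_has_derivative[OF assms(1,1,2,2)] by blast
qed

text \<open>Inverse to reading off the component in the chart \<open>c\<close>; through it,
  statements about tangent vectors are tested on coordinate vectors. The value 0 follows the
  convention of \<open>tangent_space\<close>.\<close>

definition tvec_of :: "'m \<Rightarrow> ('m, 'e) chart \<Rightarrow> 'e \<Rightarrow> ('m, 'e) tvec" where
  "tvec_of p c u d = (if d \<in> A \<and> p \<in> fst d then trans_deriv c d p u else 0)"

lemma tvec_of_in:
  assumes "c \<in> A" "p \<in> fst c"
  shows "tvec_of p c u \<in> tangent_space A p"
  unfolding tangent_space_def mem_Collect_eq
proof (intro conjI ballI allI impI)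
  fix d e assume de: "d \<in> A" "e \<in> A" "p \<in> fst d \<inter> fst e"
  then show "tvec_of p c u e = frechet_derivative (snd e \<circ> chart_inv d) (at (snd d p)) (tvec_of p c u d)"
    using trans_deriv_trans[OF assms(1) de(1,2) assms(2), of u]
    by (simp add: tvec_of_def trans_deriv_def[of d e, symmetric])
qed (auto simp: tvec_of_def)

lemma tvec_of_self: "c \<in> A \<Longrightarrow> p \<in> fst c \<Longrightarrow> tvec_of p c u c = u"
  by (simp add: tvec_of_def trans_deriv_self)

lemma tangent_space_trans:
  "X \<in> tangent_space A p \<Longrightarrow> c \<in> A \<Longrightarrow> d \<in> A \<Longrightarrow> p \<in> fst c \<Longrightarrow> p \<in> fst d \<Longrightarrow>
    X d = trans_deriv c d p (X c)"
  unfolding tangent_space_def trans_deriv_def by blast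

lemma tangent_space_outside:
  "X \<in> tangent_space A p \<Longrightarrow> \<not> (c \<in> A \<and> p \<in> fst c) \<Longrightarrow> X c = 0"
  unfolding tangent_space_def by blast

lemma tangent_space_eqI:
  assumes "X \<in> tangent_space A p" "Y \<in> tangent_space A p" "c \<in> A" "p \<in> fst c" "X c = Y c"
  shows "X = Y"
proof
  fix d
  show "X d = Y d"
  proof (cases "d \<in> A \<and> p \<in> fst d")
    case True
    then show ?thesis
      using tangent_space_trans[OF assms(1)] tangent_space_trans[OF assms(2)] assms(3-5) by metis
  next
    case False
    then show ?thesis using tangent_space_outside assms(1,2) by metis
  qed
qed

text \<open>Frees \<open>pushv\<close> from the chart selected by \<open>SOME\<close>: passing to
  another chart changes the component of \<open>X\<close> and the derivative of \<open>f\<close> by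
  the same \<open>trans_deriv\<close>, and the two changes cancel.\<close>

lemma pushv_eq:
  assumes "c \<in> A" "p \<in> fst c" "X \<in> tangent_space A p"
    and "((f \<circ> chart_inv c) has_derivative D) (at (snd c p))"
  shows "pushv A f p X = D (X c)"
proof -
  define c0 where "c0 = (SOME c. c \<in> A \<and> p \<in> fst c)"
  have c0: "c0 \<in> A" "p \<in> fst c0"
    using someI[of "\<lambda>c. c \<in> A \<and> p \<in> fst c" c] assms(1,2) unfolding c0_def by blast+
  have "frechet_derivative (f \<circ> chart_inv c0) (at (snd c0 p)) = (\<lambda>u. D (trans_deriv c0 c p u))"
    using frechet_derivative_at[OF has_derivative_change_chart[OF c0(1) assms(1) c0(2) assms(2,4)]] by simp
  then show ?thesis
    using tangent_space_trans[OF assms(3) c0(1) assms(1) c0(2) assms(2)]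
    by (simp add: pushv_def c0_def[symmetric])
qed

lemma smooth_fun_has_derivative:
  assumes "smooth_fun A f" "c \<in> A" "x \<in> snd c ` fst c"
  shows "((f \<circ> chart_inv c) has_derivative frechet_derivative (f \<circ> chart_inv c) (at x)) (at x)"
  using assms smooth_open_has_derivative unfolding smooth_fun_def by blast

lemma locally_path_connected:
  fixes U :: "'m set"
  assumes "open U" "p \<in> U"
  shows "\<exists>V. open V \<and> p \<in> V \<and> V \<subseteq> U \<and> path_connected V"
proof -
  obtain c where c: "c \<in> A" "p \<in> fst c" by (rule chart_at)
  have "snd c p \<in> snd c ` (fst c \<inter> U)" using c assms by blast
  then obtain r where r: "r > 0" "ball (snd c p) r \<subseteq> snd c ` (fst c \<inter> U)"
    using open_chart_image_Int[OF c(1) assms(1)] openE by blast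
  let ?V = "fst c \<inter> snd c -` ball (snd c p) r"
  have eq: "?V = chart_inv c ` ball (snd c p) r"
  proof
    show "?V \<subseteq> chart_inv c ` ball (snd c p) r"
      using chart_inv_left[OF c(1)] by force
    show "chart_inv c ` ball (snd c p) r \<subseteq> ?V"
    proof (rule image_subsetI)
      fix x assume x: "x \<in> ball (snd c p) r"
      then have "x \<in> snd c ` fst c" using r(2) by blast
      then show "chart_inv c x \<in> ?V" using chart_inv_right chart_inv_mem c(1) x by simp
    qed
  qed
  have "path_connected ?V"
    unfolding eq
  proof (rule path_connected_continuous_image)
    show "continuous_on (ball (snd c p) r) (chart_inv c)"
      by (rule continuous_on_subset[OF continuous_on_chart_inv[OF c(1)]]) (use r(2) in blast)
  qed (simp add: convex_imp_path_connected)
  moreover have "?V \<subseteq> U"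
  proof
    fix q assume q: "q \<in> ?V"
    then obtain q' where "q' \<in> fst c \<inter> U" "snd c q = snd c q'" using r(2) by auto
    then show "q \<in> U" using q chart_inv_left[OF c(1)] by (metis IntD1 IntD2)
  qed
  ultimately show ?thesis
    using open_chart_preimage[OF c(1) open_ball] c(2) r(1) by (intro exI[of _ ?V]) auto
qed

lemma zero_derivative_locally_const:
  fixes f :: "'m \<Rightarrow> real"
  assumes "open W" "p0 \<in> W"
    and "\<And>p c. p \<in> W \<Longrightarrow> c \<in> A \<Longrightarrow> p \<in> fst c \<Longrightarrow>
      ((f \<circ> chart_inv c) has_derivative (\<lambda>u. 0)) (at (snd c p))"
  shows "\<forall>\<^sub>F q in nhds p0. f q = f p0"
proof -
  obtain c where c: "c \<in> A" "p0 \<in> fst c" by (rule chart_at)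
  have "snd c p0 \<in> snd c ` (fst c \<inter> W)" using c assms by blast
  then obtain r where r: "r > 0" "ball (snd c p0) r \<subseteq> snd c ` (fst c \<inter> W)"
    using open_chart_image_Int[OF c(1) assms(1)] openE by blast
  have "((f \<circ> chart_inv c) has_derivative (\<lambda>u. 0)) (at x within ball (snd c p0) r)"
    if x: "x \<in> ball (snd c p0) r" for x
  proof -
    obtain p where "p \<in> fst c" "p \<in> W" "x = snd c p" using x r(2) by blast
    then show ?thesis
      using assms(3)[OF _ c(1)] by (auto intro: has_derivative_at_withinI)
  qed
  then obtain k where k: "\<And>x. x \<in> ball (snd c p0) r \<Longrightarrow> (f \<circ> chart_inv c) x = k"
    using has_derivative_zero_constant[OF convex_ball] by metis
  have "f q = f p0" if q: "q \<in> fst c \<inter> snd c -` ball (snd c p0) r" for q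
    using k[of "snd c q"] k[of "snd c p0"] q r(1) c chart_inv_left by simp
  moreover have "p0 \<in> fst c \<inter> snd c -` ball (snd c p0) r"
    using c(2) r(1) by simp
  ultimately show ?thesis
    unfolding eventually_nhds using open_chart_preimage[OF c(1) open_ball] by blast
qed

lemma zero_derivative_const:
  fixes f :: "'m \<Rightarrow> real"
  assumes "connected (UNIV :: 'm set)"
    and "\<And>p c. c \<in> A \<Longrightarrow> p \<in> fst c \<Longrightarrow> ((f \<circ> chart_inv c) has_derivative (\<lambda>u. 0)) (at (snd c p))"
  shows "f p = f q"
proof (rule connected_local_const[OF assms(1) UNIV_I UNIV_I], rule ballI)
  fix a :: 'm
  have "\<forall>\<^sub>F b in nhds a. f b = f a"
    by (rule zero_derivative_locally_const[OF open_UNIV]) (use assms(2) in auto)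
  then show "\<forall>\<^sub>F b in at a. f a = f b"
    unfolding eventually_at_filter by (rule eventually_mono) simp
qed

text \<open>A closed 1-form is given by its coordinate vectors \<open>G c\<close> in the charts \<open>c\<close>.\<close>

lemma closed_form_exact:
  fixes G :: "('m, 'e) chart \<Rightarrow> 'e \<Rightarrow> 'e"
  assumes sc: "simply_connected (UNIV :: 'm set)"
    and smooth: "\<And>c. c \<in> A \<Longrightarrow> smooth_open (snd c ` fst c) (G c)"
    and closed: "\<And>c x u w. c \<in> A \<Longrightarrow> x \<in> snd c ` fst c \<Longrightarrow>
      frechet_derivative (G c) (at x) u \<bullet> w = frechet_derivative (G c) (at x) w \<bullet> u"
    and trans: "\<And>c d p u. c \<in> A \<Longrightarrow> d \<in> A \<Longrightarrow> p \<in> fst c \<Longrightarrow> p \<in> fst d \<Longrightarrow>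
      G d (snd d p) \<bullet> trans_deriv c d p u = G c (snd c p) \<bullet> u"
  obtains h :: "'m \<Rightarrow> real" where
    "\<And>c p. c \<in> A \<Longrightarrow> p \<in> fst c \<Longrightarrow>
      ((h \<circ> chart_inv c) has_derivative (\<lambda>u. G c (snd c p) \<bullet> u)) (at (snd c p))"
proof -
  define prim where "prim U h \<longleftrightarrow> (\<forall>p\<in>U. \<forall>c\<in>A. p \<in> fst c \<longrightarrow>
      ((h \<circ> chart_inv c) has_derivative (\<lambda>u. G c (snd c p) \<bullet> u)) (at (snd c p)))"
    for U and h :: "'m \<Rightarrow> real"
  \<comment> \<open>All primitives of the form on all open sets. The Poincare lemma on coordinate
    balls shows that their domains cover, and the vanishing derivative of a difference gives
    compatibility.\<close>
  define F where "F = {(U, h). open U \<and> prim U h}"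
  interpret local_system F
  proof
    show "open U" if "(U, h) \<in> F" for U h
      using that by (simp add: F_def)
  next
    fix p
    obtain c where c: "c \<in> A" "p \<in> fst c" by (rule chart_at)
    then obtain r where r: "r > 0" "ball (snd c p) r \<subseteq> snd c ` fst c"
      using open_chart_image[OF c(1)] openE by blast
    obtain h where h: "\<And>x. x \<in> ball (snd c p) r \<Longrightarrow> (h has_derivative (\<lambda>u. G c x \<bullet> u)) (at x)"
      using poincare_lemma[OF open_chart_image[OF c(1)] smooth[OF c(1)] r(2) closed[OF c(1)]] by blast
    let ?U = "fst c \<inter> snd c -` ball (snd c p) r"
    have "prim ?U (h \<circ> snd c)"
      unfolding prim_def
    proof (intro ballI impI)
      fix q d assume q: "q \<in> ?U" and d: "d \<in> A" "q \<in> fst d"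
      have "((h \<circ> snd c \<circ> chart_inv c) has_derivative (\<lambda>u. G c (snd c q) \<bullet> u)) (at (snd c q))"
        by (rule has_derivative_transform_within_open[OF h open_ball])
           (use q r(2) chart_inv_right[OF c(1)] in \<open>auto simp: subset_iff\<close>)
      from has_derivative_change_chart[OF d(1) c(1) d(2) _ this] q
      have "((h \<circ> snd c \<circ> chart_inv d) has_derivative
          (\<lambda>u. G c (snd c q) \<bullet> trans_deriv d c q u)) (at (snd d q))"
        by simp
      then show "((h \<circ> snd c \<circ> chart_inv d) has_derivative (\<lambda>u. G d (snd d q) \<bullet> u)) (at (snd d q))"
        using trans[OF d(1) c(1) d(2)] q by simp
    qed
    then have "(?U, h \<circ> snd c) \<in> F"
      using open_chart_preimage[OF c(1) open_ball] by (simp add: F_def)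
    then show "\<exists>U h. (U, h) \<in> F \<and> p \<in> U"
      using c(2) r(1) by (intro exI[of _ ?U] exI[of _ "h \<circ> snd c"]) simp
  next
    fix U h V k p assume U: "(U, h) \<in> F" and V: "(V, k) \<in> F" and p: "p \<in> U" "p \<in> V"
    show "\<forall>\<^sub>F q in nhds p. h q - k q = h p - k p"
    proof (rule zero_derivative_locally_const[where W = "U \<inter> V"])
      fix q c assume q: "q \<in> U \<inter> V" "c \<in> A" "q \<in> fst c"
      have h: "((h \<circ> chart_inv c) has_derivative (\<lambda>u. G c (snd c q) \<bullet> u)) (at (snd c q))"
        using U q unfolding F_def prim_def by blast
      have k: "((k \<circ> chart_inv c) has_derivative (\<lambda>u. G c (snd c q) \<bullet> u)) (at (snd c q))"
        using V q unfolding F_def prim_def by blast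
      have "((\<lambda>x. (h \<circ> chart_inv c) x - (k \<circ> chart_inv c) x) has_derivative
          (\<lambda>u. G c (snd c q) \<bullet> u - G c (snd c q) \<bullet> u)) (at (snd c q))"
        by (rule has_derivative_diff[OF h k])
      then show "(((\<lambda>q. h q - k q) \<circ> chart_inv c) has_derivative (\<lambda>u. 0)) (at (snd c q))"
        by (simp add: o_def)
    qed (use U V p in \<open>auto simp: F_def\<close>)
  qed
  obtain h where h: "\<And>p U k. (U, k) \<in> F \<Longrightarrow> p \<in> U \<Longrightarrow> \<forall>\<^sub>F q in nhds p. h q - k q = h p - k p"
    using global_primitive[OF sc locally_path_connected] by fast
  have "((h \<circ> chart_inv c) has_derivative (\<lambda>u. G c (snd c p) \<bullet> u)) (at (snd c p))"
    if c: "c \<in> A" "p \<in> fst c" for c p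
  proof -
    obtain U k where U: "(U, k) \<in> F" "p \<in> U" using cover by blast
    obtain W where W: "open W" "p \<in> W" "\<And>q. q \<in> W \<Longrightarrow> h q - k q = h p - k p"
      using h[OF U] unfolding eventually_nhds by blast
    have "((k \<circ> chart_inv c) has_derivative (\<lambda>u. G c (snd c p) \<bullet> u)) (at (snd c p))"
      using U c by (auto simp: F_def prim_def)
    then have "((\<lambda>x. (k \<circ> chart_inv c) x + (h p - k p)) has_derivative (\<lambda>u. G c (snd c p) \<bullet> u + 0)) (at (snd c p))"
      by (intro has_derivative_add has_derivative_const)
    then have "((\<lambda>x. (k \<circ> chart_inv c) x + (h p - k p)) has_derivative (\<lambda>u. G c (snd c p) \<bullet> u)) (at (snd c p))"
      by simp
    then show ?thesis
    proof (rule has_derivative_transform_within_open)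
      show "open (snd c ` (fst c \<inter> W))" by (rule open_chart_image_Int[OF c(1) W(1)])
      show "snd c p \<in> snd c ` (fst c \<inter> W)" using c W by blast
      fix x assume "x \<in> snd c ` (fst c \<inter> W)"
      then have "chart_inv c x \<in> W" using chart_inv_left[OF c(1)] by auto
      then show "(k \<circ> chart_inv c) x + (h p - k p) = (h \<circ> chart_inv c) x"
        using W(3) by fastforce
    qed
  qed
  then show thesis by (rule that)
qed

end

section \<open>The flow and differentials on the hypersurface\<close>

lemma pseudohyp_iff: "z \<in> pseudohyp \<longleftrightarrow> blinfun_apply (snd z) (fst z) = -1"
  by (simp add: pseudohyp_def)

lemma pseudohyp_tangent_iff:
  "X \<in> pseudohyp_tangent z \<longleftrightarrow> blinfun_apply (snd X) (fst z) + blinfun_apply (snd z) (fst X) = 0"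
  by (simp add: pseudohyp_tangent_def)

lemma horizontal_space_subset_tangent: "horizontal_space z \<subseteq> pseudohyp_tangent z"
  by (auto simp: horizontal_space_def)

lemma hor_part_horizontal: "X \<in> horizontal_space z \<Longrightarrow> hor_part z X = X"
  by (simp add: hor_part_def horizontal_space_def)

lemma phi_in_horizontal_space:
  assumes "z \<in> pseudohyp" "X \<in> pseudohyp_tangent z"
  shows "phi z X \<in> horizontal_space z"
  using hor_part_in[OF assms] by (simp add: horizontal_space_eq phi_def blinfun.bilinear_simps)

lemma phi_hor_part:
  assumes "z \<in> pseudohyp" "X \<in> pseudohyp_tangent z"
  shows "phi z (hor_part z X) = phi z X"
  by (simp add: phi_def hor_part_horizontal[OF hor_part_in[OF assms]])

lemma flow_0: "flow 0 z = z"
  by (simp add: flow_def)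

lemma flow_flow: "flow s (flow t z) = flow (s + t) z"
  by (simp add: flow_def mult_exp_exp)

lemma flow_pairing:
  "blinfun_apply (snd (flow t X)) (fst (flow t Y)) = blinfun_apply (snd X) (fst Y)"
  by (simp add: flow_def blinfun.bilinear_simps mult.assoc[symmetric] mult_exp_exp)

lemma flow_pseudohyp: "z \<in> pseudohyp \<Longrightarrow> flow t z \<in> pseudohyp"
  by (simp add: pseudohyp_iff flow_pairing)

lemma bounded_linear_flow: "bounded_linear (flow t)"
  unfolding flow_def
  by (intro bounded_linear_Pair bounded_linear_const_scaleR bounded_linear_fst bounded_linear_snd)

lemma flow_tangent: "X \<in> pseudohyp_tangent z \<Longrightarrow> flow t X \<in> pseudohyp_tangent (flow t z)"
  by (simp add: pseudohyp_tangent_iff flow_pairing)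

lemma amb_metric_flow: "amb_metric (flow t X) (flow t Y) = amb_metric X Y"
  by (simp add: amb_metric_def flow_pairing)

lemma zeta_flow: "zeta (flow t z) = flow t (zeta z)"
  by (simp add: zeta_def flow_def)

lemma hor_part_flow: "hor_part (flow t z) (flow t X) = flow t (hor_part z X)"
proof -
  interpret bounded_linear "flow t :: 'a amb \<Rightarrow> 'a amb" by (rule bounded_linear_flow)
  show ?thesis
    by (simp only: hor_part_def zeta_flow amb_metric_flow diff scaleR)
qed

lemma phi_flow: "phi (flow t z) (flow t X) = flow t (phi z X)"
  by (simp add: phi_def hor_part_flow) (simp add: flow_def)

lemma orbit_flow: "orbit (flow t z) = orbit z"
proof -
  have "flow s z \<in> range (\<lambda>s. flow (s + t) z)" for s
    by (rule range_eqI[of _ _ "s - t"]) simp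
  then show ?thesis unfolding orbit_def flow_flow by auto
qed

lemma proj_minus_flow: "proj_minus (flow t z) = proj_minus z"
  by (simp add: proj_minus_def orbit_flow)

lemma proj_minus_eqD:
  assumes "z \<in> pseudohyp" "w \<in> pseudohyp" "proj_minus z = proj_minus w"
  obtains t where "w = flow t z"
proof -
  have "orbit z = orbit w"
    using assms by (simp add: proj_minus_def Abs_parahyp_inject)
  moreover have "w \<in> orbit w"
    unfolding orbit_def by (rule range_eqI[of _ _ 0]) (simp add: flow_0)
  ultimately show thesis using that unfolding orbit_def by auto
qed

lemma repr: "repr q \<in> pseudohyp" "proj_minus (repr q) = q"
proof -
  obtain z where "z \<in> pseudohyp" "q = proj_minus z"
    unfolding proj_minus_def by (cases q rule: Abs_parahyp_cases) blast
  then have "repr q \<in> pseudohyp \<and> proj_minus (repr q) = q"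
    unfolding repr_def using someI[of "\<lambda>z. z \<in> pseudohyp \<and> proj_minus z = q" z] by simp
  then show "repr q \<in> pseudohyp" "proj_minus (repr q) = q" by simp_all
qed

text \<open>Moving along \<open>z + t X\<close> leaves the hypersurface only to second order,
  so rescaling the covector gives a curve with the same velocity.\<close>

lemma pseudohyp_curve:
  assumes "z \<in> pseudohyp" "X \<in> pseudohyp_tangent z"
  obtains \<gamma> and S :: "real set" where "open S" "0 \<in> S" "\<gamma> ` S \<subseteq> pseudohyp" "\<gamma> 0 = z"
    "(\<gamma> has_derivative (\<lambda>t. t *\<^sub>R X)) (at 0)"
proof -
  define b where "b = blinfun_apply (snd X) (fst X)"
  define \<gamma> where "\<gamma> t = (fst z + t *\<^sub>R fst X, inverse (1 - t * t * b) *\<^sub>R (snd z + t *\<^sub>R snd X))" for t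
  define S where "S = {t. 1 - t * t * b \<noteq> 0}"
  have val: "blinfun_apply (snd z + t *\<^sub>R snd X) (fst z + t *\<^sub>R fst X) = - (1 - t * t * b)" for t
  proof -
    have "blinfun_apply (snd z + t *\<^sub>R snd X) (fst z + t *\<^sub>R fst X) =
        -1 + t * (blinfun_apply (snd X) (fst z) + blinfun_apply (snd z) (fst X)) + t * t * b"
      using assms(1) by (simp add: pseudohyp_iff blinfun.bilinear_simps b_def algebra_simps)
    then show ?thesis using assms(2) by (simp add: pseudohyp_tangent_iff)
  qed
  show thesis
  proof (rule that[of S \<gamma>])
    show "open S" unfolding S_def
      by (intro open_Collect_neq continuous_intros)
    show "\<gamma> ` S \<subseteq> pseudohyp"
    proof (rule image_subsetI)
      fix t assume "t \<in> S"
      then have "1 - t * t * b \<noteq> 0" by (simp add: S_def)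
      then show "\<gamma> t \<in> pseudohyp"
        using val[of t] by (simp only: pseudohyp_iff \<gamma>_def fst_conv snd_conv blinfun.scaleR_left)
          (simp add: field_simps)
    qed
    have "((\<lambda>t. inverse (1 - t * t * b)) has_derivative (\<lambda>t. 0)) (at 0)"
      by (auto intro!: derivative_eq_intros)
    then have "((\<lambda>t. inverse (1 - t * t * b) *\<^sub>R (snd z + t *\<^sub>R snd X)) has_derivative
        (\<lambda>t. t *\<^sub>R snd X)) (at 0)"
      by (rule has_derivative_eq_rhs[OF has_derivative_scaleR[where g' = "\<lambda>t. t *\<^sub>R snd X"]])
         (auto intro!: derivative_eq_intros)
    moreover have "((\<lambda>t. fst z + t *\<^sub>R fst X) has_derivative (\<lambda>t. t *\<^sub>R fst X)) (at 0)"
      by (auto intro!: derivative_eq_intros)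
    ultimately show "(\<gamma> has_derivative (\<lambda>t. t *\<^sub>R X)) (at 0)"
      unfolding \<gamma>_def scaleR_prod_def by (intro has_derivative_Pair)
  qed (simp_all add: S_def \<gamma>_def)
qed

lemma has_derivative_compose_pseudohyp:
  assumes "(\<sigma> has_derivative S) (at x)" "open N" "x \<in> N" "\<sigma> ` N \<subseteq> pseudohyp"
    and "(f has_derivative D) (at (\<sigma> x) within pseudohyp)"
  shows "((\<lambda>y. f (\<sigma> y)) has_derivative (\<lambda>u. D (S u))) (at x)"
proof -
  have "(\<sigma> has_derivative S) (at x within N)"
    by (rule has_derivative_at_withinI[OF assms(1)])
  moreover have "(f has_derivative D) (at (\<sigma> x) within \<sigma> ` N)"
    by (rule has_derivative_subset[OF assms(5,4)])
  ultimately have "((\<lambda>y. f (\<sigma> y)) has_derivative (\<lambda>u. D (S u))) (at x within N)"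
    by (rule has_derivative_in_compose)
  then show ?thesis using at_within_open[OF assms(3,2)] by simp
qed

text \<open>Each tangent vector is the velocity of a curve inside the hypersurface, and along that
  curve both candidates compute the derivative of the same composite.\<close>

lemma pseudohyp_derivative_unique:
  assumes "z \<in> pseudohyp" "X \<in> pseudohyp_tangent z"
    and "(f has_derivative D) (at z within pseudohyp)" "(f has_derivative D') (at z within pseudohyp)"
  shows "D X = D' X"
proof -
  obtain \<gamma> and S :: "real set" where \<gamma>: "open S" "0 \<in> S" "\<gamma> ` S \<subseteq> pseudohyp" "\<gamma> 0 = z"
    "(\<gamma> has_derivative (\<lambda>t. t *\<^sub>R X)) (at 0)"
    by (rule pseudohyp_curve[OF assms(1,2)])
  have "(\<lambda>t. D (t *\<^sub>R X)) = (\<lambda>t. D' (t *\<^sub>R X))"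
    by (rule has_derivative_unique[OF has_derivative_compose_pseudohyp[OF \<gamma>(5,1,2,3)]
          has_derivative_compose_pseudohyp[OF \<gamma>(5,1,2,3)]])
       (use assms(3,4) \<gamma>(4) in simp_all)
  then show ?thesis by (metis scaleR_one)
qed

lemma hyp_diff_eq:
  assumes "z \<in> pseudohyp" "X \<in> pseudohyp_tangent z" "(f has_derivative D) (at z within pseudohyp)"
  shows "hyp_diff f z X = D X"
proof (rule pseudohyp_derivative_unique[OF assms(1,2) _ assms(3)])
  show "(f has_derivative hyp_diff f z) (at z within pseudohyp)"
    unfolding hyp_diff_def using assms(3) frechet_derivative_works differentiableI by blast
qed

lemma derivative_in_pseudohyp_tangent:
  assumes "(\<sigma> has_derivative S) (at x)" "open N" "x \<in> N" "\<sigma> ` N \<subseteq> pseudohyp"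
  shows "S u \<in> pseudohyp_tangent (\<sigma> x)"
proof -
  have "((\<lambda>y. blinfun_apply (snd (\<sigma> y)) (fst (\<sigma> y))) has_derivative
      (\<lambda>u. blinfun_apply (snd (\<sigma> x)) (fst (S u)) + blinfun_apply (snd (S u)) (fst (\<sigma> x)))) (at x)"
    by (intro bounded_bilinear.FDERIV[OF bounded_bilinear_blinfun_apply] has_derivative_fst
        has_derivative_snd assms(1))
  moreover have "((\<lambda>y. blinfun_apply (snd (\<sigma> y)) (fst (\<sigma> y))) has_derivative (\<lambda>u. 0)) (at x)"
    by (rule has_derivative_transform_within_open[OF has_derivative_const[of "-1"] assms(2,3)])
       (use assms(4) in \<open>auto simp: pseudohyp_iff\<close>)
  ultimately have "(\<lambda>u. blinfun_apply (snd (\<sigma> x)) (fst (S u)) + blinfun_apply (snd (S u)) (fst (\<sigma> x))) = (\<lambda>u. 0)"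
    by (rule has_derivative_unique)
  then show ?thesis by (simp add: pseudohyp_tangent_iff fun_eq_iff add.commute)
qed

text \<open>Smoothness on the hypersurface supplies a local extension to the ambient space, which
  agrees with the chart only over the chart domain. Openness of that domain in the quotient topology
  makes this include all nearby points of the hypersurface.\<close>

lemma parahyp_chart_derivative:
  assumes "d \<in> parahyp_atlas" "z \<in> pseudohyp" "proj_minus z \<in> fst d"
  shows "((snd d \<circ> proj_minus) has_derivative hyp_diff (snd d \<circ> proj_minus) z) (at z within pseudohyp)"
proof -
  have op: "open (fst d)"
    and sm: "smooth_subset {z \<in> pseudohyp. proj_minus z \<in> fst d} (snd d \<circ> proj_minus)"
    using assms(1) unfolding parahyp_atlas_def is_chart_def by auto
  obtain Q where Q: "open Q" "{z \<in> pseudohyp. proj_minus z \<in> fst d} = pseudohyp \<inter> Q"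
    using op unfolding open_parahyp_def openin_open by blast
  let ?P = "{z \<in> pseudohyp. proj_minus z \<in> fst d}"
  have zP: "z \<in> ?P" using assms(2,3) by simp
  from bspec[OF sm[unfolded smooth_subset_def] zP]
  obtain U F where U: "open U" "z \<in> U" "smooth_open U F"
    and F: "\<forall>y\<in>?P \<inter> U. F y = (snd d \<circ> proj_minus) y"
    by (elim exE conjE)
  have "z \<in> U \<inter> Q" "open (U \<inter> Q)" using assms(2,3) U Q by auto
  then obtain r where r: "r > 0" "ball z r \<subseteq> U \<inter> Q" using openE by blast
  have "(F has_derivative frechet_derivative F (at z)) (at z within pseudohyp)"
    by (rule has_derivative_at_withinI[OF smooth_open_has_derivative[OF U(3,2)]])
  then have "((snd d \<circ> proj_minus) has_derivative frechet_derivative F (at z)) (at z within pseudohyp)"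
  proof (rule has_derivative_transform_within[OF _ r(1) assms(2)])
    fix y assume y: "y \<in> pseudohyp" "dist y z < r"
    then have "y \<in> U" "y \<in> Q" using r(2) by (auto simp: dist_commute)
    then show "F y = (snd d \<circ> proj_minus) y" using F Q(2) y(1) by blast
  qed
  then show ?thesis
    unfolding hyp_diff_def using frechet_derivative_works differentiableI by blast
qed

lemma hyp_diff_chart_compose:
  assumes "d \<in> parahyp_atlas" "proj_minus (\<sigma> x) \<in> fst d"
    and "(\<sigma> has_derivative S) (at x)" "open N" "x \<in> N" "\<sigma> ` N \<subseteq> pseudohyp"
  shows "((\<lambda>y. snd d (proj_minus (\<sigma> y))) has_derivative
      (\<lambda>u. proj_diff (\<sigma> x) (S u) d)) (at x)"
  using has_derivative_compose_pseudohyp[OF assms(3-6)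
      parahyp_chart_derivative[OF assms(1) _ assms(2)]] assms
  by (auto simp: proj_diff_def)

lemma hyp_diff_linear:
  assumes "d \<in> parahyp_atlas" "z \<in> pseudohyp" "proj_minus z \<in> fst d"
  shows "linear (hyp_diff (snd d \<circ> proj_minus) z)"
  using parahyp_chart_derivative[OF assms] has_derivative_bounded_linear bounded_linear.linear by blast

lemma proj_diff_diff:
  assumes "z \<in> pseudohyp"
  shows "proj_diff z (X - Y) = (\<lambda>d. proj_diff z X d - proj_diff z Y d)"
  using hyp_diff_linear[OF _ assms] by (auto simp: proj_diff_def fun_eq_iff linear_diff)

lemma proj_diff_scaleR:
  assumes "z \<in> pseudohyp"
  shows "proj_diff z (r *\<^sub>R X) = (\<lambda>d. r *\<^sub>R proj_diff z X d)"
  using hyp_diff_linear[OF _ assms] by (auto simp: proj_diff_def fun_eq_iff linear_scale)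

text \<open>\<open>zeta z\<close> is the velocity at \<open>z\<close> of the flow, along which
  \<open>proj_minus\<close> is constant.\<close>

lemma proj_diff_zeta:
  assumes "z \<in> pseudohyp"
  shows "proj_diff z (zeta z) = (\<lambda>d. 0)"
proof
  fix d
  show "proj_diff z (zeta z) d = 0"
  proof (cases "d \<in> parahyp_atlas \<and> proj_minus z \<in> fst d")
    case True
    have "((\<lambda>t. flow t z) has_derivative (\<lambda>t. t *\<^sub>R zeta z)) (at 0)"
      unfolding flow_def zeta_def
      by (auto intro!: derivative_eq_intros simp: scaleR_prod_def)
    then have "((\<lambda>t. snd d (proj_minus (flow t z))) has_derivative
        (\<lambda>t. proj_diff (flow 0 z) (t *\<^sub>R zeta z) d)) (at 0)"
      using True flow_pseudohyp[OF assms]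
      by (intro hyp_diff_chart_compose[where N = UNIV]) (auto simp: flow_0)
    moreover have "((\<lambda>t. snd d (proj_minus (flow t z))) has_derivative (\<lambda>t. 0)) (at 0)"
      by (simp add: proj_minus_flow)
    ultimately have "(\<lambda>t. proj_diff (flow 0 z) (t *\<^sub>R zeta z) d) = (\<lambda>t. 0)"
      by (rule has_derivative_unique)
    from fun_cong[OF this, of 1] show ?thesis by (simp add: flow_0)
  qed (auto simp: proj_diff_def)
qed

lemma proj_diff_hor_part:
  "z \<in> pseudohyp \<Longrightarrow> proj_diff z (hor_part z X) = proj_diff z X"
  by (simp add: hor_part_def proj_diff_diff proj_diff_scaleR proj_diff_zeta)

lemma proj_diff_flow:
  assumes "z \<in> pseudohyp" "X \<in> pseudohyp_tangent z"
  shows "proj_diff (flow t z) (flow t X) = proj_diff z X"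
proof
  fix d
  show "proj_diff (flow t z) (flow t X) d = proj_diff z X d"
  proof (cases "d \<in> parahyp_atlas \<and> proj_minus z \<in> fst d")
    case True
    let ?f = "snd d \<circ> proj_minus"
    have "(flow t has_derivative flow t) (at z within pseudohyp)"
      by (rule bounded_linear_imp_has_derivative[OF bounded_linear_flow])
    moreover have "(?f has_derivative hyp_diff ?f (flow t z)) (at (flow t z) within flow t ` pseudohyp)"
      by (rule has_derivative_subset[OF parahyp_chart_derivative])
         (use True flow_pseudohyp[OF assms(1)] flow_pseudohyp in \<open>auto simp: proj_minus_flow\<close>)
    ultimately have "((\<lambda>y. ?f (flow t y)) has_derivative (\<lambda>u. hyp_diff ?f (flow t z) (flow t u)))
        (at z within pseudohyp)"
      by (rule has_derivative_in_compose)
    then have "(?f has_derivative (\<lambda>u. hyp_diff ?f (flow t z) (flow t u))) (at z within pseudohyp)"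
      by (simp add: proj_minus_flow o_def)
    from hyp_diff_eq[OF assms this] show ?thesis
      by (simp add: proj_diff_def proj_minus_flow)
  qed (auto simp: proj_diff_def proj_minus_flow)
qed

section \<open>Affine charts of the para-complex hyperbolic space\<close>

lemma blinfun_apply_axis_sum:
  fixes \<alpha> :: "'n::finite rcovec"
  shows "blinfun_apply \<alpha> x = (\<Sum>k\<in>UNIV. x $ k * blinfun_apply \<alpha> (axis k 1))"
proof -
  have "x = (\<Sum>k\<in>UNIV. x $ k *\<^sub>R axis k 1)"
    by (simp add: vec_eq_iff axis_def if_distrib cong: if_cong)
  then have "blinfun_apply \<alpha> x = blinfun_apply \<alpha> (\<Sum>k\<in>UNIV. x $ k *\<^sub>R axis k 1)"
    by (rule arg_cong)
  then show ?thesis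
    by (simp only: blinfun.sum_right blinfun.scaleR_right real_scaleR_def)
qed

lemma rcovec_eqI:
  fixes \<alpha> \<beta> :: "'n::finite rcovec"
  assumes "\<And>k. blinfun_apply \<alpha> (axis k 1) = blinfun_apply \<beta> (axis k 1)"
  shows "\<alpha> = \<beta>"
proof (rule blinfun_eqI)
  show "blinfun_apply \<alpha> x = blinfun_apply \<beta> x" for x
    unfolding blinfun_apply_axis_sum[of \<alpha> x] blinfun_apply_axis_sum[of \<beta> x] by (simp only: assms)
qed

text \<open>The affine charts of the quotient: on the part where the coordinate \<open>v\<^sub>i\<close> has the sign
  \<open>\<epsilon>\<close>, the functions \<open>v\<^sub>j / v\<^sub>i\<close> and \<open>\<alpha>\<^sub>j v\<^sub>i\<close> for \<open>j \<noteq> i\<close> are coordinates; \<open>e\<close> enumerates the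
  indices \<open>j \<noteq> i\<close>.\<close>

locale affine_chart =
  fixes i :: "'n::finite option" and e :: "'n \<Rightarrow> 'n option" and \<epsilon> :: real
  assumes eps: "\<epsilon> * \<epsilon> = 1" and bij: "bij_betw e UNIV (UNIV - {i})"
begin

lemma e_neq: "e j \<noteq> i"
  using bij by (auto simp: bij_betw_def)

lemma e_eq_iff: "e j = e k \<longleftrightarrow> j = k"
  using bij by (auto simp: bij_betw_def inj_eq)

lemma index_cases: obtains "k = i" | j where "k = e j"
  using bij by (auto simp: bij_betw_def)

lemma sum_index: "(\<Sum>k\<in>UNIV. f k) = f i + (\<Sum>j\<in>UNIV. f (e j))" for f :: "'n option \<Rightarrow> real"
  using sum.remove[of UNIV i f] sum.reindex_bij_betw[OF bij, of f] by simp

definition emb :: "real ^ 'n \<Rightarrow> 'n rvec" where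
  "emb a = (\<Sum>j\<in>UNIV. (a $ j) *\<^sub>R axis (e j) 1)"

lemma emb_e: "emb a $ e k = a $ k"
  by (simp add: emb_def axis_def e_eq_iff if_distrib cong: if_cong)

lemma emb_i: "emb a $ i = 0"
  by (simp add: emb_def axis_def e_neq[THEN not_sym])

text \<open>The sign has to be fixed: \<open>(v, \<alpha>)\<close> and
  \<open>(-v, -\<alpha>)\<close> have the same coordinates but lie on different orbits, since the
  flow scales by positive factors.\<close>

definition half :: "'n amb set" where
  "half = {z. \<epsilon> * fst z $ i > 0}"

definition coord :: "'n amb \<Rightarrow> (real ^ 'n) \<times> (real ^ 'n)" where
  "coord z = (\<chi> j. fst z $ e j * inverse (fst z $ i),
              \<chi> j. blinfun_apply (snd z) (axis (e j) 1) * fst z $ i)"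

text \<open>The point of the orbit whose vector has entry \<open>\<epsilon>\<close> at index
  \<open>i\<close>. The coordinates prescribe the entries at the other indices, and the covector
  entry at \<open>i\<close> is forced by the pairing value -1; this is the origin of
  \<open>1 + fst y \<bullet> snd y\<close>.\<close>

definition sect :: "(real ^ 'n) \<times> (real ^ 'n) \<Rightarrow> 'n amb" where
  "sect y = (\<epsilon> *\<^sub>R (axis i 1 + emb (fst y)),
     blinfun_inner_right (\<epsilon> *\<^sub>R (emb (snd y) - (1 + fst y \<bullet> snd y) *\<^sub>R axis i 1)))"

lemma open_half: "open half"
  unfolding half_def by (intro open_Collect_less continuous_intros)

lemma half_nonzero: "z \<in> half \<Longrightarrow> fst z $ i \<noteq> 0"
  by (auto simp: half_def)

lemma half_flow: "flow t z \<in> half \<longleftrightarrow> z \<in> half"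
  by (simp add: half_def flow_def mult.left_commute[of \<epsilon>] zero_less_mult_iff mult_less_0_iff)

lemma coord_flow: "coord (flow t z) = coord z"
  by (simp add: coord_def flow_def blinfun.bilinear_simps vec_eq_iff mult_exp_exp field_simps
      flip: exp_minus)

lemma sect_i: "fst (sect y) $ i = \<epsilon>"
  by (simp add: sect_def emb_i)

lemma sect_e: "fst (sect y) $ e j = \<epsilon> * fst y $ j"
  using e_neq[of j] by (simp add: sect_def emb_e axis_def)

lemma sect_snd_e: "blinfun_apply (snd (sect y)) (axis (e j) 1) = \<epsilon> * snd y $ j"
  using e_neq[of j] by (simp add: sect_def inner_axis emb_e) (simp add: axis_def)

lemma sect_snd_i: "blinfun_apply (snd (sect y)) (axis i 1) = - \<epsilon> * (1 + fst y \<bullet> snd y)"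
  by (simp add: sect_def inner_axis emb_i algebra_simps)

lemma sect_pseudohyp: "sect y \<in> pseudohyp"
proof -
  have 1: "blinfun_apply (snd (sect y)) (fst (sect y)) =
      \<epsilon> * (- \<epsilon> * (1 + fst y \<bullet> snd y)) + (\<Sum>j\<in>UNIV. (\<epsilon> * fst y $ j) * (\<epsilon> * snd y $ j))"
    by (subst blinfun_apply_axis_sum, subst sum_index) (simp only: sect_i sect_e sect_snd_e sect_snd_i)
  have "(\<epsilon> * a) * (\<epsilon> * b) = a * b" for a b :: real
    using eps by (metis mult.assoc mult.left_commute mult_1)
  then have "(\<Sum>j\<in>UNIV. (\<epsilon> * fst y $ j) * (\<epsilon> * snd y $ j)) = fst y \<bullet> snd y"
    unfolding inner_vec_def by (simp only: inner_real_def)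
  moreover have "\<epsilon> * (- \<epsilon> * (1 + fst y \<bullet> snd y)) = - (1 + fst y \<bullet> snd y)"
    using eps by (metis minus_mult_left minus_mult_right mult.assoc mult_1)
  ultimately show ?thesis
    using 1 by (simp add: pseudohyp_iff)
qed

lemma sect_half: "sect y \<in> half"
  using eps by (simp add: half_def sect_i)

lemma coord_sect: "coord (sect y) = y"
proof -
  have "\<epsilon> \<noteq> 0" using eps by auto
  moreover have "\<epsilon> * b * \<epsilon> = b" for b
    using eps by (simp add: mult.commute mult.left_commute)
  ultimately show ?thesis
    by (simp add: coord_def sect_i sect_e sect_snd_e prod_eq_iff vec_eq_iff)
qed

lemma sect_coord:
  assumes z: "z \<in> pseudohyp" "z \<in> half"
  shows "sect (coord z) = (inverse (\<epsilon> * fst z $ i) *\<^sub>R fst z, (\<epsilon> * fst z $ i) *\<^sub>R snd z)"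
proof -
  have nz: "fst z $ i \<noteq> 0" by (rule half_nonzero[OF z(2)])
  have ie: "inverse \<epsilon> = \<epsilon>" using eps by (rule inverse_unique)
  have "fst (sect (coord z)) $ k = inverse (\<epsilon> * fst z $ i) * fst z $ k" for k
    by (cases k rule: index_cases) (use nz in \<open>simp_all add: sect_i sect_e coord_def ie\<close>)
  moreover have "blinfun_apply (snd (sect (coord z))) (axis k 1) =
      (\<epsilon> * fst z $ i) * blinfun_apply (snd z) (axis k 1)" for k
  proof (cases k rule: index_cases)
    \<comment> \<open>The coordinates do not record the covector entry at \<open>i\<close>; it is
      recovered from the pairing value -1 of \<open>z\<close>.\<close>
    case 1
    have "fst z $ i * blinfun_apply (snd z) (axis i 1) +
        (\<Sum>j\<in>UNIV. fst z $ e j * blinfun_apply (snd z) (axis (e j) 1)) = -1"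
      using z(1) blinfun_apply_axis_sum[of "snd z" "fst z"] sum_index by (simp add: pseudohyp_iff)
    moreover have "a * inverse (fst z $ i) * (b * fst z $ i) = a * b" for a b
      using nz by simp
    then have "(\<Sum>j\<in>UNIV. fst z $ e j * blinfun_apply (snd z) (axis (e j) 1)) =
        fst (coord z) \<bullet> snd (coord z)"
      by (simp only: coord_def inner_vec_def fst_conv snd_conv vec_lambda_beta inner_real_def)
    ultimately have "- (1 + fst (coord z) \<bullet> snd (coord z)) =
        fst z $ i * blinfun_apply (snd z) (axis i 1)"
      by simp
    then show ?thesis
      using 1 by (simp only: sect_snd_i) (metis minus_mult_commute mult.assoc)
  next
    case (2 j)
    then show ?thesis by (simp add: sect_snd_e coord_def)
  qed
  then have "snd (sect (coord z)) = (\<epsilon> * fst z $ i) *\<^sub>R snd z"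
    by (intro rcovec_eqI) (simp add: blinfun.scaleR_left)
  ultimately show ?thesis
    by (simp add: prod_eq_iff vec_eq_iff)
qed

lemma sect_coord_flow:
  assumes "z \<in> pseudohyp" "z \<in> half"
  shows "sect (coord z) = flow (- ln (\<epsilon> * fst z $ i)) z"
  using assms(2) unfolding sect_coord[OF assms] by (simp add: flow_def half_def exp_minus)

lemma smooth_coord: "smooth_open half coord"
  unfolding coord_def using half_nonzero open_half
  by (intro smooth_open_Pair smooth_open_vec_lambda smooth_open_mult smooth_open_inverse
      smooth_open_vec_nth smooth_open_blinfun_apply smooth_open_fst smooth_open_snd smooth_open_id
      smooth_open_const)

lemma smooth_emb: "smooth_open UNIV (\<lambda>y. emb (f y))" if "smooth_open UNIV f"
  unfolding emb_def using that
  by (intro smooth_open_sum smooth_open_scaleR smooth_open_vec_nth smooth_open_const) auto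

lemma smooth_sect: "smooth_open UNIV sect"
  unfolding sect_def
  by (intro smooth_open_Pair smooth_open_linear[OF bounded_linear_blinfun_inner_right]
      smooth_open_add smooth_open_diff smooth_open_scaleR smooth_open_inner smooth_emb
      smooth_open_fst smooth_open_snd smooth_open_id smooth_open_const open_UNIV)

section \<open>The affine coordinates as charts of the quotient\<close>

definition dom :: "'n parahyp set" where
  "dom = proj_minus ` (pseudohyp \<inter> half)"

definition chart_fun :: "'n parahyp \<Rightarrow> (real ^ 'n) \<times> (real ^ 'n)" where
  "chart_fun q = coord (repr q)"

lemma proj_minus_dom:
  assumes "z \<in> pseudohyp"
  shows "proj_minus z \<in> dom \<longleftrightarrow> z \<in> half"
proof
  assume "proj_minus z \<in> dom"
  then obtain w where w: "w \<in> pseudohyp" "w \<in> half" "proj_minus z = proj_minus w"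
    unfolding dom_def by blast
  show "z \<in> half"
    by (rule proj_minus_eqD[OF assms w(1,3)]) (use w(2) half_flow in simp)
qed (use assms in \<open>simp add: dom_def\<close>)

lemma chart_fun_proj: "z \<in> pseudohyp \<Longrightarrow> chart_fun (proj_minus z) = coord z"
  unfolding chart_fun_def using proj_minus_eqD[OF _ repr(1) repr(2)[symmetric]] coord_flow by metis

lemma proj_sect_coord: "z \<in> pseudohyp \<Longrightarrow> z \<in> half \<Longrightarrow> proj_minus (sect (coord z)) = proj_minus z"
  by (simp add: sect_coord_flow proj_minus_flow)

lemma proj_sect_chart_fun:
  assumes "q \<in> dom"
  shows "proj_minus (sect (chart_fun q)) = q"
  using proj_sect_coord[OF repr(1)[of q]] proj_minus_dom[OF repr(1), of q] assms
  by (simp add: chart_fun_def repr(2))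

lemma proj_sect_dom: "proj_minus (sect y) \<in> dom"
  by (simp add: proj_minus_dom sect_pseudohyp sect_half)

lemma chart_fun_proj_sect: "chart_fun (proj_minus (sect y)) = y"
  by (simp add: chart_fun_proj sect_pseudohyp coord_sect)

lemma chart_fun_image: "chart_fun ` dom = UNIV"
  using chart_fun_proj_sect proj_sect_dom by (metis UNIV_eq_I image_eqI)

lemma chart_inv_eq: "chart_inv (dom, chart_fun) y = proj_minus (sect y)"
proof -
  have "inj_on chart_fun dom"
    by (rule inj_on_inverseI[of _ "\<lambda>y. proj_minus (sect y)"]) (rule proj_sect_chart_fun)
  then show ?thesis
    unfolding chart_inv_def fst_conv snd_conv
    by (rule inv_into_f_eq) (simp_all add: proj_sect_dom chart_fun_proj_sect)
qed

lemma open_dom_inter: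
  assumes "open B"
  shows "open (dom \<inter> chart_fun -` B)"
proof -
  have "{z \<in> pseudohyp. proj_minus z \<in> dom \<inter> chart_fun -` B} = pseudohyp \<inter> (half \<inter> coord -` B)"
    by (auto simp: proj_minus_dom chart_fun_proj)
  moreover have "open (half \<inter> coord -` B)"
    by (rule continuous_open_preimage[OF smooth_open_imp_continuous_on[OF smooth_coord] open_half assms])
  ultimately show ?thesis
    unfolding open_parahyp_def by (simp add: openin_open_Int)
qed

lemma is_chart: "is_chart (dom, chart_fun)"
  unfolding is_chart_def fst_conv snd_conv
proof (intro conjI)
  show "open dom" using open_dom_inter[of UNIV] by simp
  show "open (chart_fun ` dom)" by (simp add: chart_fun_image)
  have "continuous_on dom chart_fun"
    unfolding continuous_on_open_invariant
  proof (intro allI impI)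
    fix B :: "((real ^ 'n) \<times> (real ^ 'n)) set" assume "open B"
    then show "\<exists>T. open T \<and> T \<inter> dom = chart_fun -` B \<inter> dom"
      by (intro exI[of _ "dom \<inter> chart_fun -` B"]) (auto simp: open_dom_inter)
  qed
  moreover have "continuous_on UNIV (\<lambda>y. proj_minus (sect y))"
    unfolding continuous_on_open_vimage[OF open_UNIV]
  proof (intro allI impI)
    fix V :: "'n parahyp set" assume "open V"
    then obtain Q where Q: "open Q" "{z \<in> pseudohyp. proj_minus z \<in> V} = pseudohyp \<inter> Q"
      unfolding open_parahyp_def openin_open by blast
    have "(\<lambda>y. proj_minus (sect y)) -` V = UNIV \<inter> sect -` Q"
      using Q(2) sect_pseudohyp by blast
    then show "open ((\<lambda>y. proj_minus (sect y)) -` V \<inter> UNIV)"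
      using continuous_open_preimage[OF smooth_open_imp_continuous_on[OF smooth_sect] open_UNIV Q(1)] by simp
  qed
  moreover have "(\<lambda>y. proj_minus (sect y)) ` UNIV = dom"
  proof
    show "range (\<lambda>y. proj_minus (sect y)) \<subseteq> dom"
      using proj_sect_dom by blast
    show "dom \<subseteq> range (\<lambda>y. proj_minus (sect y))"
      using proj_sect_chart_fun by (metis rangeI subsetI)
  qed
  ultimately show "homeomorphism dom (chart_fun ` dom) chart_fun (chart_inv (dom, chart_fun))"
    unfolding homeomorphism_def chart_fun_image chart_inv_eq[abs_def]
    by (auto simp: proj_sect_chart_fun chart_fun_proj_sect)
qed

lemma chart_derivative:
  assumes "z \<in> pseudohyp" "z \<in> half"
  shows "((chart_fun \<circ> proj_minus) has_derivative frechet_derivative coord (at z)) (at z within pseudohyp)"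
proof (rule has_derivative_transform)
  show "(coord has_derivative frechet_derivative coord (at z)) (at z within pseudohyp)"
    by (rule has_derivative_at_withinI[OF smooth_open_has_derivative[OF smooth_coord assms(2)]])
qed (use assms(1) in \<open>simp_all add: chart_fun_proj\<close>)

lemma sect_through:
  assumes "z \<in> pseudohyp" "z \<in> half"
  obtains t where "flow t (sect (coord z)) = z"
  using that[of "ln (\<epsilon> * fst z $ i)"] by (simp add: sect_coord_flow[OF assms] flow_flow flow_0)

text \<open>Submersivity comes from a right inverse: the section, moved by the flow so as to pass
  through \<open>z\<close>, composes with the chart to the identity, so its derivative yields a
  tangent preimage of every coordinate vector.\<close>

lemma chart_in_atlas: "(dom, chart_fun) \<in> parahyp_atlas"
  unfolding parahyp_atlas_def mem_Collect_eq prod.case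
proof (intro conjI is_chart ballI impI)
  show "smooth_subset {z \<in> pseudohyp. proj_minus z \<in> dom} (chart_fun \<circ> proj_minus)"
    unfolding smooth_subset_def
    by (intro ballI exI[of _ half] exI[of _ coord])
       (auto simp: proj_minus_dom chart_fun_proj open_half smooth_coord)
next
  fix z assume z: "z \<in> pseudohyp" "proj_minus z \<in> dom"
  then have zh: "z \<in> half" by (simp add: proj_minus_dom)
  obtain t where t: "flow t (sect (coord z)) = z" by (rule sect_through[OF z(1) zh])
  define S where "S u = flow t (frechet_derivative sect (at (coord z)) u)" for u
  have \<sigma>: "((\<lambda>y. flow t (sect y)) has_derivative S) (at (coord z))"
    unfolding S_def
    by (rule bounded_linear.has_derivative[OF bounded_linear_flow
          smooth_open_has_derivative[OF smooth_sect UNIV_I]])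
  have P: "(\<lambda>y. flow t (sect y)) ` UNIV \<subseteq> pseudohyp"
    using flow_pseudohyp sect_pseudohyp by blast
  have T: "S u \<in> pseudohyp_tangent z" for u
    using derivative_in_pseudohyp_tangent[OF \<sigma> open_UNIV UNIV_I P] t by simp
  have "((\<lambda>y. (chart_fun \<circ> proj_minus) (flow t (sect y))) has_derivative
      (\<lambda>u. frechet_derivative coord (at z) (S u))) (at (coord z))"
    by (rule has_derivative_compose_pseudohyp[OF \<sigma> open_UNIV UNIV_I P])
       (unfold t, rule chart_derivative[OF z(1) zh])
  moreover have "(chart_fun \<circ> proj_minus) (flow t (sect y)) = y" for y
    by (simp add: proj_minus_flow chart_fun_proj_sect)
  ultimately have "((\<lambda>y. y) has_derivative (\<lambda>u. frechet_derivative coord (at z) (S u))) (at (coord z))"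
    by simp
  then have eq: "(\<lambda>u. frechet_derivative coord (at z) (S u)) = (\<lambda>u. u)"
    using has_derivative_unique has_derivative_ident by blast
  have "hyp_diff (chart_fun \<circ> proj_minus) z (S u) = u" for u
    using hyp_diff_eq[OF z(1) T chart_derivative[OF z(1) zh], of u] fun_cong[OF eq, of u] by simp
  then show "hyp_diff (chart_fun \<circ> proj_minus) z ` pseudohyp_tangent z = UNIV"
    using T by (metis UNIV_eq_I image_eqI)
qed

text \<open>Differentiating \<open>sect (coord z) = flow (- ln (\<epsilon> z\<^sub>i)) z\<close> recovers a horizontal vector from its
  image under \<open>coord\<close>.\<close>

lemma proj_diff_inj:
  assumes z: "z \<in> pseudohyp" "z \<in> half" and w: "w \<in> horizontal_space z"
    and 0: "proj_diff z w (dom, chart_fun) = 0"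
  shows "w = 0"
proof -
  let ?c = "\<epsilon> * fst z $ i"
  define R where "R y = (inverse (\<epsilon> * fst y $ i) *\<^sub>R fst y, (\<epsilon> * fst y $ i) *\<^sub>R snd y)" for y :: "'n amb"
  define DR where "DR h = (inverse ?c *\<^sub>R fst h + (- (inverse ?c * (\<epsilon> * fst h $ i) * inverse ?c)) *\<^sub>R fst z,
      ?c *\<^sub>R snd h + (\<epsilon> * fst h $ i) *\<^sub>R snd z)" for h :: "'n amb"
  have c: "?c > 0" using z(2) by (simp add: half_def)
  have wT: "w \<in> pseudohyp_tangent z" using w horizontal_space_subset_tangent by blast
  have lin: "bounded_linear (\<lambda>y::'n amb. \<epsilon> * fst y $ i)"
    by (intro bounded_linear_const_mult bounded_linear_compose[OF bounded_linear_vec_nth bounded_linear_fst])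
  have "(R has_derivative DR) (at z within pseudohyp)"
    unfolding R_def DR_def using c
    by (intro has_derivative_Pair has_derivative_scaleR Deriv.has_derivative_inverse
        bounded_linear_imp_has_derivative lin bounded_linear_fst bounded_linear_snd) auto
  moreover have "((\<lambda>y. sect (coord y)) has_derivative
      (\<lambda>h. frechet_derivative sect (at (coord z)) (frechet_derivative coord (at z) h))) (at z within pseudohyp)"
    by (rule has_derivative_compose[OF has_derivative_at_withinI
          [OF smooth_open_has_derivative[OF smooth_coord z(2)]]
          smooth_open_has_derivative[OF smooth_sect UNIV_I]])
  then have "(R has_derivative
      (\<lambda>h. frechet_derivative sect (at (coord z)) (frechet_derivative coord (at z) h))) (at z within pseudohyp)"
  proof -
    obtain r where r: "r > 0" "ball z r \<subseteq> half" using z(2) open_half openE by blast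
    assume a: "((\<lambda>y. sect (coord y)) has_derivative
      (\<lambda>h. frechet_derivative sect (at (coord z)) (frechet_derivative coord (at z) h))) (at z within pseudohyp)"
    show ?thesis
      by (rule has_derivative_transform_within[OF a r(1) z(1)])
         (use r(2) in \<open>auto simp: R_def sect_coord dist_commute subset_iff\<close>)
  qed
  ultimately have "DR w = frechet_derivative sect (at (coord z)) (frechet_derivative coord (at z) w)"
    using pseudohyp_derivative_unique[OF z(1) wT] by blast
  moreover have "frechet_derivative coord (at z) w = 0"
    using 0 hyp_diff_eq[OF z(1) wT chart_derivative[OF z]] chart_in_atlas proj_minus_dom[OF z(1)] z(2)
    by (simp add: proj_diff_def)
  moreover have "frechet_derivative sect (at (coord z)) 0 = 0"
    using has_derivative_bounded_linear[OF smooth_open_has_derivative[OF smooth_sect UNIV_I]]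
      linear_0 bounded_linear.linear by blast
  ultimately have "DR w = 0" by simp
  then have 1: "inverse ?c *\<^sub>R fst w = (inverse ?c * (\<epsilon> * fst w $ i) * inverse ?c) *\<^sub>R fst z"
    and 2: "?c *\<^sub>R snd w + (\<epsilon> * fst w $ i) *\<^sub>R snd z = 0"
    by (simp_all add: DR_def prod_eq_iff)
  \<comment> \<open>Pairing the first component of \<open>DR w = 0\<close> with \<open>snd z\<close>
    isolates the coefficient of \<open>fst z\<close>: \<open>w\<close> is horizontal, and
    \<open>snd z\<close> takes the value -1 on \<open>fst z\<close>.\<close>
  have "blinfun_apply (snd z) (inverse ?c *\<^sub>R fst w) = 0"
    using w by (simp add: horizontal_space_eq blinfun.scaleR_right)
  then have 0: "\<epsilon> * fst w $ i = 0"
    unfolding 1 using less_imp_neq[OF c] z(1) by (auto simp: blinfun.scaleR_right pseudohyp_iff)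
  then show ?thesis
    using 1[unfolded 0] 2[unfolded 0] less_imp_neq[OF c] by (auto simp: prod_eq_iff)
qed

end

section \<open>Horizontal lifts and the transported para-Kaehler structure\<close>

lemma affine_chart_at:
  fixes z :: "'n::finite amb"
  assumes "z \<in> pseudohyp"
  obtains i e \<epsilon> where "affine_chart i e \<epsilon>" "z \<in> affine_chart.half i \<epsilon>"
proof -
  have "fst z \<noteq> 0" using assms by (auto simp: pseudohyp_iff blinfun.bilinear_simps)
  then obtain i where i: "fst z $ i \<noteq> 0" by (auto simp: vec_eq_iff)
  have "card (UNIV :: 'n set) = card (UNIV - {i})" by (simp add: card_Diff_singleton)
  then obtain e where e: "bij_betw e (UNIV :: 'n set) (UNIV - {i})"
    by (metis finite finite_same_card_bij)
  define \<epsilon> where "\<epsilon> = sgn (fst z $ i)"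
  have a: "affine_chart i e \<epsilon>"
    using i e by unfold_locales (auto simp: \<epsilon>_def sgn_if)
  moreover have "z \<in> affine_chart.half i \<epsilon>"
    using i unfolding affine_chart.half_def[OF a] by (simp add: \<epsilon>_def sgn_if)
  ultimately show thesis by (rule that)
qed

lemma proj_diff_horizontal_eqD:
  assumes z: "z \<in> pseudohyp" and w: "w \<in> horizontal_space z" "w' \<in> horizontal_space z"
    and eq: "proj_diff z w = proj_diff z w'"
  shows "w = w'"
proof -
  obtain i e \<epsilon> where c: "affine_chart i e \<epsilon>" "z \<in> affine_chart.half i \<epsilon>"
    by (rule affine_chart_at[OF z])
  have h: "w - w' \<in> horizontal_space z"
    using w by (simp add: horizontal_space_eq blinfun.bilinear_simps)
  have "proj_diff z (w - w') d = 0" for d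
    using eq by (simp add: proj_diff_diff[OF z])
  then have "w - w' = 0"
    by (rule affine_chart.proj_diff_inj[OF c(1) z c(2) h])
  then show ?thesis by simp
qed

text \<open>The removed multiple of \<open>zeta z\<close> projects to zero, so the horizontal part
  is a candidate; injectivity of the projection on horizontal vectors makes it the only one, as
  \<open>THE\<close> demands.\<close>

lemma hor_lift_proj_diff:
  assumes "z \<in> pseudohyp" "X \<in> pseudohyp_tangent z"
  shows "hor_lift z (proj_diff z X) = hor_part z X"
  unfolding hor_lift_def
  by (rule the_equality)
     (use hor_part_in[OF assms] proj_diff_hor_part[OF assms(1)] proj_diff_horizontal_eqD[OF assms(1)] in auto)

text \<open>The structure of the quotient is defined at the selected point \<open>repr\<close>. This
  moves the computation to an arbitrary point \<open>z\<close> of the orbit; the flow that remains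
  disappears later because it preserves \<open>g\<close> and commutes with
  \<open>phi\<close>.\<close>

lemma hor_lift_repr:
  assumes "z \<in> pseudohyp"
  obtains t where "repr (proj_minus z) = flow t z"
    "\<And>X. X \<in> pseudohyp_tangent z \<Longrightarrow>
      hor_lift (repr (proj_minus z)) (proj_diff z X) = flow t (hor_part z X)"
proof -
  obtain t where t: "repr (proj_minus z) = flow t z"
    by (rule proj_minus_eqD[OF assms repr(1) repr(2)[symmetric]])
  have "hor_lift (repr (proj_minus z)) (proj_diff z X) = flow t (hor_part z X)"
    if X: "X \<in> pseudohyp_tangent z" for X
    unfolding t using hor_lift_proj_diff[OF flow_pseudohyp[OF assms] flow_tangent[OF X], of t]
    by (simp add: proj_diff_flow[OF assms X] hor_part_flow)
  then show thesis using that t by blast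
qed

lemma parahyp_metric_proj_diff:
  assumes "z \<in> pseudohyp" "X \<in> pseudohyp_tangent z" "Y \<in> pseudohyp_tangent z"
  shows "parahyp_metric (proj_minus z) (proj_diff z X) (proj_diff z Y) =
    amb_metric (hor_part z X) (hor_part z Y)"
  by (rule hor_lift_repr[OF assms(1)]) (simp add: parahyp_metric_def assms(2,3) amb_metric_flow)

lemma parahyp_P_proj_diff:
  assumes "z \<in> pseudohyp" "X \<in> pseudohyp_tangent z"
  shows "parahyp_P (proj_minus z) (proj_diff z X) = proj_diff z (phi z X)"
proof (rule hor_lift_repr[OF assms(1)])
  fix t assume t: "repr (proj_minus z) = flow t z"
    "\<And>X. X \<in> pseudohyp_tangent z \<Longrightarrow>
      hor_lift (repr (proj_minus z)) (proj_diff z X) = flow t (hor_part z X)"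
  have "phi z X \<in> pseudohyp_tangent z"
    using phi_in_horizontal_space[OF assms] horizontal_space_subset_tangent by blast
  then show ?thesis
    unfolding parahyp_P_def t(2)[OF assms(2)] unfolding t(1)
    by (simp add: phi_flow phi_hor_part assms proj_diff_flow)
qed

lemma parahyp_omega_proj_diff:
  assumes "z \<in> pseudohyp" "X \<in> pseudohyp_tangent z" "Y \<in> pseudohyp_tangent z"
  shows "parahyp_omega (proj_minus z) (proj_diff z X) (proj_diff z Y) =
    amb_metric (hor_part z X) (phi z Y)"
proof -
  have h: "phi z Y \<in> horizontal_space z"
    by (rule phi_in_horizontal_space[OF assms(1,3)])
  then have "phi z Y \<in> pseudohyp_tangent z"
    using horizontal_space_subset_tangent by blast
  then show ?thesis
    unfolding parahyp_omega_def parahyp_P_proj_diff[OF assms(1,3)]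
    by (simp add: parahyp_metric_proj_diff assms hor_part_horizontal[OF h])
qed

section \<open>Lifts\<close>

lemma amb_metric_sym: "amb_metric X Y = amb_metric Y X"
  by (simp add: amb_metric_def)

lemma amb_metric_hor_part:
  assumes "X \<in> horizontal_space z"
  shows "amb_metric X (hor_part z Y) = amb_metric X Y"
proof -
  have "amb_metric X (Y - a *\<^sub>R V) = amb_metric X Y - a * amb_metric X V" for a V
    by (simp add: amb_metric_def blinfun.bilinear_simps algebra_simps)
  then show ?thesis
    using assms by (simp add: hor_part_def horizontal_space_def)
qed

text \<open>Tangency turns pairings of \<open>snd X\<close> with \<open>fst z\<close> into pairings
  of \<open>snd z\<close> with \<open>fst X\<close>, after which all terms coming from
  \<open>zeta z\<close> cancel. What is left is, up to the sign convention, half the canonical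
  symplectic form of a vector space plus its dual.\<close>

lemma amb_metric_hor_part_phi:
  assumes "z \<in> pseudohyp" "X \<in> pseudohyp_tangent z" "Y \<in> pseudohyp_tangent z"
  shows "amb_metric (hor_part z X) (phi z Y) =
    (blinfun_apply (snd X) (fst Y) - blinfun_apply (snd Y) (fst X)) / 2"
proof -
  have g: "amb_metric V (zeta z) = - blinfun_apply (snd z) (fst V)" if "V \<in> pseudohyp_tangent z" for V
    using that by (simp add: amb_metric_def zeta_def pseudohyp_tangent_iff blinfun.bilinear_simps)
  have v: "blinfun_apply (snd V) (fst z) = - blinfun_apply (snd z) (fst V)" if "V \<in> pseudohyp_tangent z" for V
    using that by (simp add: pseudohyp_tangent_iff)
  show ?thesis
    using assms(1)
    by (simp add: phi_def hor_part_def g v assms(2,3) pseudohyp_iff amb_metric_def zeta_def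
        blinfun.bilinear_simps algebra_simps)
qed

lemma linear_inj_surj:
  fixes f :: "'a::euclidean_space \<Rightarrow> 'b::euclidean_space"
  assumes "linear f" "inj f" "DIM('a) = DIM('b)"
  shows "surj f"
proof -
  have "dim (range f) = DIM('b)"
    using dim_image_eq[OF assms(1), of UNIV] assms(2,3) by simp
  moreover have "span (range f) = range f"
    using linear_subspace_image[OF assms(1) subspace_UNIV] by simp
  ultimately show ?thesis using dim_eq_full by metis
qed

section \<open>Differentials of maps into vector spaces, and a criterion for centroaffine
  immersions\<close>

context atlas
begin

lemma pushv_chart:
  assumes "smooth_fun A f" "c \<in> A" "p \<in> fst c" "X \<in> tangent_space A p"
  shows "pushv A f p X = frechet_derivative (f \<circ> chart_inv c) (at (snd c p)) (X c)"
  by (rule pushv_eq[OF assms(2-4) smooth_fun_has_derivative[OF assms(1,2)]]) (use assms(3) in blast)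

lemma smooth_fun_linear:
  assumes "bounded_linear L" "smooth_fun A f"
  shows "smooth_fun A (\<lambda>p. L (f p))"
  unfolding smooth_fun_def
proof
  fix c assume c: "c \<in> A"
  have "smooth_open (snd c ` fst c) (\<lambda>x. L ((f \<circ> chart_inv c) x))"
    by (rule smooth_open_linear[OF assms(1) open_chart_image[OF c]])
       (use assms(2) c in \<open>simp only: smooth_fun_def\<close>)
  then show "smooth_open (snd c ` fst c) ((\<lambda>p. L (f p)) \<circ> chart_inv c)"
    by (simp add: o_def)
qed

lemma smooth_fun_scaled:
  assumes "smooth_fun A \<mu>" "smooth_fun A f"
  shows "smooth_fun A (scaled \<mu> f)"
  unfolding smooth_fun_def
proof
  fix c assume c: "c \<in> A"
  have "smooth_open (snd c ` fst c) (\<lambda>x. exp ((\<mu> \<circ> chart_inv c) x) *\<^sub>R (f \<circ> chart_inv c) x)"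
    by (intro smooth_open_scaleR smooth_open_exp open_chart_image[OF c])
       (use assms c in \<open>simp_all only: smooth_fun_def\<close>)
  then show "smooth_open (snd c ` fst c) (scaled \<mu> f \<circ> chart_inv c)"
    by (simp add: o_def scaled_def)
qed

lemma smooth_fun_Pair:
  assumes "smooth_fun A f" "smooth_fun A g"
  shows "smooth_fun A (\<lambda>p. (f p, g p))"
  unfolding smooth_fun_def
proof
  fix c assume c: "c \<in> A"
  have "smooth_open (snd c ` fst c) (\<lambda>x. ((f \<circ> chart_inv c) x, (g \<circ> chart_inv c) x))"
    by (intro smooth_open_Pair open_chart_image[OF c])
       (use assms c in \<open>simp_all only: smooth_fun_def\<close>)
  then show "smooth_open (snd c ` fst c) ((\<lambda>p. (f p, g p)) \<circ> chart_inv c)"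
    by (simp add: o_def)
qed

lemma pushv_scaled:
  assumes "smooth_fun A \<mu>" "smooth_fun A f" "X \<in> tangent_space A p"
  shows "pushv A (scaled \<mu> f) p X = exp (\<mu> p) *\<^sub>R (pushv A f p X + pushv A \<mu> p X *\<^sub>R f p)"
proof -
  obtain c where c: "c \<in> A" "p \<in> fst c" by (rule chart_at)
  then have x: "snd c p \<in> snd c ` fst c" by blast
  have "((\<lambda>x. exp ((\<mu> \<circ> chart_inv c) x) *\<^sub>R (f \<circ> chart_inv c) x) has_derivative
      (\<lambda>u. exp ((\<mu> \<circ> chart_inv c) (snd c p)) *\<^sub>R frechet_derivative (f \<circ> chart_inv c) (at (snd c p)) u +
        (exp ((\<mu> \<circ> chart_inv c) (snd c p)) * frechet_derivative (\<mu> \<circ> chart_inv c) (at (snd c p)) u) *\<^sub>R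
          (f \<circ> chart_inv c) (snd c p))) (at (snd c p))"
    by (rule has_derivative_eq_rhs[OF has_derivative_scaleR[OF has_derivative_exp
          [OF smooth_fun_has_derivative[OF assms(1) c(1) x]]
          smooth_fun_has_derivative[OF assms(2) c(1) x]]])
       (simp add: mult.commute)
  then have "((scaled \<mu> f \<circ> chart_inv c) has_derivative
      (\<lambda>u. exp (\<mu> p) *\<^sub>R (frechet_derivative (f \<circ> chart_inv c) (at (snd c p)) u +
        frechet_derivative (\<mu> \<circ> chart_inv c) (at (snd c p)) u *\<^sub>R f p))) (at (snd c p))"
    by (simp add: o_def scaled_def chart_inv_left[OF c] scaleR_add_right)
  from pushv_eq[OF c assms(3) this] show ?thesis
    using pushv_chart[OF assms(1) c assms(3)] pushv_chart[OF assms(2) c assms(3)] by simp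
qed

text \<open>The map \<open>T\<close>, which adds a multiple of \<open>f p\<close> to a coordinate
  derivative, is injective by the two conditions on \<open>f\<close>, hence onto by dimension. The
  target is only a normed space, so \<open>\<iota>\<close> carries the dimension count to a
  Euclidean one: it is the identity for vectors and the tuple of coefficients for covectors.\<close>

lemma centroaffineI:
  fixes f :: "'m \<Rightarrow> 'w::real_normed_vector" and \<iota> :: "'w \<Rightarrow> 'v::euclidean_space"
  assumes smooth: "smooth_fun A f" and nz: "\<And>p. f p \<noteq> 0"
    and inj: "\<And>p X. X \<in> tangent_space A p \<Longrightarrow> pushv A f p X \<in> span {f p} \<Longrightarrow> X = (\<lambda>_. 0)"
    and \<iota>: "linear \<iota>" "inj \<iota>" and dim: "DIM('v) = DIM('e) + 1"
  shows "centroaffine A f"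
  unfolding centroaffine_def
proof (intro conjI allI smooth)
  fix p
  obtain c where c: "c \<in> A" "p \<in> fst c" by (rule chart_at)
  define D where "D = frechet_derivative (f \<circ> chart_inv c) (at (snd c p))"
  have "(f \<circ> chart_inv c has_derivative D) (at (snd c p))"
    unfolding D_def by (rule smooth_fun_has_derivative[OF smooth c(1)]) (use c in blast)
  then have "bounded_linear D" by (rule has_derivative_bounded_linear)
  then have lin: "linear D" by (rule bounded_linear.linear)
  have push: "pushv A f p X = D (X c)" if "X \<in> tangent_space A p" for X
    unfolding D_def by (rule pushv_chart[OF smooth c that])
  have pushD: "pushv A f p (tvec_of p c u) = D u" for u
    using push[OF tvec_of_in[OF c]] tvec_of_self[OF c] by simp
  have zero: "u = 0" if "D u \<in> span {f p}" for u
  proof -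
    have "tvec_of p c u = (\<lambda>_. 0)"
      by (rule inj[OF tvec_of_in[OF c]]) (simp add: pushD that)
    then show ?thesis using tvec_of_self[OF c, of u] by simp
  qed
  have img: "pushv A f p ` tangent_space A p = range D"
  proof
    show "pushv A f p ` tangent_space A p \<subseteq> range D"
      using push by auto
    show "range D \<subseteq> pushv A f p ` tangent_space A p"
      using tvec_of_in[OF c] pushD by (metis image_eqI image_subsetI)
  qed
  show "inj_on (pushv A f p) (tangent_space A p)"
  proof (rule inj_onI)
    fix X Y assume X: "X \<in> tangent_space A p" and Y: "Y \<in> tangent_space A p"
      and eq: "pushv A f p X = pushv A f p Y"
    have "D (X c - Y c) = 0"
      using eq push[OF X] push[OF Y] by (simp add: linear_diff[OF lin])
    then have "X c - Y c = 0"
      using zero[of "X c - Y c"] span_zero by metis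
    then show "X = Y"
      by (intro tangent_space_eqI[OF X Y c]) simp
  qed
  show "pushv A f p ` tangent_space A p \<inter> span {f p} = {0}"
    unfolding img using zero linear_0[OF lin] span_zero by fastforce
  define T where "T y = D (fst y) + snd y *\<^sub>R f p" for y :: "'e \<times> real"
  have linT: "linear T"
    unfolding T_def
    by (rule linearI) (simp_all add: linear_add[OF lin] linear_scale[OF lin] algebra_simps)
  have "y = 0" if "T y = 0" for y
  proof -
    have D: "D (fst y) = (- snd y) *\<^sub>R f p"
      using that by (simp add: T_def add_eq_0_iff)
    then have "fst y = 0"
      by (intro zero) (simp add: D span_base span_scale span_neg)
    then show ?thesis using D nz[of p] linear_0[OF lin] by (simp add: prod_eq_iff)
  qed
  then have "inj T"
    using linear_injective_0[OF linT] by blast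
  have "surj (\<iota> \<circ> T)"
    by (rule linear_inj_surj) (use linT \<open>inj T\<close> \<iota> dim in \<open>auto intro: linear_compose inj_compose\<close>)
  have "\<exists>y. w = T y" for w
  proof -
    obtain y where "\<iota> w = (\<iota> \<circ> T) y"
      by (rule surjE[OF \<open>surj (\<iota> \<circ> T)\<close>])
    then have "w = T y" by (intro injD[OF \<iota>(2)]) simp
    then show ?thesis by blast
  qed
  then show "{x + y |x y. x \<in> pushv A f p ` tangent_space A p \<and> y \<in> span {f p}} = UNIV"
    unfolding img span_singleton T_def by blast
qed

end

section \<open>Geometry of a fixed lift\<close>

locale parahyp_lift = atlas A
  for A :: "('m::topological_space, real ^ 'n::finite) chart set" +
  fixes s :: "'m \<Rightarrow> 'n parahyp" and \<xi> :: "'m \<Rightarrow> 'n rvec" and \<nu> :: "'m \<Rightarrow> 'n rcovec"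
  assumes lift: "is_lift A s (\<lambda>p. (- \<xi> p, \<nu> p))"
begin

abbreviation \<sigma> :: "'m \<Rightarrow> 'n amb" where
  "\<sigma> p \<equiv> (- \<xi> p, \<nu> p)"

lemma smooth_lift: "smooth_fun A \<sigma>"
  using lift by (simp add: is_lift_def)

lemma lift_in: "\<sigma> p \<in> pseudohyp"
  using lift by (auto simp: is_lift_def)

lemma proj_lift: "proj_minus (\<sigma> p) = s p"
  using lift by (auto simp: is_lift_def o_def)

lemma smooth_xi: "smooth_fun A \<xi>"
  using smooth_fun_linear[OF bounded_linear_minus[OF bounded_linear_fst] smooth_lift] by simp

lemma smooth_nu: "smooth_fun A \<nu>"
  using smooth_fun_linear[OF bounded_linear_snd smooth_lift] by simp

lemma nu_xi: "blinfun_apply (\<nu> p) (\<xi> p) = 1"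
  using lift_in[of p] by (simp add: pseudohyp_iff blinfun.bilinear_simps)

lemma pushv_lift:
  assumes "X \<in> tangent_space A p"
  shows "pushv A \<sigma> p X = (- pushv A \<xi> p X, pushv A \<nu> p X)"
proof -
  obtain c where c: "c \<in> A" "p \<in> fst c" by (rule chart_at)
  then have x: "snd c p \<in> snd c ` fst c" by blast
  have "((\<lambda>x. (- (\<xi> \<circ> chart_inv c) x, (\<nu> \<circ> chart_inv c) x)) has_derivative
      (\<lambda>u. (- frechet_derivative (\<xi> \<circ> chart_inv c) (at (snd c p)) u,
        frechet_derivative (\<nu> \<circ> chart_inv c) (at (snd c p)) u))) (at (snd c p))"
    by (intro has_derivative_Pair has_derivative_minus smooth_fun_has_derivative[OF _ c(1) x]
        smooth_xi smooth_nu)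
  then have "((\<sigma> \<circ> chart_inv c) has_derivative
      (\<lambda>u. (- frechet_derivative (\<xi> \<circ> chart_inv c) (at (snd c p)) u,
        frechet_derivative (\<nu> \<circ> chart_inv c) (at (snd c p)) u))) (at (snd c p))"
    by (simp add: o_def)
  from pushv_eq[OF c assms this] show ?thesis
    using pushv_chart[OF smooth_xi c assms] pushv_chart[OF smooth_nu c assms] by simp
qed

lemma lift_derivative:
  assumes "c \<in> A" "p \<in> fst c"
  shows "((\<sigma> \<circ> chart_inv c) has_derivative
      frechet_derivative (\<sigma> \<circ> chart_inv c) (at (snd c p))) (at (snd c p))"
  by (rule smooth_fun_has_derivative[OF smooth_lift assms(1)]) (use assms(2) in blast)

lemma pushv_lift_tangent:
  assumes "X \<in> tangent_space A p"
  shows "pushv A \<sigma> p X \<in> pseudohyp_tangent (\<sigma> p)"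
proof -
  obtain c where c: "c \<in> A" "p \<in> fst c" by (rule chart_at)
  have "frechet_derivative (\<sigma> \<circ> chart_inv c) (at (snd c p)) (X c) \<in>
      pseudohyp_tangent ((\<sigma> \<circ> chart_inv c) (snd c p))"
    by (rule derivative_in_pseudohyp_tangent[OF lift_derivative[OF c] open_chart_image[OF c(1)]])
       (use c(2) lift_in in auto)
  then show ?thesis
    using pushv_chart[OF smooth_lift c assms] chart_inv_left[OF c] by simp
qed

text \<open>The chain rule for \<open>s = proj_minus \<circ> \<sigma>\<close>; through it the metric
  and the symplectic form of the quotient are evaluated on the lift.\<close>

lemma pushm_lift:
  assumes "X \<in> tangent_space A p"
  shows "pushm A parahyp_atlas s p X = proj_diff (\<sigma> p) (pushv A \<sigma> p X)"
proof
  fix d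
  show "pushm A parahyp_atlas s p X d = proj_diff (\<sigma> p) (pushv A \<sigma> p X) d"
  proof (cases "d \<in> parahyp_atlas \<and> s p \<in> fst d")
    case True
    obtain c where c: "c \<in> A" "p \<in> fst c" by (rule chart_at)
    let ?S = "frechet_derivative (\<sigma> \<circ> chart_inv c) (at (snd c p))"
    have "((\<lambda>y. snd d (proj_minus ((\<sigma> \<circ> chart_inv c) y))) has_derivative
        (\<lambda>u. proj_diff ((\<sigma> \<circ> chart_inv c) (snd c p)) (?S u) d)) (at (snd c p))"
      by (rule hyp_diff_chart_compose[OF _ _ lift_derivative[OF c] open_chart_image[OF c(1)]])
         (use c True lift_in in \<open>auto simp: chart_inv_left proj_lift\<close>)
    then have "((snd d \<circ> s \<circ> chart_inv c) has_derivative (\<lambda>u. proj_diff (\<sigma> p) (?S u) d)) (at (snd c p))"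
      by (simp add: o_def proj_lift chart_inv_left[OF c])
    from pushv_eq[OF c assms this] show ?thesis
      using True pushv_chart[OF smooth_lift c assms] by (simp add: pushm_def)
  next
    case False
    then show ?thesis
      unfolding pushm_def proj_diff_def proj_lift by auto
  qed
qed

lemma induced_hor_metric_eq:
  assumes "X \<in> tangent_space A p" "Y \<in> tangent_space A p"
  shows "induced_hor_metric A \<sigma> p X Y = metric_parahyp A s p X Y"
  using parahyp_metric_proj_diff[OF lift_in pushv_lift_tangent[OF assms(1)] pushv_lift_tangent[OF assms(2)]]
  by (simp add: induced_hor_metric_def metric_parahyp_def pushm_lift assms proj_lift)

lemma induced_metric_eq:
  assumes "horizontal A \<sigma>" "X \<in> tangent_space A p" "Y \<in> tangent_space A p"
  shows "induced_metric A \<sigma> p X Y = metric_parahyp A s p X Y"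
  using assms induced_hor_metric_eq[OF assms(2,3)]
  by (simp add: horizontal_def induced_metric_def induced_hor_metric_def hor_part_horizontal)

lemma pushv_nu_xi:
  assumes "X \<in> tangent_space A p"
  shows "blinfun_apply (pushv A \<nu> p X) (\<xi> p) = - blinfun_apply (\<nu> p) (pushv A \<xi> p X)"
  using pushv_lift_tangent[OF assms] unfolding pushv_lift[OF assms]
  by (simp add: pseudohyp_tangent_iff blinfun.bilinear_simps)

text \<open>Horizontality consists of two equations, but because the pairing of \<open>\<nu>\<close>
  with \<open>\<xi>\<close> is constant, \<open>pushv_nu_xi\<close> makes one the negative of the
  other.\<close>

lemma horizontal_iff:
  "horizontal A \<sigma> \<longleftrightarrow> (\<forall>p. \<forall>X\<in>tangent_space A p. blinfun_apply (\<nu> p) (pushv A \<xi> p X) = 0)"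
  by (auto simp: horizontal_def pushv_lift horizontal_space_eq blinfun.bilinear_simps pushv_nu_xi)

lemma horizontal_dual:
  assumes "horizontal A \<sigma>"
  shows "dual_immersion A \<xi> \<nu>" "dual_immersion A \<nu> (\<lambda>p. bidual (\<xi> p))"
  using assms unfolding horizontal_iff
  by (simp_all add: dual_immersion_def bidual_apply nu_xi pushv_nu_xi)

context
  assumes lagrangian: "lagrangian A s"
begin

lemma lagrangian_hor_part_phi:
  assumes "X \<in> tangent_space A p" "Y \<in> tangent_space A p"
  shows "amb_metric (hor_part (\<sigma> p) (pushv A \<sigma> p X)) (phi (\<sigma> p) (pushv A \<sigma> p Y)) = 0"
proof -
  have "parahyp_omega (s p) (pushm A parahyp_atlas s p X) (pushm A parahyp_atlas s p Y) = 0"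
    using lagrangian assms by (simp add: lagrangian_def)
  then show ?thesis
    using parahyp_omega_proj_diff[OF lift_in pushv_lift_tangent[OF assms(1)] pushv_lift_tangent[OF assms(2)]]
    by (simp add: pushm_lift assms proj_lift)
qed

lemma lagrangian_sym:
  assumes "X \<in> tangent_space A p" "Y \<in> tangent_space A p"
  shows "blinfun_apply (pushv A \<nu> p X) (pushv A \<xi> p Y) = blinfun_apply (pushv A \<nu> p Y) (pushv A \<xi> p X)"
  using lagrangian_hor_part_phi[OF assms]
    amb_metric_hor_part_phi[OF lift_in pushv_lift_tangent[OF assms(1)] pushv_lift_tangent[OF assms(2)]]
  by (simp add: pushv_lift assms blinfun.bilinear_simps)

text \<open>\<open>phi\<close> takes horizontal values, so the other argument may be replaced by its
  horizontal part; with \<open>X\<close> and \<open>Y\<close> exchanged this is the pulled back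
  symplectic form.\<close>

lemma lagrangian_anti_invariant: "anti_invariant A \<sigma>"
  unfolding anti_invariant_def
proof (intro allI ballI)
  fix p X Y assume X: "X \<in> tangent_space A p" and Y: "Y \<in> tangent_space A p"
  show "amb_metric (phi (\<sigma> p) (pushv A \<sigma> p X)) (pushv A \<sigma> p Y) = 0"
    using lagrangian_hor_part_phi[OF Y X]
      amb_metric_hor_part[OF phi_in_horizontal_space[OF lift_in pushv_lift_tangent[OF X]], of "pushv A \<sigma> p Y"]
    unfolding amb_metric_sym[of "hor_part (\<sigma> p) (pushv A \<sigma> p Y)"] by (rule trans[OF sym, rotated])
qed

text \<open>The symmetry of \<open>\<nu>\<^sub>*X(\<xi>\<^sub>*Y)\<close> makes each of the two halves of the metric determine the other,
  so a horizontal part with a vanishing component is in the radical.\<close>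

lemma nondegenerate_hor_part:
  assumes "nondegenerate A s" and X: "X \<in> tangent_space A p"
    and "fst (hor_part (\<sigma> p) (pushv A \<sigma> p X)) = 0 \<or> snd (hor_part (\<sigma> p) (pushv A \<sigma> p X)) = 0"
  shows "X = (\<lambda>_. 0)"
proof -
  have "metric_parahyp A s p X Y = 0" if Y: "Y \<in> tangent_space A p" for Y
    using lagrangian_hor_part_phi[OF X Y] assms(3)
    unfolding induced_hor_metric_eq[OF X Y, symmetric]
    by (auto simp: induced_hor_metric_def amb_metric_def phi_def blinfun.bilinear_simps)
  then show ?thesis
    using assms(1) X by (auto simp: nondegenerate_def)
qed

text \<open>If the derivative of \<open>\<xi>\<close> along \<open>X\<close> is a multiple of
  \<open>\<xi>\<close>, it is cancelled by the \<open>zeta\<close> component, and the horizontal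
  part loses its first component. For \<open>\<nu>\<close> the same happens in the second component.
  Nondegeneracy then forces \<open>X\<close> to vanish.\<close>

lemma centroaffine_lift:
  assumes "nondegenerate A s"
  shows "centroaffine A \<xi>" "centroaffine A \<nu>"
proof -
  have g: "amb_metric (pushv A \<sigma> p X) (zeta (\<sigma> p)) = blinfun_apply (\<nu> p) (pushv A \<xi> p X)"
    if "X \<in> tangent_space A p" for p X
    by (simp add: pushv_lift[OF that] amb_metric_def zeta_def blinfun.bilinear_simps pushv_nu_xi[OF that])
  show "centroaffine A \<xi>"
  proof (rule centroaffineI[OF smooth_xi, where \<iota> = "\<lambda>w. w"])
    show "\<xi> p \<noteq> 0" for p
      using nu_xi[of p] by (auto simp: blinfun.bilinear_simps)
    fix p X assume X: "X \<in> tangent_space A p" and "pushv A \<xi> p X \<in> span {\<xi> p}"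
    then obtain t where t: "pushv A \<xi> p X = t *\<^sub>R \<xi> p"
      unfolding span_singleton by blast
    have "fst (hor_part (\<sigma> p) (pushv A \<sigma> p X)) = 0"
      unfolding hor_part_def g[OF X]
      by (simp add: pushv_lift[OF X] t zeta_def blinfun.bilinear_simps nu_xi)
    then show "X = (\<lambda>_. 0)"
      using nondegenerate_hor_part[OF assms X] by blast
  qed (simp_all add: linear_id[unfolded id_def])
  show "centroaffine A \<nu>"
  proof (rule centroaffineI[OF smooth_nu, where \<iota> = "\<lambda>\<alpha>. \<chi> k. blinfun_apply \<alpha> (axis k 1)"])
    show "\<nu> p \<noteq> 0" for p
      using nu_xi[of p] by (auto simp: blinfun.bilinear_simps)
    fix p X assume X: "X \<in> tangent_space A p" and "pushv A \<nu> p X \<in> span {\<nu> p}"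
    then obtain t where t: "pushv A \<nu> p X = t *\<^sub>R \<nu> p"
      unfolding span_singleton by blast
    then have "blinfun_apply (\<nu> p) (pushv A \<xi> p X) = - t"
      using pushv_nu_xi[OF X] nu_xi[of p] by (simp add: blinfun.bilinear_simps)
    then have "snd (hor_part (\<sigma> p) (pushv A \<sigma> p X)) = 0"
      unfolding hor_part_def g[OF X]
      by (simp add: pushv_lift[OF X] t zeta_def)
    then show "X = (\<lambda>_. 0)"
      using nondegenerate_hor_part[OF assms X] by blast
  next
    show "linear (\<lambda>\<alpha>::'n rcovec. \<chi> k. blinfun_apply \<alpha> (axis k 1))"
      by (rule linearI) (simp_all add: vec_eq_iff blinfun.bilinear_simps)
    show "inj (\<lambda>\<alpha>::'n rcovec. \<chi> k. blinfun_apply \<alpha> (axis k 1))"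
      by (rule injI) (auto simp: vec_eq_iff intro: rcovec_eqI)
  qed simp
qed

text \<open>The 1-form \<open>X \<mapsto> - \<nu>(\<xi>\<^sub>*X)\<close> is closed because its exterior derivative is, up to a factor, the
  pulled back symplectic form.\<close>

lemma horizontal_potential:
  assumes "simply_connected (UNIV :: 'm set)"
  obtains h where "smooth_fun A h"
    "\<And>p X. X \<in> tangent_space A p \<Longrightarrow> pushv A h p X = - blinfun_apply (\<nu> p) (pushv A \<xi> p X)"
proof -
  define Dx where "Dx c x = frechet_derivative (\<xi> \<circ> chart_inv c) (at x)"
    for c :: "('m, real ^ 'n) chart" and x
  define Dn where "Dn c x = frechet_derivative (\<nu> \<circ> chart_inv c) (at x)"
    for c :: "('m, real ^ 'n) chart" and x
  define \<theta> where "\<theta> c x u = - blinfun_apply ((\<nu> \<circ> chart_inv c) x) (Dx c x u)"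
    for c :: "('m, real ^ 'n) chart" and x u
  \<comment> \<open>The vector representing the covector \<open>\<theta> c x\<close>, which is the
    form in which \<open>closed_form_exact\<close> expects a 1-form.\<close>
  define G where "G c x = (\<Sum>b\<in>Basis. \<theta> c x b *\<^sub>R b)" for c x
  have Dx: "((\<xi> \<circ> chart_inv c) has_derivative Dx c x) (at x)"
    and Dn: "((\<nu> \<circ> chart_inv c) has_derivative Dn c x) (at x)"
    if "c \<in> A" "x \<in> snd c ` fst c" for c x
    unfolding Dx_def Dn_def using that
    by (auto intro!: smooth_fun_has_derivative smooth_xi smooth_nu simp del: o_apply)
  have G: "G c x \<bullet> u = \<theta> c x u" if "c \<in> A" "x \<in> snd c ` fst c" for c x u
  proof -
    have "linear (Dx c x)"
      using Dx[OF that] has_derivative_bounded_linear bounded_linear.linear by blast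
    then have lin: "linear (\<theta> c x)"
      unfolding \<theta>_def
      by (intro linearI) (simp_all add: linear_add linear_scale blinfun.bilinear_simps)
    have "\<theta> c x (\<Sum>b\<in>Basis. (u \<bullet> b) *\<^sub>R b) = (\<Sum>b\<in>Basis. (u \<bullet> b) * \<theta> c x b)"
      by (simp add: linear_sum[OF lin] linear_scale[OF lin])
    moreover have "G c x \<bullet> u = (\<Sum>b\<in>Basis. (u \<bullet> b) * \<theta> c x b)"
      by (simp add: G_def inner_sum_left inner_commute[of u] mult.commute)
    ultimately show ?thesis by (simp only: euclidean_representation)
  qed
  have smooth_\<theta>: "smooth_open (snd c ` fst c) (\<lambda>x. \<theta> c x u)" if c: "c \<in> A" for c u
    unfolding \<theta>_def Dx_def
    by (intro smooth_open_uminus smooth_open_blinfun_apply smooth_open_frechet open_chart_image[OF c])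
       (use smooth_xi smooth_nu c in \<open>simp_all only: smooth_fun_def\<close>)
  have smooth_G: "smooth_open (snd c ` fst c) (G c)" if c: "c \<in> A" for c
    unfolding G_def
    by (intro smooth_open_sum smooth_open_scaleR smooth_open_const smooth_\<theta> open_chart_image c)
  have closed: "frechet_derivative (G c) (at x) u \<bullet> w = frechet_derivative (G c) (at x) w \<bullet> u"
    if c: "c \<in> A" and x: "x \<in> snd c ` fst c" for c x u w
  proof -
    obtain p where p: "p \<in> fst c" "x = snd c p" using x by blast
    define D2 where "D2 u w = frechet_derivative (\<lambda>y. Dx c y w) (at x) u" for u w
    have D2_sym: "D2 u w = D2 w u" for u w
      unfolding D2_def Dx_def
      by (rule second_derivative_symmetric[OF open_chart_image[OF c] _ x])
         (use smooth_xi c in \<open>simp only: smooth_fun_def\<close>)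
    \<comment> \<open>The first summand is symmetric in \<open>u\<close> and \<open>w\<close> as a
      second derivative of \<open>\<xi>\<close>, the second one by the Lagrangian condition.\<close>
    have eq: "frechet_derivative (G c) (at x) u \<bullet> w =
        - (blinfun_apply ((\<nu> \<circ> chart_inv c) x) (D2 u w) + blinfun_apply (Dn c x u) (Dx c x w))" for u w
    proof -
      have "((\<lambda>y. Dx c y w) has_derivative (\<lambda>u. D2 u w)) (at x)"
        unfolding D2_def Dx_def
        by (rule smooth_open_has_derivative[OF smooth_open_frechet x])
           (use smooth_xi c in \<open>simp only: smooth_fun_def\<close>)
      then have 1: "((\<lambda>y. \<theta> c y w) has_derivative (\<lambda>u. - (blinfun_apply ((\<nu> \<circ> chart_inv c) x) (D2 u w) +
          blinfun_apply (Dn c x u) (Dx c x w)))) (at x)"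
        unfolding \<theta>_def
        by (intro has_derivative_minus bounded_bilinear.FDERIV[OF bounded_bilinear_blinfun_apply] Dn[OF c x])
      have "((\<lambda>y. G c y \<bullet> w) has_derivative (\<lambda>u. frechet_derivative (G c) (at x) u \<bullet> w)) (at x)"
        by (rule bounded_linear.has_derivative[OF bounded_linear_inner_left
              smooth_open_has_derivative[OF smooth_G[OF c] x]])
      then have "((\<lambda>y. \<theta> c y w) has_derivative (\<lambda>u. frechet_derivative (G c) (at x) u \<bullet> w)) (at x)"
        by (rule has_derivative_transform_within_open[OF _ open_chart_image[OF c] x]) (simp add: G[OF c])
      from fun_cong[OF has_derivative_unique[OF this 1], of u] show ?thesis .
    qed
    have push: "Dx c x u = pushv A \<xi> p (tvec_of p c u)" "Dn c x u = pushv A \<nu> p (tvec_of p c u)" for u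
      unfolding Dx_def Dn_def p(2)
      using pushv_chart[OF smooth_xi c p(1) tvec_of_in[OF c p(1)]]
        pushv_chart[OF smooth_nu c p(1) tvec_of_in[OF c p(1)]] tvec_of_self[OF c p(1)] by simp_all
    show ?thesis
      unfolding eq push using D2_sym[of u w] lagrangian_sym[OF tvec_of_in tvec_of_in, OF c p(1) c p(1)]
      by simp
  qed
  have trans: "G d (snd d p) \<bullet> trans_deriv c d p u = G c (snd c p) \<bullet> u"
    if c: "c \<in> A" "p \<in> fst c" and d: "d \<in> A" "p \<in> fst d" for c d p u
  proof -
    have xc: "snd c p \<in> snd c ` fst c" and xd: "snd d p \<in> snd d ` fst d" using c d by blast+
    have "(\<lambda>u. Dx d (snd d p) (trans_deriv c d p u)) = Dx c (snd c p)"
      by (rule has_derivative_unique[OF has_derivative_change_chart[OF c(1) d(1) c(2) d(2) Dx[OF d(1) xd]]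
            Dx[OF c(1) xc]])
    from fun_cong[OF this, of u] show ?thesis
      by (simp add: G[OF c(1) xc] G[OF d(1) xd] \<theta>_def chart_inv_left[OF c] chart_inv_left[OF d])
  qed
  obtain h :: "'m \<Rightarrow> real" where h: "\<And>c p. c \<in> A \<Longrightarrow> p \<in> fst c \<Longrightarrow>
      ((h \<circ> chart_inv c) has_derivative (\<lambda>u. G c (snd c p) \<bullet> u)) (at (snd c p))"
    using closed_form_exact[OF assms smooth_G closed trans] by blast
  show thesis
  proof (rule that[of h])
    show "smooth_fun A h"
      unfolding smooth_fun_def
    proof
      fix c assume c: "c \<in> A"
      show "smooth_open (snd c ` fst c) (h \<circ> chart_inv c)"
      proof (rule smooth_open_derivI[OF open_chart_image[OF c]])
        show "((h \<circ> chart_inv c) has_derivative \<theta> c x) (at x)" if x: "x \<in> snd c ` fst c" for x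
        proof -
          obtain p where p: "p \<in> fst c" "x = snd c p" using x by blast
          show ?thesis
            by (rule has_derivative_eq_rhs[OF h[OF c p(1), folded p(2)]]) (simp add: fun_eq_iff G[OF c x])
        qed
        show "smooth_open (snd c ` fst c) (\<lambda>x. \<theta> c x v)" for v by (rule smooth_\<theta>[OF c])
      qed
    qed
    fix p X assume X: "X \<in> tangent_space A p"
    obtain c where c: "c \<in> A" "p \<in> fst c" by (rule chart_at)
    then have x: "snd c p \<in> snd c ` fst c" by blast
    show "pushv A h p X = - blinfun_apply (\<nu> p) (pushv A \<xi> p X)"
      using pushv_eq[OF c X h[OF c]] pushv_chart[OF smooth_xi c X]
      by (simp add: G[OF c(1) x] \<theta>_def Dx_def chart_inv_left[OF c])
  qed
qed

end

section \<open>Rescaled lifts and the horizontal ones among them\<close>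

lemma lift_mu_flow: "lift_mu \<xi> \<nu> \<mu> p = flow (\<mu> p) (\<sigma> p)"
  by (simp add: lift_mu_def scaled_def flow_def)

lemma smooth_fun_uminus: "smooth_fun A \<mu> \<Longrightarrow> smooth_fun A (\<lambda>p. - \<mu> p)" for \<mu> :: "'m \<Rightarrow> real"
  by (rule smooth_fun_linear[OF bounded_linear_minus[OF bounded_linear_ident]])

lemma lift_mu_lift:
  assumes "smooth_fun A \<mu>"
  shows "parahyp_lift A s (scaled \<mu> \<xi>) (scaled (\<lambda>p. - \<mu> p) \<nu>)"
proof unfold_locales
  have "smooth_fun A (\<lambda>p. (- scaled \<mu> \<xi> p, scaled (\<lambda>p. - \<mu> p) \<nu> p))"
    by (intro smooth_fun_Pair smooth_fun_linear[OF bounded_linear_minus[OF bounded_linear_ident]]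
        smooth_fun_scaled smooth_fun_uminus smooth_xi smooth_nu assms)
  moreover have "(- scaled \<mu> \<xi> p, scaled (\<lambda>p. - \<mu> p) \<nu> p) = flow (\<mu> p) (\<sigma> p)" for p
    using lift_mu_flow[of \<mu> p] by (simp add: lift_mu_def)
  ultimately show "is_lift A s (\<lambda>p. (- scaled \<mu> \<xi> p, scaled (\<lambda>p. - \<mu> p) \<nu> p))"
    using flow_pseudohyp[OF lift_in] by (auto simp: is_lift_def fun_eq_iff proj_minus_flow proj_lift)
qed

lemma horizontal_lift_mu_iff:
  assumes "smooth_fun A \<mu>"
  shows "horizontal A (lift_mu \<xi> \<nu> \<mu>) \<longleftrightarrow> (\<forall>p. \<forall>X\<in>tangent_space A p.
    pushv A \<mu> p X = - blinfun_apply (\<nu> p) (pushv A \<xi> p X))"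
proof -
  interpret mu: parahyp_lift A s "scaled \<mu> \<xi>" "scaled (\<lambda>p. - \<mu> p) \<nu>"
    by (rule lift_mu_lift[OF assms])
  have "blinfun_apply (scaled (\<lambda>p. - \<mu> p) \<nu> p) (pushv A (scaled \<mu> \<xi>) p X) =
      blinfun_apply (\<nu> p) (pushv A \<xi> p X) + pushv A \<mu> p X" if "X \<in> tangent_space A p" for p X
    unfolding pushv_scaled[OF assms smooth_xi that] scaled_def
    by (simp add: blinfun.bilinear_simps nu_xi exp_minus field_simps)
  then have "blinfun_apply (scaled (\<lambda>p. - \<mu> p) \<nu> p) (pushv A (scaled \<mu> \<xi>) p X) = 0 \<longleftrightarrow>
      pushv A \<mu> p X = - blinfun_apply (\<nu> p) (pushv A \<xi> p X)" if "X \<in> tangent_space A p" for p X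
    using that by (simp only:) linarith
  moreover have "lift_mu \<xi> \<nu> \<mu> = (\<lambda>p. (- scaled \<mu> \<xi> p, scaled (\<lambda>p. - \<mu> p) \<nu> p))"
    by (simp add: fun_eq_iff lift_mu_def)
  ultimately show ?thesis
    by (simp add: mu.horizontal_iff cong: ball_cong)
qed

lemma lift_iff:
  "is_lift A s \<tau> \<longleftrightarrow> (\<exists>\<mu>. smooth_fun A \<mu> \<and> \<tau> = lift_mu \<xi> \<nu> \<mu>)"
proof
  assume "\<exists>\<mu>. smooth_fun A \<mu> \<and> \<tau> = lift_mu \<xi> \<nu> \<mu>"
  then show "is_lift A s \<tau>"
    using parahyp_lift.lift[OF lift_mu_lift] by (auto simp: lift_mu_def[abs_def])
next
  assume \<tau>: "is_lift A s \<tau>"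
  \<comment> \<open>If \<open>\<tau> p\<close> is reached from \<open>\<sigma> p\<close> in flow
    time \<open>t\<close>, this number is \<open>exp t\<close>, because \<open>\<nu> p\<close> takes
    the value 1 on \<open>\<xi> p\<close>. It depends smoothly on \<open>p\<close>, so its logarithm
    is a smooth choice of the flow time.\<close>
  define r where "r p = blinfun_apply (\<nu> p) (- fst (\<tau> p))" for p
  have ex: "r p > 0 \<and> \<tau> p = flow (ln (r p)) (\<sigma> p)" for p
  proof -
    have "\<tau> p \<in> pseudohyp" "proj_minus (\<sigma> p) = proj_minus (\<tau> p)"
      using \<tau> proj_lift[of p] by (auto simp: is_lift_def)
    then obtain t where t: "\<tau> p = flow t (\<sigma> p)"
      using proj_minus_eqD[OF lift_in] by blast
    then have "r p = exp t"
      by (simp add: r_def flow_def blinfun.bilinear_simps nu_xi)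
    then show ?thesis using t by simp
  qed
  have "smooth_fun A (\<lambda>p. ln (r p))"
    unfolding smooth_fun_def
  proof
    fix c assume c: "c \<in> A"
    have \<nu>: "smooth_open (snd c ` fst c) (\<nu> \<circ> chart_inv c)"
      and \<tau>': "smooth_open (snd c ` fst c) (\<tau> \<circ> chart_inv c)"
      using smooth_nu \<tau> c by (simp_all only: smooth_fun_def is_lift_def)
    have "smooth_open (snd c ` fst c) (\<lambda>x. ln (blinfun_apply ((\<nu> \<circ> chart_inv c) x) (- fst ((\<tau> \<circ> chart_inv c) x))))"
      by (intro smooth_open_ln smooth_open_blinfun_apply smooth_open_uminus smooth_open_fst open_chart_image[OF c]
          \<nu> \<tau>') (use ex in \<open>simp add: r_def\<close>)
    then show "smooth_open (snd c ` fst c) ((\<lambda>p. ln (r p)) \<circ> chart_inv c)"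
      by (simp add: o_def r_def)
  qed
  moreover have "\<tau> = lift_mu \<xi> \<nu> (\<lambda>p. ln (r p))"
    using ex by (simp add: fun_eq_iff lift_mu_flow)
  ultimately show "\<exists>\<mu>. smooth_fun A \<mu> \<and> \<tau> = lift_mu \<xi> \<nu> \<mu>" by blast
qed

text \<open>Horizontality prescribes the differential of \<open>\<mu>\<close>. The potential
  \<open>h\<close> is one solution, adding constants gives others, and on a connected manifold the
  difference of two solutions has zero derivative and is constant.\<close>

lemma horizontal_lift_mu_set:
  assumes "lagrangian A s" "simply_connected (UNIV :: 'm set)" "connected (UNIV :: 'm set)"
  obtains h where
    "{\<mu>. smooth_fun A \<mu> \<and> horizontal A (lift_mu \<xi> \<nu> \<mu>)} = {\<lambda>p. h p + c | c. True}"
proof -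
  obtain h where h: "smooth_fun A h"
    "\<And>p X. X \<in> tangent_space A p \<Longrightarrow> pushv A h p X = - blinfun_apply (\<nu> p) (pushv A \<xi> p X)"
    using horizontal_potential[OF assms(1,2)] by blast
  have hc: "smooth_fun A (\<lambda>p. h p + k)" "horizontal A (lift_mu \<xi> \<nu> (\<lambda>p. h p + k))" for k
  proof -
    show s: "smooth_fun A (\<lambda>p. h p + k)"
      unfolding smooth_fun_def
    proof
      fix c assume c: "c \<in> A"
      have "smooth_open (snd c ` fst c) (\<lambda>x. (h \<circ> chart_inv c) x + k)"
        by (intro smooth_open_add smooth_open_const open_chart_image[OF c])
           (use h(1) c in \<open>simp only: smooth_fun_def\<close>)
      then show "smooth_open (snd c ` fst c) ((\<lambda>p. h p + k) \<circ> chart_inv c)"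
        by (simp add: o_def)
    qed
    show "horizontal A (lift_mu \<xi> \<nu> (\<lambda>p. h p + k))"
      unfolding horizontal_lift_mu_iff[OF s]
    proof (intro allI ballI)
      fix p X assume X: "X \<in> tangent_space A p"
      obtain c where c: "c \<in> A" "p \<in> fst c" by (rule chart_at)
      have "((\<lambda>x. (h \<circ> chart_inv c) x + k) has_derivative
          (\<lambda>u. frechet_derivative (h \<circ> chart_inv c) (at (snd c p)) u + 0)) (at (snd c p))"
        by (intro has_derivative_add has_derivative_const smooth_fun_has_derivative[OF h(1) c(1)])
           (use c in blast)
      then have "((\<lambda>p. h p + k) \<circ> chart_inv c has_derivative
          frechet_derivative (h \<circ> chart_inv c) (at (snd c p))) (at (snd c p))"
        by (simp add: o_def)
      from pushv_eq[OF c X this]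
      show "pushv A (\<lambda>p. h p + k) p X = - blinfun_apply (\<nu> p) (pushv A \<xi> p X)"
        using pushv_chart[OF h(1) c X] h(2)[OF X] by simp
    qed
  qed
  have "\<exists>k. \<mu> = (\<lambda>p. h p + k)" if \<mu>: "smooth_fun A \<mu>" "horizontal A (lift_mu \<xi> \<nu> \<mu>)" for \<mu>
  proof -
    have zero: "(((\<lambda>p. \<mu> p - h p) \<circ> chart_inv c) has_derivative (\<lambda>u. 0)) (at (snd c p))"
      if c: "c \<in> A" "p \<in> fst c" for c p
    proof -
      have x: "snd c p \<in> snd c ` fst c" using c by blast
      have "frechet_derivative (\<mu> \<circ> chart_inv c) (at (snd c p)) u =
          frechet_derivative (h \<circ> chart_inv c) (at (snd c p)) u" for u
        using pushv_chart[OF \<mu>(1) c tvec_of_in[OF c]] pushv_chart[OF h(1) c tvec_of_in[OF c]]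
          tvec_of_self[OF c] h(2)[OF tvec_of_in[OF c]] \<mu>(2) tvec_of_in[OF c]
        unfolding horizontal_lift_mu_iff[OF \<mu>(1)] by metis
      moreover have "((\<lambda>x. (\<mu> \<circ> chart_inv c) x - (h \<circ> chart_inv c) x) has_derivative
          (\<lambda>u. frechet_derivative (\<mu> \<circ> chart_inv c) (at (snd c p)) u -
            frechet_derivative (h \<circ> chart_inv c) (at (snd c p)) u)) (at (snd c p))"
        by (intro has_derivative_diff smooth_fun_has_derivative[OF _ c(1) x] \<mu>(1) h(1))
      ultimately show ?thesis by (simp add: o_def)
    qed
    obtain a :: 'm where True by blast
    have "\<mu> p - h p = \<mu> a - h a" for p
      using zero_derivative_const[OF assms(3) zero, of p a] by simp
    then have "\<mu> = (\<lambda>p. h p + (\<mu> a - h a))"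
      by (simp add: fun_eq_iff algebra_simps)
    then show ?thesis by blast
  qed
  then show thesis
    using hc by (intro that[of h]) blast
qed

end

section \<open>A global section of the quotient map\<close>

definition unit_rep :: "'n::finite amb \<Rightarrow> 'n amb" where
  "unit_rep z = flow (- ln (fst z \<bullet> fst z) / 2) z"

lemma fst_inner_pos:
  assumes "z \<in> pseudohyp"
  shows "fst z \<bullet> fst z > 0"
  using assms by (auto simp: pseudohyp_iff blinfun.bilinear_simps)

text \<open>The flow for time \<open>t\<close> multiplies the squared length
  \<open>fst z \<bullet> fst z\<close> by \<open>exp (2 * t)\<close>; the factor 1/2 in
  \<open>unit_rep\<close> turns this into the compensating shift by \<open>- t\<close>.\<close>

lemma unit_rep_flow:
  assumes "z \<in> pseudohyp"
  shows "unit_rep (flow t z) = unit_rep z"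
proof -
  have "fst (flow t z) \<bullet> fst (flow t z) = exp (2 * t) * (fst z \<bullet> fst z)"
    by (simp add: flow_def mult.assoc[symmetric] mult_exp_exp)
  then have "ln (fst (flow t z) \<bullet> fst (flow t z)) = 2 * t + ln (fst z \<bullet> fst z)"
    using fst_inner_pos[OF assms] by (simp add: ln_mult)
  then show ?thesis
    by (simp add: unit_rep_def flow_flow field_simps)
qed

text \<open>Choosing in each orbit the representative with \<open>\<bar>v\<bar> = 1\<close> is a global smooth section of the
  quotient map, so every smooth map into the quotient lifts.\<close>

lemma lift_exists:
  fixes A :: "('m::topological_space, real ^ 'n::finite) chart set"
  assumes "smooth_atlas A" "smooth_map A parahyp_atlas s"
  shows "\<exists>\<sigma>. is_lift A s \<sigma>"
proof -
  interpret atlas A by unfold_locales (rule assms(1))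
  define \<sigma> where "\<sigma> p = unit_rep (repr (s p))" for p
  have "smooth_fun A \<sigma>"
    unfolding smooth_fun_def
  proof (intro ballI smooth_open_locally)
    fix c x assume c: "c \<in> A" and x: "x \<in> snd c ` fst c"
    define p where "p = chart_inv c x"
    have p: "p \<in> fst c" "x = snd c p"
      using chart_inv_mem[OF c x] chart_inv_right[OF c x] by (simp_all add: p_def)
    obtain i e \<epsilon> where "affine_chart i e \<epsilon>" and h: "repr (s p) \<in> affine_chart.half i \<epsilon>"
      by (rule affine_chart_at[OF repr(1)])
    then interpret ac: affine_chart i e \<epsilon> by simp
    let ?N = "snd c ` (fst c \<inter> s -` ac.dom)"
    have "open (s -` ac.dom)"
      using assms(2) ac.open_dom_inter[of UNIV]
      by (auto simp: smooth_map_def intro: open_vimage)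
    then have N: "open ?N" by (rule open_chart_image_Int[OF c])
    have "s p \<in> ac.dom"
      using ac.proj_minus_dom[OF repr(1)] h repr(2) by metis
    then have xN: "x \<in> ?N" using p by blast
    have "smooth_open ?N (snd (ac.dom, ac.chart_fun) \<circ> s \<circ> chart_inv c)"
      using assms(2) c ac.chart_in_atlas unfolding smooth_map_def by force
    then have f: "smooth_open ?N (\<lambda>y. ac.chart_fun (s (chart_inv c y)))"
      by (simp add: o_def)
    have "smooth_open UNIV (\<lambda>y. unit_rep (ac.sect y))"
      unfolding unit_rep_def flow_def
      by (intro smooth_open_Pair smooth_open_scaleR smooth_open_exp smooth_open_uminus
          smooth_open_divide_const smooth_open_ln smooth_open_inner smooth_open_fst smooth_open_snd
          ac.smooth_sect open_UNIV fst_inner_pos ac.sect_pseudohyp)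
    from smooth_open_compose[OF N open_UNIV f this]
    have "smooth_open ?N (\<lambda>y. unit_rep (ac.sect (ac.chart_fun (s (chart_inv c y)))))"
      by simp
    \<comment> \<open>\<open>repr\<close> is chosen without regard to smoothness. As
      \<open>unit_rep\<close> is constant on orbits, \<open>repr\<close> may be replaced over
      \<open>?N\<close> by the smooth section of an affine chart.\<close>
    then have "smooth_open ?N (\<sigma> \<circ> chart_inv c)"
    proof (rule smooth_open_cong[OF N, rotated])
      fix y assume "y \<in> ?N"
      then have "s (chart_inv c y) \<in> ac.dom" using chart_inv_left[OF c] by auto
      then have "proj_minus (repr (s (chart_inv c y))) =
          proj_minus (ac.sect (ac.chart_fun (s (chart_inv c y))))"
        by (simp add: repr(2) ac.proj_sect_chart_fun)
      then obtain t where "ac.sect (ac.chart_fun (s (chart_inv c y))) = flow t (repr (s (chart_inv c y)))"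
        by (rule proj_minus_eqD[OF repr(1) ac.sect_pseudohyp])
      then show "unit_rep (ac.sect (ac.chart_fun (s (chart_inv c y)))) = (\<sigma> \<circ> chart_inv c) y"
        by (simp add: \<sigma>_def unit_rep_flow repr(1))
    qed
    then show "\<exists>U. open U \<and> x \<in> U \<and> smooth_open U (\<sigma> \<circ> chart_inv c)"
      using N xN by blast
  qed
  moreover have "\<sigma> p \<in> pseudohyp" "proj_minus (\<sigma> p) = s p" for p
    by (simp_all add: \<sigma>_def unit_rep_def flow_pseudohyp repr proj_minus_flow)
  ultimately have "is_lift A s \<sigma>"
    by (auto simp: is_lift_def)
  then show ?thesis by blast
qed

text \<open>For a lift that is not horizontal the full pullback of \<open>g\<close> contains in
  addition the square of the vertical 1-form, so the agreement of metrics for every lift concerns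
  \<open>induced_hor_metric\<close>, and \<open>induced_metric\<close> appears for horizontal lifts.
  \<open>bidual\<close> identifies a vector space with its double dual, so that duality can be
  stated in both directions. The set equation expresses at once the existence of a horizontal
  rescaling and its uniqueness up to a constant.\<close>

theorem theoremC:
  fixes A :: "('m::{second_countable_topology, t2_space}, real ^ 'n::finite) chart set"
    and s :: "'m \<Rightarrow> 'n parahyp"
  assumes "smooth_atlas A"
    and "connected (UNIV :: 'm set)"
    and "simply_connected (UNIV :: 'm set)"
    and "immersion_parahyp A s"
    and "lagrangian A s"
    and "nondegenerate A s"
  shows "(\<exists>\<sigma>. is_lift A s \<sigma>) \<and>
    (\<forall>\<xi> \<nu>. is_lift A s (\<lambda>p. (- \<xi> p, \<nu> p)) \<longrightarrow>
      (\<forall>\<sigma>. is_lift A s \<sigma> \<longleftrightarrow> (\<exists>\<mu>. smooth_fun A \<mu> \<and> \<sigma> = lift_mu \<xi> \<nu> \<mu>)) \<and>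
      (\<forall>\<mu>. smooth_fun A \<mu> \<longrightarrow>
         centroaffine A (scaled \<mu> \<xi>) \<and> centroaffine A (scaled (\<lambda>p. - \<mu> p) \<nu>)) \<and>
      (\<forall>\<mu>. smooth_fun A \<mu> \<longrightarrow>
         anti_invariant A (lift_mu \<xi> \<nu> \<mu>) \<and>
         (\<forall>p. \<forall>X\<in>tangent_space A p. \<forall>Y\<in>tangent_space A p.
            induced_hor_metric A (lift_mu \<xi> \<nu> \<mu>) p X Y = metric_parahyp A s p X Y) \<and>
         (horizontal A (lift_mu \<xi> \<nu> \<mu>) \<longrightarrow>
           (\<forall>p. \<forall>X\<in>tangent_space A p. \<forall>Y\<in>tangent_space A p.
              induced_metric A (lift_mu \<xi> \<nu> \<mu>) p X Y = metric_parahyp A s p X Y))) \<and>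
      (\<exists>\<mu>. {\<mu>'. smooth_fun A \<mu>' \<and> horizontal A (lift_mu \<xi> \<nu> \<mu>')} = {\<lambda>p. \<mu> p + c | c. True}) \<and>
      (\<forall>\<mu>. smooth_fun A \<mu> \<and> horizontal A (lift_mu \<xi> \<nu> \<mu>) \<longrightarrow>
         dual_immersion A (scaled \<mu> \<xi>) (scaled (\<lambda>p. - \<mu> p) \<nu>) \<and>
         dual_immersion A (scaled (\<lambda>p. - \<mu> p) \<nu>) (\<lambda>p. bidual (scaled \<mu> \<xi> p)) \<and>
         (\<forall>\<mu>'. smooth_fun A \<mu>' \<and> horizontal A (lift_mu \<xi> \<nu> \<mu>') \<longrightarrow>
            (\<exists>k>0. (\<forall>p. scaled \<mu>' \<xi> p = k *\<^sub>R scaled \<mu> \<xi> p) \<and>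
                   (\<forall>p. scaled (\<lambda>p. - \<mu>' p) \<nu> p = (1 / k) *\<^sub>R scaled (\<lambda>p. - \<mu> p) \<nu> p)))))"
proof (rule conjI, goal_cases)
  case 1
  show ?case
    using lift_exists[OF assms(1)] assms(4) by (simp add: immersion_parahyp_def)
next
  case 2
  show ?case
  proof (intro allI impI, goal_cases)
    case (1 \<xi> \<nu>)
    interpret parahyp_lift A s \<xi> \<nu>
      by unfold_locales (rule assms(1), rule 1)
    have eq: "lift_mu \<xi> \<nu> \<mu> = (\<lambda>p. (- scaled \<mu> \<xi> p, scaled (\<lambda>p. - \<mu> p) \<nu> p))" for \<mu>
      by (simp add: fun_eq_iff lift_mu_def)
    obtain h where h:
      "{\<mu>'. smooth_fun A \<mu>' \<and> horizontal A (lift_mu \<xi> \<nu> \<mu>')} = {\<lambda>p. h p + c | c. True}"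
      by (rule horizontal_lift_mu_set[OF assms(5,3,2)])
    have homothety: "\<exists>k>0. (\<forall>p. scaled \<mu>' \<xi> p = k *\<^sub>R scaled \<mu> \<xi> p) \<and>
        (\<forall>p. scaled (\<lambda>p. - \<mu>' p) \<nu> p = (1 / k) *\<^sub>R scaled (\<lambda>p. - \<mu> p) \<nu> p)"
      if \<mu>: "smooth_fun A \<mu> \<and> horizontal A (lift_mu \<xi> \<nu> \<mu>)"
        and \<mu>': "smooth_fun A \<mu>' \<and> horizontal A (lift_mu \<xi> \<nu> \<mu>')" for \<mu> \<mu>'
    proof -
      obtain a where a: "\<mu> = (\<lambda>p. h p + a)" using h \<mu> by blast
      obtain b where b: "\<mu>' = (\<lambda>p. h p + b)" using h \<mu>' by blast
      \<comment> \<open>Horizontal rescalings differ by the constant \<open>b - a\<close>, which is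
        the logarithm of the homothety factor of the vectors; covectors scale with the opposite sign
        and hence by the inverse factor.\<close>
      have "1 / exp (b - a) = exp (a - b)" using exp_minus[of "b - a"] by (simp add: inverse_eq_divide)
      then show ?thesis
        by (intro exI[of _ "exp (b - a)"]) (simp add: a b scaled_def mult_exp_exp)
    qed
    show ?case
    proof (intro conjI allI impI ballI)
      show "is_lift A s \<tau> \<longleftrightarrow> (\<exists>\<mu>. smooth_fun A \<mu> \<and> \<tau> = lift_mu \<xi> \<nu> \<mu>)" for \<tau>
        by (rule lift_iff)
      show "\<exists>\<mu>. {\<mu>'. smooth_fun A \<mu>' \<and> horizontal A (lift_mu \<xi> \<nu> \<mu>')} = {\<lambda>p. \<mu> p + c | c. True}"
        by (rule exI[of _ h]) (rule h)
      show "\<exists>k>0. (\<forall>p. scaled \<mu>' \<xi> p = k *\<^sub>R scaled \<mu> \<xi> p) \<and>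
          (\<forall>p. scaled (\<lambda>p. - \<mu>' p) \<nu> p = (1 / k) *\<^sub>R scaled (\<lambda>p. - \<mu> p) \<nu> p)"
        if "smooth_fun A \<mu> \<and> horizontal A (lift_mu \<xi> \<nu> \<mu>)"
          "smooth_fun A \<mu>' \<and> horizontal A (lift_mu \<xi> \<nu> \<mu>')" for \<mu> \<mu>'
        by (rule homothety[OF that])
    next
      fix \<mu> :: "'m \<Rightarrow> real" assume "smooth_fun A \<mu>"
      then interpret mu: parahyp_lift A s "scaled \<mu> \<xi>" "scaled (\<lambda>p. - \<mu> p) \<nu>"
        by (rule lift_mu_lift)
      show "centroaffine A (scaled \<mu> \<xi>)" "centroaffine A (scaled (\<lambda>p. - \<mu> p) \<nu>)"
        by (rule mu.centroaffine_lift[OF assms(5,6)])+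
      show "anti_invariant A (lift_mu \<xi> \<nu> \<mu>)"
        unfolding eq by (rule mu.lagrangian_anti_invariant[OF assms(5)])
      fix p X Y assume XY: "X \<in> tangent_space A p" "Y \<in> tangent_space A p"
      show "induced_hor_metric A (lift_mu \<xi> \<nu> \<mu>) p X Y = metric_parahyp A s p X Y"
        unfolding eq by (rule mu.induced_hor_metric_eq[OF XY])
      show "induced_metric A (lift_mu \<xi> \<nu> \<mu>) p X Y = metric_parahyp A s p X Y"
        if "horizontal A (lift_mu \<xi> \<nu> \<mu>)"
        using that XY unfolding eq by (rule mu.induced_metric_eq)
    next
      fix \<mu> :: "'m \<Rightarrow> real" assume \<mu>: "smooth_fun A \<mu> \<and> horizontal A (lift_mu \<xi> \<nu> \<mu>)"
      then interpret mu: parahyp_lift A s "scaled \<mu> \<xi>" "scaled (\<lambda>p. - \<mu> p) \<nu>"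
        by (intro lift_mu_lift) blast
      show "dual_immersion A (scaled \<mu> \<xi>) (scaled (\<lambda>p. - \<mu> p) \<nu>)"
        "dual_immersion A (scaled (\<lambda>p. - \<mu> p) \<nu>) (\<lambda>p. bidual (scaled \<mu> \<xi> p))"
        using \<mu> unfolding eq by (blast intro: mu.horizontal_dual)+
    qed
  qed
qed

end
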